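(* Let $(X_n)_{n\ge 1}$ be a sequence of generalized random fields. If the characteristic functionals $\mathcal{L}_{X_n}$ converge pointwise on $\mathcal{S}(\mathbb{R}^d)$ to a functional $\mathcal{L}:\mathcal{S}(\mathbb{R}^d)\to\mathbb{C}$ which is continuous at $0$, then there exists a generalized random field $X$ such that $\mathcal{L}_X=\mathcal{L}$ and $X_n$ converges in distribution to $X$ with respect to the strong topology.
   Context: Fix an integer $d\ge 1$. $\mathcal{S}=\mathcal{S}(\mathbb{R}^d)$ is the (real) Schwartz space of rapidly decreasing $C^\infty$ functions $f:\mathbb{R}^d\to\mathbb{R}$ with its usual Fréchet topology, generated by the semi-norms $\|f\|_{m,j}=\sup_{x}(1+|x|)^m|D^jf(x)|$, $m\in\mathbb{N}$, $j\in\mathbb{N}^d$. $\mathcal{S}'$ is its topological dual (tempered distributions), with bracket $(F,f)=F(f)$. The strong topology $\tau_s$ on $\mathcal{S}'$ is generated by the semi-norms $q_B(F)=\sup_{f\in B}|(F,f)|$, $B\subset\mathcal{S}$ bounded (in the sense of topological vector spaces). $\mathcal{B}(\mathcal{S}')$ is the Borel $\sigma$-field of $(\mathcal{S}',\tau_s)$ (it coincides with the Borel $\sigma$-field of the weak topology, generated by the semi-norms $|(\cdot,f)|$, $f\in\mathcal{S}$). A generalized random field is a random variable $X$, defined on some probability space, with values in $(\mathcal{S}',\mathcal{B}(\mathcal{S}'))$; its law is denoted $\mathbb{P}_X$, and its characteristic functional is $\mathcal{L}_X(f)=\mathbb{E}(e^{iX(f)})=\int_{\mathcal{S}'}e^{iF(f)}\,d\mathbb{P}_X(F)$,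 $f\in\mathcal{S}$. $X_n$ converges in distribution to $X$ with respect to the strong topology if $\lim_{n\to\infty}\int_{\mathcal{S}'}\varphi\,d\mathbb{P}_{X_n}=\int_{\mathcal{S}'}\varphi\,d\mathbb{P}_X$ for every bounded $\tau_s$-continuous function $\varphi:\mathcal{S}'\to\mathbb{R}$. *)

theory Defs
  imports "HOL-Probability.Probability"
begin

section \<open>Topologies generated by semi-norms, bounded sets\<close>

definition seminorm_open :: "('a::ab_group_add \<Rightarrow> real) set \<Rightarrow> 'a set \<Rightarrow> bool" where
  "seminorm_open P = generate_topology {{y. p (y - x) < e} | p x e. p \<in> P \<and> 0 < e}"

text \<open>Boundedness in the sense of topological vector spaces (von Neumann): absorbed by every
  neighbourhood of the origin.\<close>

definition tvs_bounded :: "'a::{real_vector, topological_space} set \<Rightarrow> bool" where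
  "tvs_bounded B \<longleftrightarrow>
     (\<forall>U. open U \<and> 0 \<in> U \<longrightarrow> (\<exists>s>0. \<forall>t>s. B \<subseteq> (\<lambda>x. t *\<^sub>R x) ` U))"


section \<open>Smooth functions and partial derivatives\<close>

definition partial_deriv :: "'n \<Rightarrow> (real ^ 'n::finite \<Rightarrow> real) \<Rightarrow> real ^ 'n \<Rightarrow> real" where
  "partial_deriv i f x = frechet_derivative f (at x) (axis i 1)"

abbreviation iter_partial :: "'n list \<Rightarrow> (real ^ 'n::finite \<Rightarrow> real) \<Rightarrow> real ^ 'n \<Rightarrow> real" where
  "iter_partial l f \<equiv> foldr partial_deriv l f"

text \<open>\<open>C\<^sup>\<infinity>\<close>: every iterated partial derivative is (Frechet) differentiable, hence also continuous.\<close>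

definition smooth :: "(real ^ 'n::finite \<Rightarrow> real) \<Rightarrow> bool" where
  "smooth f \<longleftrightarrow> (\<forall>l. iter_partial l f differentiable_on UNIV)"

text \<open>The index type carries no order, so some order of differentiation realising the
  multi-index is chosen; for smooth functions all orders give the same result.\<close>

definition multi_deriv :: "nat ^ 'n \<Rightarrow> (real ^ 'n::finite \<Rightarrow> real) \<Rightarrow> real ^ 'n \<Rightarrow> real" where
  "multi_deriv j f = iter_partial (SOME l. \<forall>i. count_list l i = j $ i) f"

lemma ex_list_multi_index: "\<exists>l. \<forall>i. count_list l i = (j :: nat ^ 'n::finite) $ i"
proof -
  obtain l where l: "mset l = Abs_multiset (($) j)"
    using ex_mset by blast
  have "count_list l i = j $ i" for i
    using arg_cong[OF l, of "\<lambda>m. count m i"] by (simp add: count_mset count_list_eq_length_filter)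
  then show ?thesis by blast
qed

lemma iter_partial_zero: "iter_partial l (\<lambda>_. 0) = (\<lambda>_. 0)"
proof (induction l)
  case (Cons i l)
  then show ?case by (intro ext) (simp add: partial_deriv_def[of i])
qed simp

lemma iter_partial_add:
  assumes "smooth f" "smooth g"
  shows "iter_partial l (\<lambda>x. f x + g x) = (\<lambda>x. iter_partial l f x + iter_partial l g x)"
proof (induction l)
  case (Cons i l)
  have "frechet_derivative (\<lambda>x. iter_partial l f x + iter_partial l g x) (at x) =
      (\<lambda>h. frechet_derivative (iter_partial l f) (at x) h
         + frechet_derivative (iter_partial l g) (at x) h)" for x
    using assms
    by (intro frechet_derivative_at[symmetric] has_derivative_add)
       (auto simp: smooth_def differentiable_on_def frechet_derivative_works[symmetric])
  then show ?case by (intro ext) (simp add: Cons partial_deriv_def[of i])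
qed simp

lemma iter_partial_scale:
  assumes "smooth f"
  shows "iter_partial l (\<lambda>x. c * f x) = (\<lambda>x. c * iter_partial l f x)"
proof (induction l)
  case (Cons i l)
  have "frechet_derivative (\<lambda>x. c * iter_partial l f x) (at x) =
      (\<lambda>h. c * frechet_derivative (iter_partial l f) (at x) h)" for x
    using assms
    by (intro frechet_derivative_at[symmetric] has_derivative_mult_right)
       (auto simp: smooth_def differentiable_on_def frechet_derivative_works[symmetric])
  then show ?case by (intro ext) (simp add: Cons partial_deriv_def[of i])
qed simp

lemma smooth_zero: "smooth (\<lambda>_. 0)"
  by (simp add: smooth_def iter_partial_zero)

lemma smooth_add: "smooth f \<Longrightarrow> smooth g \<Longrightarrow> smooth (\<lambda>x. f x + g x)"
  using iter_partial_add[of f g] by (simp add: smooth_def differentiable_on_add)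

lemma smooth_scale: "smooth f \<Longrightarrow> smooth (\<lambda>x. c * f x)"
  using iter_partial_scale[of f] by (simp add: smooth_def differentiable_on_mult)


section \<open>The Schwartz space\<close>

definition is_schwartz :: "(real ^ 'n::finite \<Rightarrow> real) \<Rightarrow> bool" where
  "is_schwartz f \<longleftrightarrow> smooth f \<and>
     (\<forall>m j. bdd_above (range (\<lambda>x. (1 + norm x) ^ m * \<bar>multi_deriv j f x\<bar>)))"

lemma is_schwartz_zero: "is_schwartz (\<lambda>_. 0)"
  by (simp add: is_schwartz_def smooth_zero multi_deriv_def iter_partial_zero)

lemma is_schwartz_add:
  assumes f: "is_schwartz f" and g: "is_schwartz g"
  shows "is_schwartz (\<lambda>x. f x + g x)"
proof -
  have "bdd_above (range (\<lambda>x. (1 + norm x) ^ m * \<bar>multi_deriv j (\<lambda>x. f x + g x) x\<bar>))" for m j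
  proof -
    obtain A where A: "\<And>x. (1 + norm x) ^ m * \<bar>multi_deriv j f x\<bar> \<le> A"
      using f unfolding is_schwartz_def bdd_above_def by blast
    obtain B where B: "\<And>x. (1 + norm x) ^ m * \<bar>multi_deriv j g x\<bar> \<le> B"
      using g unfolding is_schwartz_def bdd_above_def by blast
    have "(1 + norm x) ^ m * \<bar>multi_deriv j (\<lambda>x. f x + g x) x\<bar> \<le> A + B" for x
    proof -
      have "(1 + norm x) ^ m * \<bar>multi_deriv j (\<lambda>x. f x + g x) x\<bar>
          \<le> (1 + norm x) ^ m * (\<bar>multi_deriv j f x\<bar> + \<bar>multi_deriv j g x\<bar>)"
        using f g
        by (intro mult_left_mono) (auto simp: is_schwartz_def multi_deriv_def iter_partial_add)
      also have "\<dots> \<le> A + B"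
        using A[of x] B[of x] by (simp add: distrib_left)
      finally show ?thesis .
    qed
    then show ?thesis by (intro bdd_aboveI2)
  qed
  then show ?thesis using f g by (simp add: is_schwartz_def smooth_add)
qed

lemma is_schwartz_scale:
  assumes f: "is_schwartz f"
  shows "is_schwartz (\<lambda>x. c * f x)"
proof -
  have "bdd_above (range (\<lambda>x. (1 + norm x) ^ m * \<bar>multi_deriv j (\<lambda>x. c * f x) x\<bar>))" for m j
  proof -
    obtain A where A: "\<And>x. (1 + norm x) ^ m * \<bar>multi_deriv j f x\<bar> \<le> A"
      using f unfolding is_schwartz_def bdd_above_def by blast
    have "(1 + norm x) ^ m * \<bar>multi_deriv j (\<lambda>x. c * f x) x\<bar> \<le> \<bar>c\<bar> * A" for x
      using f mult_left_mono[OF A[of x], of "\<bar>c\<bar>"]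
      by (simp add: is_schwartz_def multi_deriv_def iter_partial_scale abs_mult algebra_simps)
    then show ?thesis by (intro bdd_aboveI2)
  qed
  then show ?thesis using f by (simp add: is_schwartz_def smooth_scale)
qed

typedef (overloaded) ('n::finite) schwartz = "{f :: real ^ 'n \<Rightarrow> real. is_schwartz f}"
  morphisms schwartz_fun Abs_schwartz
  using is_schwartz_zero by blast

setup_lifting type_definition_schwartz

instantiation schwartz :: (finite) real_vector
begin

lift_definition zero_schwartz :: "'a schwartz" is "\<lambda>_. 0"
  by (rule is_schwartz_zero)

lift_definition plus_schwartz :: "'a schwartz \<Rightarrow> 'a schwartz \<Rightarrow> 'a schwartz"
  is "\<lambda>f g x. f x + g x"
  by (rule is_schwartz_add)

lift_definition uminus_schwartz :: "'a schwartz \<Rightarrow> 'a schwartz" is "\<lambda>f x. - f x"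
  using is_schwartz_scale[of _ "-1"] by simp

lift_definition minus_schwartz :: "'a schwartz \<Rightarrow> 'a schwartz \<Rightarrow> 'a schwartz"
  is "\<lambda>f g x. f x - g x"
  using is_schwartz_add[OF _ is_schwartz_scale[of _ "-1"]] by simp

lift_definition scaleR_schwartz :: "real \<Rightarrow> 'a schwartz \<Rightarrow> 'a schwartz" is "\<lambda>c f x. c * f x"
  by (rule is_schwartz_scale)

instance
  by standard (transfer; simp add: algebra_simps fun_eq_iff)+

end

definition schwartz_seminorm :: "nat \<Rightarrow> nat ^ 'n \<Rightarrow> 'n::finite schwartz \<Rightarrow> real" where
  "schwartz_seminorm m j f = (SUP x. (1 + norm x) ^ m * \<bar>multi_deriv j (schwartz_fun f) x\<bar>)"

instantiation schwartz :: (finite) topological_space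
begin

definition open_schwartz :: "'a schwartz set \<Rightarrow> bool" where
  "open_schwartz = seminorm_open {schwartz_seminorm m j | m j. True}"

instance
  by standard (auto simp: open_schwartz_def seminorm_open_def intro: generate_topology.intros)

end


section \<open>Tempered distributions with the strong topology\<close>

typedef (overloaded) ('n::finite) tempered =
  "{F :: 'n schwartz \<Rightarrow> real. linear F \<and> continuous_on UNIV F}"
  morphisms bracket Abs_tempered
  by (rule exI[of _ "\<lambda>_. 0"]) (simp add: linear_iff)

setup_lifting type_definition_tempered

instantiation tempered :: (finite) real_vector
begin

lift_definition zero_tempered :: "'a tempered" is "\<lambda>_. 0"
  by (simp add: linear_iff)

lift_definition plus_tempered :: "'a tempered \<Rightarrow> 'a tempered \<Rightarrow> 'a tempered"
  is "\<lambda>F G f. F f + G f"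
  by (auto intro: linear_compose_add continuous_on_add)

lift_definition uminus_tempered :: "'a tempered \<Rightarrow> 'a tempered" is "\<lambda>F f. - F f"
  by (auto intro: linear_compose_neg continuous_on_minus)

lift_definition minus_tempered :: "'a tempered \<Rightarrow> 'a tempered \<Rightarrow> 'a tempered"
  is "\<lambda>F G f. F f - G f"
  by (auto intro: linear_compose_sub continuous_on_diff)

lift_definition scaleR_tempered :: "real \<Rightarrow> 'a tempered \<Rightarrow> 'a tempered" is "\<lambda>c F f. c * F f"
  by (auto simp: linear_iff algebra_simps intro: continuous_on_mult_left)

instance
  by standard (transfer; simp add: algebra_simps fun_eq_iff)+

end

definition strong_seminorm :: "'n::finite schwartz set \<Rightarrow> 'n tempered \<Rightarrow> real" where
  "strong_seminorm B F = (SUP f\<in>B. \<bar>bracket F f\<bar>)"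

text \<open>The empty set is excluded because the supremum of the empty set of reals is unspecified.\<close>

instantiation tempered :: (finite) topological_space
begin

definition open_tempered :: "'a tempered set \<Rightarrow> bool" where
  "open_tempered = seminorm_open {strong_seminorm B | B. tvs_bounded B \<and> B \<noteq> {}}"

instance
  by standard (auto simp: open_tempered_def seminorm_open_def intro: generate_topology.intros)

end


section \<open>Generalized random fields\<close>

text \<open>On the type of tempered distributions, \<open>borel\<close> is the Borel \<open>\<sigma>\<close>-field of the strong
  topology and \<open>continuous_on UNIV\<close> is strong continuity.\<close>

definition generalized_random_field :: "'w measure \<Rightarrow> ('w \<Rightarrow> 'n::finite tempered) \<Rightarrow> bool" where
  "generalized_random_field M X \<longleftrightarrow> prob_space M \<and> X \<in> measurable M borel"

definition law :: "'w measure \<Rightarrow> ('w \<Rightarrow> 'n::finite tempered) \<Rightarrow> 'n tempered measure" where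
  "law M X = distr M borel X"

definition char_functional ::
    "'w measure \<Rightarrow> ('w \<Rightarrow> 'n::finite tempered) \<Rightarrow> 'n schwartz \<Rightarrow> complex" where
  "char_functional M X f = (LINT \<omega>|M. exp (\<i> * complex_of_real (bracket (X \<omega>) f)))"

definition converges_in_distribution ::
    "(nat \<Rightarrow> 'w measure) \<Rightarrow> (nat \<Rightarrow> 'w \<Rightarrow> 'n::finite tempered) \<Rightarrow>
     'v measure \<Rightarrow> ('v \<Rightarrow> 'n tempered) \<Rightarrow> bool" where
  "converges_in_distribution M X N Y \<longleftrightarrow>
     (\<forall>\<phi> :: 'n tempered \<Rightarrow> real. continuous_on UNIV \<phi> \<and> bounded (range \<phi>) \<longrightarrow>
        (\<lambda>n. LINT F|law (M n) (X n). \<phi> F) \<longlonglongrightarrow> (LINT F|law N Y. \<phi> F))"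

end

theory Submission
  imports Defs
begin

text \<open>The Schwartz topology is generated by an increasing sequence of Hilbert norms (weighted Sobolev
  norms) with Hilbert-Schmidt embeddings; the Hilbert-Schmidt bound follows from the Sobolev inequality
  alone. Completeness and a Baire argument upgrade continuity of the limit at \<open>0\<close> to equicontinuity of
  the characteristic functionals, and averaging over Gaussian combinations of an orthonormal system
  (Minlos' trick) turns this into uniform tightness on polars of Hilbert norm balls. By the
  Hilbert-Schmidt property these polars are compact and metrizable in the strong topology, where the
  coordinates along a countable total family describe them, so a limit law along a subsequence comes
  from Helly's theorem on the line through a Cantor-type coding of sequences of reals. On each polar
  the trigonometric polynomials are dense by Stone-Weierstrass, which determines the limits of all
  expectations and gives convergence of the whole sequence.\<close>

section \<open>Scales of Hilbert norms with Hilbert-Schmidt embeddings\<close>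

text \<open>The strong dual is not metrizable, so sequential compactness arguments do not apply to
  it as a whole; they are confined to polars, and tightness makes the mass outside them negligible.
  Hilbert norms replace the suprema of the definition because Minlos' trick needs orthonormal
  coordinates: with independent standard Gaussian coefficients t_e, the mean of exp(i F(sum t_e e))
  is exp(- sum F(e)^2 / 2), so a bound on 1 - cos for single test functions becomes a bound on the
  squared dual norm of F on span E. The price is the trace of a weaker form over E, which the
  Hilbert-Schmidt property bounds uniformly in E. A further obstacle: a trigonometric polynomial
  close to a given function on a polar may be huge off it, so it is composed with a polynomial close
  to a truncation, which bounds it everywhere by a constant that does not depend on the
  polar.\<close>

lemma integral_std_normal_cos:
  "(\<integral>t. cos (a + t * b) \<partial>std_normal_distribution) = cos a * exp (- b\<^sup>2 / 2)"
proof -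
  interpret real_distribution std_normal_distribution by (rule real_dist_normal_dist)
  have "(\<integral>t. cos (a + t * b) \<partial>std_normal_distribution) =
      (\<integral>t. Re (iexp a * iexp (b * t)) \<partial>std_normal_distribution)"
    by (intro Bochner_Integration.integral_cong) (auto simp: exp_add[symmetric] Re_exp algebra_simps)
  also have "\<dots> = Re (iexp a * (\<integral>t. iexp (b * t) \<partial>std_normal_distribution))"
    by (subst integral_Re) (auto intro!: integrable_const_bound[of _ 1] simp: norm_mult)
  also have "(\<integral>t. iexp (b * t) \<partial>std_normal_distribution) = complex_of_real (exp (- b\<^sup>2 / 2))"
    using fun_cong[OF char_std_normal_distribution, of b] by (simp add: char_def)
  finally show ?thesis by (simp add: Re_exp)
qed

lemma std_normal_moments:
  "integrable std_normal_distribution (\<lambda>t. t)" "(\<integral>t. t \<partial>std_normal_distribution) = 0"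
  "integrable std_normal_distribution (\<lambda>t. t\<^sup>2)" "(\<integral>t. t\<^sup>2 \<partial>std_normal_distribution) = 1"
  using integrable_std_normal_moment[of 1] integral_std_normal_moment_odd[of 0]
    integrable_std_normal_moment[of 2] integral_std_normal_moment_even[of 1]
  by (simp_all add: integrable_density integral_density)

text \<open>An abstract nuclear countably Hilbert space. \<open>hilbert_schmidt\<close> speaks of
  finite orthonormal systems, so the argument stays inside the space and its norms.
  \<open>complete\<close> concerns sequences that are Cauchy in all norms at once, which is
  completeness of the Frechet topology.\<close>

locale hilbert_scale =
  fixes ip :: "nat \<Rightarrow> 'a::real_vector \<Rightarrow> 'a \<Rightarrow> real"
  assumes ip_add: "ip m (x + y) z = ip m x z + ip m y z"
    and ip_scale: "ip m (c *\<^sub>R x) z = c * ip m x z"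
    and ip_sym: "ip m x y = ip m y x"
    and ip_pos: "x \<noteq> 0 \<Longrightarrow> 0 < ip m x x"
    and ip_mono: "ip m x x \<le> ip (Suc m) x x"
    and hilbert_schmidt: "\<exists>k\<ge>m. \<exists>C. \<forall>E. finite E \<and> (\<forall>e\<in>E. \<forall>f\<in>E. ip k e f = (if e = f then 1 else 0)) \<longrightarrow>
          (\<Sum>e\<in>E. ip m e e) \<le> C"
    and complete: "(\<And>m e. 0 < e \<Longrightarrow> \<exists>N. \<forall>i\<ge>N. \<forall>j\<ge>N. ip m (u i - u j) (u i - u j) < e) \<Longrightarrow>
          \<exists>x. \<forall>m. (\<lambda>i. ip m (u i - x) (u i - x)) \<longlonglongrightarrow> 0"
begin

section \<open>Inner product calculus and the norms\<close>

definition nrm :: "nat \<Rightarrow> 'a \<Rightarrow> real" where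
  "nrm m x = sqrt (ip m x x)"

definition orthonormal :: "nat \<Rightarrow> 'a set \<Rightarrow> bool" where
  "orthonormal k E \<longleftrightarrow> finite E \<and> (\<forall>e\<in>E. \<forall>f\<in>E. ip k e f = (if e = f then 1 else 0))"

lemma ip_zero_left [simp]: "ip m 0 z = 0"
  using ip_scale[of m 0 0 z] by simp

lemma ip_zero_right [simp]: "ip m z 0 = 0"
  using ip_sym[of m z 0] by simp

lemma ip_add_right: "ip m z (x + y) = ip m z x + ip m z y"
  by (metis ip_add ip_sym)

lemma ip_scale_right: "ip m z (c *\<^sub>R x) = c * ip m z x"
  by (metis ip_scale ip_sym)

lemma ip_minus: "ip m (- x) z = - ip m x z"
  using ip_scale[of m "-1" x z] by simp

lemma ip_minus_right: "ip m z (- x) = - ip m z x"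
  by (metis ip_minus ip_sym)

lemma ip_diff: "ip m (x - y) z = ip m x z - ip m y z"
  using ip_add[of m x "- y" z] by (simp add: ip_minus)

lemma ip_diff_right: "ip m z (x - y) = ip m z x - ip m z y"
  by (metis ip_diff ip_sym)

lemma ip_sum: "ip m (\<Sum>i\<in>I. f i) z = (\<Sum>i\<in>I. ip m (f i) z)"
  by (induction I rule: infinite_finite_induct) (auto simp: ip_add)

lemma ip_sum_right: "ip m z (\<Sum>i\<in>I. f i) = (\<Sum>i\<in>I. ip m z (f i))"
  by (induction I rule: infinite_finite_induct) (auto simp: ip_add_right)

lemmas ip_simps = ip_add ip_add_right ip_scale ip_scale_right ip_minus ip_minus_right
  ip_diff ip_diff_right ip_sum ip_sum_right

lemma ip_nonneg [simp]: "0 \<le> ip m x x"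
  using ip_pos[of x m] by (cases "x = 0") auto

lemma nrm_nonneg [simp]: "0 \<le> nrm m x"
  by (simp add: nrm_def)

lemma nrm_zero [simp]: "nrm m 0 = 0"
  by (simp add: nrm_def)

lemma nrm_square: "(nrm m x)\<^sup>2 = ip m x x"
  by (simp add: nrm_def)

lemma nrm_pos: "x \<noteq> 0 \<Longrightarrow> 0 < nrm m x"
  by (simp add: nrm_def ip_pos)

lemma nrm_scale: "nrm m (c *\<^sub>R x) = \<bar>c\<bar> * nrm m x"
proof -
  have "ip m (c *\<^sub>R x) (c *\<^sub>R x) = c\<^sup>2 * ip m x x"
    by (simp add: ip_simps power2_eq_square)
  then show ?thesis by (simp add: nrm_def real_sqrt_mult)
qed

lemma nrm_minus [simp]: "nrm m (- x) = nrm m x"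
  by (simp add: nrm_def ip_simps)

lemma nrm_minus_commute: "nrm m (x - y) = nrm m (y - x)"
  using nrm_minus[of m "x - y"] by simp

lemma cauchy_schwarz: "\<bar>ip m x y\<bar> \<le> nrm m x * nrm m y"
proof (cases "y = 0")
  case False
  then have y: "0 < ip m y y" by (rule ip_pos)
  define t where "t = ip m x y / ip m y y"
  have "0 \<le> ip m (x - t *\<^sub>R y) (x - t *\<^sub>R y)" by simp
  also have "\<dots> = ip m x x - (ip m x y)\<^sup>2 / ip m y y"
    using y by (simp add: ip_simps ip_sym[of m y x] t_def power2_eq_square field_simps)
  finally have "(ip m x y)\<^sup>2 \<le> ip m x x * ip m y y"
    using y by (simp add: field_simps)
  then have "sqrt ((ip m x y)\<^sup>2) \<le> sqrt (ip m x x * ip m y y)"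
    by (rule real_sqrt_le_mono)
  then show ?thesis by (simp add: nrm_def real_sqrt_mult)
qed simp

lemma nrm_triangle: "nrm m (x + y) \<le> nrm m x + nrm m y"
proof -
  have "(nrm m (x + y))\<^sup>2 = ip m x x + 2 * ip m x y + ip m y y"
    by (simp add: nrm_square ip_simps ip_sym[of m y x])
  also have "\<dots> \<le> (nrm m x)\<^sup>2 + 2 * (nrm m x * nrm m y) + (nrm m y)\<^sup>2"
    using cauchy_schwarz[of m x y] by (simp add: nrm_square)
  also have "\<dots> = (nrm m x + nrm m y)\<^sup>2" by (simp add: power2_sum algebra_simps)
  finally show ?thesis by (rule power2_le_imp_le) simp
qed

lemma nrm_triangle_diff: "nrm m (x - y) \<le> nrm m (x - z) + nrm m (z - y)"
  using nrm_triangle[of m "x - z" "z - y"] by simp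

lemma nrm_mono: "m \<le> k \<Longrightarrow> nrm m x \<le> nrm k x"
  by (rule lift_Suc_mono_le[of "\<lambda>m. nrm m x"]) (auto simp: nrm_def ip_mono)

section \<open>Orthonormal systems, projections and total boundedness\<close>

definition proj :: "nat \<Rightarrow> 'a set \<Rightarrow> 'a \<Rightarrow> 'a" where
  "proj k E x = (\<Sum>e\<in>E. ip k x e *\<^sub>R e)"

lemma ip_proj:
  assumes "orthonormal k E" "e \<in> E"
  shows "ip k (proj k E x) e = ip k x e"
proof -
  have "ip k (proj k E x) e = (\<Sum>f\<in>E. ip k x f * ip k f e)"
    by (simp add: proj_def ip_simps)
  also have "\<dots> = (\<Sum>f\<in>E. if f = e then ip k x f else 0)"
    using assms by (intro sum.cong) (auto simp: orthonormal_def)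
  finally show ?thesis using assms by (simp add: orthonormal_def)
qed

lemma ip_residual:
  assumes "orthonormal k E" "e \<in> E"
  shows "ip k (x - proj k E x) e = 0"
  using ip_proj[OF assms] by (simp add: ip_simps)

text \<open>Pythagoras, since the residual is orthogonal to the projection. Dropping one summand
  gives Bessel's inequality, dropping the other shows that the residual is no longer than
  \<open>x\<close>.\<close>

lemma bessel:
  assumes E: "orthonormal k E"
  shows "ip k x x = (\<Sum>e\<in>E. (ip k x e)\<^sup>2) + ip k (x - proj k E x) (x - proj k E x)"
proof -
  let ?p = "proj k E x"
  have "ip k (x - ?p) ?p = 0"
    by (simp add: proj_def[of k E x] ip_sum_right ip_scale_right)
       (simp add: proj_def[symmetric] ip_residual[OF E])
  moreover have "ip k x ?p = (\<Sum>e\<in>E. (ip k x e)\<^sup>2)"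
    by (simp add: proj_def ip_simps power2_eq_square)
  ultimately show ?thesis by (simp add: ip_simps ip_sym[of k ?p x])
qed

lemma proj_in_span: "proj k E x \<in> span E"
  unfolding proj_def by (intro span_sum span_scale span_base)

lemma nrm_residual_le:
  assumes E: "orthonormal k E"
  shows "nrm k (x - proj k E x) \<le> nrm k x"
  unfolding nrm_def using bessel[OF E, of x] by (simp add: sum_nonneg)

lemma proj_span:
  assumes E: "orthonormal k E" and x: "x \<in> span E"
  shows "proj k E x = x"
proof (rule ccontr)
  assume *: "proj k E x \<noteq> x"
  let ?r = "x - proj k E x"
  have "?r \<in> span E" by (intro span_diff x proj_in_span)
  then obtain c where "?r = (\<Sum>e\<in>E. c e *\<^sub>R e)"
    using E span_finite[of E] by (auto simp: orthonormal_def)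
  then have "ip k ?r ?r = (\<Sum>e\<in>E. c e * ip k ?r e)"
    by (metis (mono_tags, lifting) ip_scale_right ip_sum_right sum.cong)
  also have "\<dots> = 0" using ip_residual[OF E] by simp
  finally show False using ip_pos[of ?r k] * by simp
qed

text \<open>The probabilistic estimates concern orthonormal \<open>E\<close>, while the whole space
  is exhausted by spans of arbitrary vectors; this links the two.\<close>

lemma gram_schmidt:
  assumes "finite D"
  shows "\<exists>E. orthonormal k E \<and> D \<subseteq> span E \<and> E \<subseteq> span D"
  using assms
proof (induction D)
  case empty
  show ?case by (auto simp: orthonormal_def)
next
  case (insert d D)
  then obtain E where E: "orthonormal k E" "D \<subseteq> span E" "E \<subseteq> span D" by blast
  have ED: "E \<subseteq> span (insert d D)" using E(3) span_mono[of D "insert d D"] by blast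
  let ?r = "d - proj k E d"
  show ?case
  proof (cases "?r = 0")
    case True
    then have "d \<in> span E" using proj_in_span[of k E d] by simp
    then show ?thesis using E ED by blast
  next
    case False
    define e where "e = (1 / nrm k ?r) *\<^sub>R ?r"
    have r: "0 < nrm k ?r" using False by (rule nrm_pos)
    have "ip k e e = (1 / nrm k ?r)\<^sup>2 * (nrm k ?r)\<^sup>2"
      unfolding e_def nrm_square by (simp add: ip_scale ip_scale_right power2_eq_square)
    then have ee: "ip k e e = 1" using r by (simp add: power_divide)
    have ef: "ip k e f = 0" if "f \<in> E" for f
      using ip_residual[OF E(1) that] by (simp add: e_def ip_scale)
    have fe: "ip k f e = 0" if "f \<in> E" for f
      using ef[OF that] ip_sym by simp
    have "orthonormal k (insert e E)"
      using E(1) ee ef fe unfolding orthonormal_def by (metis finite_insert insert_iff)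
    moreover have "d = nrm k ?r *\<^sub>R e + proj k E d" using r by (simp add: e_def)
    then have "d \<in> span (insert e E)"
      using proj_in_span[of k E d] span_mono[of E "insert e E"]
      by (metis insertI1 span_add span_base span_scale subset_insertI subsetD)
    moreover have "D \<subseteq> span (insert e E)" using E(2) span_mono[of E "insert e E"] by blast
    moreover have "proj k E d \<in> span (insert d D)"
      using proj_in_span[of k E d] span_minimal[OF ED subspace_span] by blast
    then have "e \<in> span (insert d D)"
      unfolding e_def by (intro span_scale span_diff) (auto intro: span_base)
    ultimately show ?thesis using ED by (intro exI[of _ "insert e E"]) auto
  qed
qed

text \<open>A finite orthonormal system of maximal size among those whose members are large in the
  weaker norm: its size is bounded by the Hilbert-Schmidt property, and by maximality the
  embedding is small on its orthogonal complement.\<close>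

lemma total_boundedness:
  "\<exists>k\<ge>m. \<forall>\<epsilon>>0. \<exists>E. orthonormal k E \<and> (\<forall>x. nrm m (x - proj k E x) \<le> \<epsilon> * nrm k x)"
proof -
  obtain k C where k: "m \<le> k" and C: "\<And>E. orthonormal k E \<Longrightarrow> (\<Sum>e\<in>E. ip m e e) \<le> C"
    using hilbert_schmidt[of m] unfolding orthonormal_def by blast
  have "\<exists>E. orthonormal k E \<and> (\<forall>x. nrm m (x - proj k E x) \<le> \<epsilon> * nrm k x)"
    if \<epsilon>: "0 < \<epsilon>" for \<epsilon>
  proof -
    define P where "P E \<longleftrightarrow> orthonormal k E \<and> (\<forall>e\<in>E. \<epsilon> < nrm m e)" for E
    \<comment> \<open>Each member contributes at least \<open>\<epsilon>\<^sup>2\<close> to the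
      trace, and the trace is at most \<open>C\<close>.\<close>
    have bound: "card E \<le> nat \<lceil>C / \<epsilon>\<^sup>2\<rceil>" if "P E" for E
    proof -
      have "real (card E) * \<epsilon>\<^sup>2 = (\<Sum>e\<in>E. \<epsilon>\<^sup>2)" by simp
      also have "\<dots> \<le> (\<Sum>e\<in>E. ip m e e)"
        using that \<epsilon> by (intro sum_mono) (auto simp: P_def nrm_square[symmetric] intro!: power_mono less_imp_le)
      also have "\<dots> \<le> C" using that C by (simp add: P_def)
      finally have "real (card E) \<le> C / \<epsilon>\<^sup>2" using \<epsilon> by (simp add: field_simps)
      then show ?thesis by linarith
    qed
    have "P {}" by (simp add: P_def orthonormal_def)
    then obtain E where E: "P E" and max: "\<And>E'. P E' \<Longrightarrow> card E' \<le> card E"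
      using ex_has_greatest_nat[of P "{}" card "Suc (nat \<lceil>C / \<epsilon>\<^sup>2\<rceil>)"] bound
      by (auto simp: less_Suc_eq_le)
    have oE: "orthonormal k E" using E by (simp add: P_def)
    have "nrm m r \<le> \<epsilon> * nrm k r" if r: "\<And>e. e \<in> E \<Longrightarrow> ip k r e = 0" for r
    proof (rule ccontr)
      assume *: "\<not> nrm m r \<le> \<epsilon> * nrm k r"
      then have r0: "r \<noteq> 0" by auto
      then have nr: "0 < nrm k r" by (rule nrm_pos)
      define e where "e = (1 / nrm k r) *\<^sub>R r"
      have "ip k e e = (1 / nrm k r)\<^sup>2 * (nrm k r)\<^sup>2"
        unfolding e_def nrm_square by (simp add: ip_scale ip_scale_right power2_eq_square)
      then have ee: "ip k e e = 1" using nr by (simp add: power_divide)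
      have ef: "ip k e f = 0" "ip k f e = 0" if "f \<in> E" for f
        using r[OF that] ip_sym[of k f e] by (simp_all add: e_def ip_scale)
      have "orthonormal k (insert e E)"
        using oE ee ef unfolding orthonormal_def by (metis finite_insert insert_iff)
      moreover have "\<epsilon> < nrm m e" using * nr by (simp add: e_def nrm_scale field_simps)
      ultimately have "P (insert e E)" using E by (auto simp: P_def)
      moreover have "e \<notin> E" using ee ef by force
      ultimately show False using max[of "insert e E"] oE by (simp add: orthonormal_def)
    qed
    then have "nrm m (x - proj k E x) \<le> \<epsilon> * nrm k (x - proj k E x)" for x
      using ip_residual[OF oE] by blast
    also have "\<epsilon> * nrm k (x - proj k E x) \<le> \<epsilon> * nrm k x" for x
      using nrm_residual_le[OF oE] \<epsilon> by simp
    finally show ?thesis using oE by blast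
  qed
  then show ?thesis using k by blast
qed

text \<open>Collects the finite systems given by total boundedness, for every \<open>m\<close> and
  every accuracy \<open>1 / Suc r\<close>. One countable set then serves all norms
  simultaneously.\<close>

lemma countable_total_family:
  "\<exists>d :: nat \<Rightarrow> 'a. \<forall>x m. \<forall>\<epsilon>>0. \<exists>y\<in>span (range d). nrm m (x - y) < \<epsilon>"
proof -
  obtain k where k: "\<And>m \<epsilon>. 0 < \<epsilon> \<Longrightarrow> \<exists>E. orthonormal (k m) E \<and> (\<forall>x. nrm m (x - proj (k m) E x) \<le> \<epsilon> * nrm (k m) x)"
    using total_boundedness by metis
  obtain E where E: "\<And>m r. orthonormal (k m) (E m r)"
      "\<And>m r x. nrm m (x - proj (k m) (E m r) x) \<le> 1 / real (Suc r) * nrm (k m) x"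
  proof -
    have "\<forall>m r. \<exists>E. orthonormal (k m) E \<and> (\<forall>x. nrm m (x - proj (k m) E x) \<le> 1 / real (Suc r) * nrm (k m) x)"
      by (intro allI k) simp
    then show ?thesis using that by metis
  qed
  \<comment> \<open>The element \<open>0\<close> makes \<open>U\<close> nonempty, so that
    \<open>from_nat_into\<close> enumerates exactly \<open>U\<close>.\<close>
  define U where "U = insert 0 (\<Union>m r. E m r)"
  have U: "countable U" "U \<noteq> {}"
  proof -
    have "countable (E m r)" for m r
      using E(1)[of m r] by (auto simp: orthonormal_def intro: countable_finite)
    then show "countable U" unfolding U_def by (intro countable_insert countable_UN) auto
  qed (simp add: U_def)
  have "\<exists>y\<in>span (range (from_nat_into U)). nrm m (x - y) < \<epsilon>" if "0 < \<epsilon>" for x m \<epsilon>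
  proof -
    obtain r where r: "nrm (k m) x / \<epsilon> < real (Suc r)"
      using reals_Archimedean2 by (metis less_Suc_eq of_nat_less_iff order_less_trans)
    have "proj (k m) (E m r) x \<in> span U"
      using proj_in_span span_mono[of "E m r" U] by (auto simp: U_def)
    moreover have "nrm m (x - proj (k m) (E m r) x) < \<epsilon>"
      using E(2)[of m x r] r that
      by (intro order.strict_trans1[OF E(2)]) (simp add: field_simps)
    ultimately show ?thesis using U range_from_nat_into by metis
  qed
  then show ?thesis by blast
qed

text \<open>Meant for \<open>\<psi> n\<close> equal to 1 minus the real part of the n-th
  characteristic functional. If the claim failed for large n, every ball would contain a smaller
  closed ball on which some late \<open>\<psi> n\<close> exceeds \<open>e / 4\<close>; nested balls
  then meet in a point where this happens infinitely often, although the limit there is below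
  \<open>e / 4\<close>. In \<open>cont\<close> the norm may depend on n and x, in the conclusion one
  norm serves all n.\<close>

lemma equicontinuity:
  fixes \<psi> :: "nat \<Rightarrow> 'a \<Rightarrow> real"
  assumes diff: "\<And>n x y. \<psi> n (x - y) \<le> 2 * \<psi> n x + 2 * \<psi> n y"
    and zero: "\<And>n. \<psi> n 0 = 0"
    and cont: "\<And>n x e. 0 < e \<Longrightarrow> \<exists>m. \<exists>\<delta>>0. \<forall>y. nrm m (y - x) < \<delta> \<longrightarrow> \<bar>\<psi> n y - \<psi> n x\<bar> < e"
    and lim: "\<And>x. (\<lambda>n. \<psi> n x) \<longlonglongrightarrow> \<psi>' x"
    and cont0: "\<And>e. 0 < e \<Longrightarrow> \<exists>m. \<exists>\<delta>>0. \<forall>y. nrm m y < \<delta> \<longrightarrow> \<psi>' y < e"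
    and e: "0 < e"
  shows "\<exists>m. \<exists>\<delta>>0. \<forall>n x. nrm m x < \<delta> \<longrightarrow> \<psi> n x \<le> e"
proof -
  \<comment> \<open>A quarter, because by \<open>diff\<close> a value \<open>\<psi> n x\<close>
    above \<open>e\<close> forces \<open>\<psi> n (c + x)\<close> or \<open>\<psi> n c\<close> above
    \<open>e / 4\<close>, whatever the centre \<open>c\<close>.\<close>
  define \<epsilon> where "\<epsilon> = e / 4"
  have \<epsilon>: "0 < \<epsilon>" "e = 4 * \<epsilon>" using e by (auto simp: \<epsilon>_def)
  obtain m0 \<delta>0 where \<delta>0: "0 < \<delta>0" and m0: "\<And>y. nrm m0 y < \<delta>0 \<Longrightarrow> \<psi>' y < \<epsilon>"
    using cont0[OF \<epsilon>(1)] by blast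
  have tail: "\<exists>N m. \<exists>\<delta>>0. \<forall>n\<ge>N. \<forall>x. nrm m x < \<delta> \<longrightarrow> \<psi> n x \<le> e"
  proof (rule ccontr)
    assume "\<not> ?thesis"
    then have bad: "\<exists>n\<ge>N. \<exists>x. nrm m x < \<delta> \<and> e < \<psi> n x" if "0 < \<delta>" for N m \<delta>
      using that by (metis not_le)
    define B where "B = (\<lambda>(c, m, \<delta>). {y. nrm m (y - c) \<le> \<delta>})"
    \<comment> \<open>Each step halves the radius and also raises the norm index, so the centres
      become Cauchy in every norm and not merely in that of the first ball.\<close>
    define R where "R i s t \<longleftrightarrow> (case s of (c, m, \<delta>) \<Rightarrow> case t of (c', m', \<delta>') \<Rightarrow>
        0 < \<delta>' \<and> \<delta>' \<le> \<delta> / 2 \<and> m < m' \<and> B t \<subseteq> B s \<and> (\<exists>n\<ge>i. \<forall>y\<in>B t. \<epsilon> < \<psi> n y))" for i :: nat and s t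
    define P where "P s \<longleftrightarrow> 0 < snd (snd s)" for s :: "'a \<times> nat \<times> real"
    have step: "\<exists>t. P t \<and> R i s t" if "P s" for s i
    proof -
      obtain c m \<delta> where s: "s = (c, m, \<delta>)" by (cases s)
      have \<delta>: "0 < \<delta>" using that s by (simp add: P_def)
      obtain n x where n: "i \<le> n" and x: "nrm m x < \<delta>" "e < \<psi> n x"
        using bad[OF \<delta>] by blast
      have "\<psi> n x \<le> 2 * \<psi> n (c + x) + 2 * \<psi> n c" using diff[of n "c + x" c] by simp
      then have "\<epsilon> < \<psi> n (c + x) \<or> \<epsilon> < \<psi> n c" using x \<epsilon> by linarith
      then obtain c' where c': "nrm m (c' - c) < \<delta>" "\<epsilon> < \<psi> n c'"
        using x \<delta> by (metis add_diff_cancel_left' diff_self nrm_zero)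
      obtain m' \<delta>' where \<delta>': "0 < \<delta>'" and m': "\<And>y. nrm m' (y - c') < \<delta>' \<Longrightarrow> \<bar>\<psi> n y - \<psi> n c'\<bar> < \<psi> n c' - \<epsilon>"
        using cont[of "\<psi> n c' - \<epsilon>" c' n] c' by auto
      define \<delta>'' where "\<delta>'' = min (\<delta>' / 2) (min (\<delta> / 2) (\<delta> - nrm m (c' - c)))"
      define t where "t = (c', max m' (Suc m), \<delta>'')"
      have p: "0 < \<delta>''" using \<delta>' \<delta> c' by (simp add: \<delta>''_def)
      have "B t \<subseteq> B s"
      proof
        fix y assume "y \<in> B t"
        then have "nrm (max m' (Suc m)) (y - c') \<le> \<delta> - nrm m (c' - c)" by (simp add: t_def B_def \<delta>''_def)
        moreover have "nrm m (y - c') \<le> nrm (max m' (Suc m)) (y - c')" by (rule nrm_mono) simp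
        ultimately show "y \<in> B s" using nrm_triangle_diff[of m y c c'] by (simp add: s B_def)
      qed
      moreover have "\<epsilon> < \<psi> n y" if "y \<in> B t" for y
      proof -
        have "nrm m' (y - c') \<le> nrm (max m' (Suc m)) (y - c')" by (rule nrm_mono) simp
        also have "\<dots> \<le> \<delta>''" using that by (simp add: t_def B_def)
        also have "\<dots> < \<delta>'" using \<delta>' by (simp add: \<delta>''_def min_less_iff_disj)
        finally show ?thesis using m'[of y] by linarith
      qed
      ultimately have "R i s t" using p n by (auto simp: R_def s t_def \<delta>''_def min_def)
      moreover have "P t" using p by (simp add: P_def t_def)
      ultimately show ?thesis by blast
    qed
    \<comment> \<open>Half the radius, since the balls are closed while \<open>m0\<close> asks for a
      strict inequality.\<close>
    define s0 where "s0 = (0 :: 'a, m0, \<delta>0 / 2)"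
    have "P s0" using \<delta>0 by (simp add: P_def s0_def)
    then obtain S where S: "\<And>i. P (S i) \<and> (i = 0 \<longrightarrow> S i = s0)" "\<And>i. R i (S i) (S (Suc i))"
      using dependent_nat_choice[of "\<lambda>i s. P s \<and> (i = 0 \<longrightarrow> s = s0)" R] step by blast
    define c m \<delta> where "c i = fst (S i)" and "m i = fst (snd (S i))" and "\<delta> i = snd (snd (S i))" for i
    have Si: "S i = (c i, m i, \<delta> i)" for i by (simp add: c_def m_def \<delta>_def)
    have \<delta>pos: "0 < \<delta> i" for i using S(1)[of i] by (simp add: P_def Si)
    have R: "\<delta> (Suc i) \<le> \<delta> i / 2" "m i < m (Suc i)" "B (S (Suc i)) \<subseteq> B (S i)"
        "\<exists>n\<ge>i. \<forall>y\<in>B (S (Suc i)). \<epsilon> < \<psi> n y" for i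
      using S(2)[of i] by (auto simp: R_def Si)
    have mi: "i \<le> m i" for i
      by (induction i) (use R(2) in \<open>auto simp: Suc_le_eq intro: le_less_trans\<close>)
    have \<delta>i: "\<delta> i \<le> \<delta> 0 / 2 ^ i" for i
    proof (induction i)
      case (Suc i)
      then show ?case using R(1)[of i] by simp
    qed simp
    have nested: "B (S j) \<subseteq> B (S i)" if "i \<le> j" for i j
      using that lift_Suc_antimono_le[of "\<lambda>i. B (S i)"] R(3) by blast
    have "c j \<in> B (S j)" for j using \<delta>pos[of j] by (simp add: B_def Si)
    then have cB: "nrm (m i) (c j - c i) \<le> \<delta> i" if "i \<le> j" for i j
      using nested[OF that] by (force simp: B_def Si)
    have \<delta>lim: "\<delta> \<longlonglongrightarrow> 0"
    proof (rule tendsto_sandwich[of "\<lambda>_. 0" _ _ "\<lambda>i. \<delta> 0 / 2 ^ i"])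
      have "(\<lambda>i. \<delta> 0 * (1 / 2) ^ i) \<longlonglongrightarrow> \<delta> 0 * 0" by (intro tendsto_intros) auto
      then show "(\<lambda>i. \<delta> 0 / 2 ^ i) \<longlonglongrightarrow> 0" by (simp add: power_one_over)
    qed (use \<delta>pos \<delta>i in \<open>auto intro!: always_eventually less_imp_le\<close>)
    have "\<exists>x. \<forall>k. (\<lambda>i. ip k (c i - x) (c i - x)) \<longlonglongrightarrow> 0"
    proof (rule complete)
      fix k :: nat and r :: real assume r: "0 < r"
      have "eventually (\<lambda>i. \<delta> i < sqrt r / 2) sequentially"
        using \<delta>lim r by (intro order_tendstoD(2)[of _ 0]) auto
      then obtain N0 where N0: "\<And>i. N0 \<le> i \<Longrightarrow> \<delta> i < sqrt r / 2"
        by (auto simp: eventually_sequentially)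
      let ?N = "max N0 k"
      have *: "nrm k (c i - c ?N) < sqrt r / 2" if "?N \<le> i" for i
      proof -
        have "nrm k (c i - c ?N) \<le> nrm (m ?N) (c i - c ?N)"
          using mi[of ?N] by (intro nrm_mono) simp
        also have "\<dots> \<le> \<delta> ?N" using cB[OF that] .
        finally show ?thesis using N0[of ?N] by simp
      qed
      have "nrm k (c i - c j) < sqrt r" if "?N \<le> i" "?N \<le> j" for i j
        using *[OF that(1)] *[OF that(2)] nrm_triangle_diff[of k "c i" "c j" "c ?N"]
          nrm_minus_commute[of k "c j" "c ?N"] by linarith
      then show "\<exists>N. \<forall>i\<ge>N. \<forall>j\<ge>N. ip k (c i - c j) (c i - c j) < r"
        by (intro exI[of _ ?N]) (auto simp: nrm_def)
    qed
    then obtain x where "\<And>k. (\<lambda>i. ip k (c i - x) (c i - x)) \<longlonglongrightarrow> 0" by blast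
    then have x: "(\<lambda>i. nrm k (c i - x)) \<longlonglongrightarrow> 0" for k
      unfolding nrm_def using tendsto_real_sqrt by force
    have xB: "x \<in> B (S i)" for i
    proof -
      have "nrm (m i) (x - c i) \<le> nrm (m i) (c j - x) + \<delta> i" if "i \<le> j" for j
        using nrm_triangle_diff[of "m i" x "c i" "c j"] cB[OF that] nrm_minus_commute[of "m i" x "c j"]
        by linarith
      moreover have "(\<lambda>j. nrm (m i) (c j - x) + \<delta> i) \<longlonglongrightarrow> 0 + \<delta> i"
        by (intro tendsto_intros x)
      ultimately have "nrm (m i) (x - c i) \<le> 0 + \<delta> i"
        by (intro tendsto_lowerbound[of _ _ sequentially]) (auto simp: eventually_sequentially)
      then show ?thesis by (simp add: B_def Si)
    qed
    have "x \<in> B s0" using xB[of 0] S(1)[of 0] by simp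
    then have "\<psi>' x < \<epsilon>" using m0[of x] \<delta>0 by (simp add: B_def s0_def)
    then have "eventually (\<lambda>n. \<psi> n x < \<epsilon>) sequentially" using lim by (intro order_tendstoD(2))
    then obtain N where "\<And>n. N \<le> n \<Longrightarrow> \<psi> n x < \<epsilon>" by (auto simp: eventually_sequentially)
    moreover obtain n where "N \<le> n" "\<epsilon> < \<psi> n x" using R(4)[of N] xB by blast
    ultimately show False by (meson less_asym)
  qed
  then obtain N mt \<delta>t where \<delta>t: "0 < \<delta>t" and t: "\<And>n x. N \<le> n \<Longrightarrow> nrm mt x < \<delta>t \<Longrightarrow> \<psi> n x \<le> e"
    by blast
  \<comment> \<open>The finitely many early n are added one at a time, each by its own continuity at
    \<open>0\<close>.\<close>
  have "\<exists>m. \<exists>\<delta>>0. \<forall>n<N'. \<forall>x. nrm m x < \<delta> \<longrightarrow> \<psi> n x \<le> e" for N'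
  proof (induction N')
    case (Suc N')
    then obtain m \<delta> where \<delta>: "0 < \<delta>" and m: "\<And>n x. n < N' \<Longrightarrow> nrm m x < \<delta> \<Longrightarrow> \<psi> n x \<le> e" by blast
    obtain m' \<delta>' where \<delta>': "0 < \<delta>'" and m': "\<And>x. nrm m' (x - 0) < \<delta>' \<Longrightarrow> \<bar>\<psi> N' x - \<psi> N' 0\<bar> < e"
      using cont[OF e, of 0 N'] by blast
    have "\<psi> n x \<le> e" if n: "n < Suc N'" and x: "nrm (max m m') x < min \<delta> \<delta>'" for n x
    proof -
      have "nrm m x < \<delta>" "nrm m' x < \<delta>'"
        using x nrm_mono[of m "max m m'" x] nrm_mono[of m' "max m m'" x] by auto
      then show ?thesis using m[of n x] m'[of x] n zero[of N'] by (cases "n = N'") auto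
    qed
    then show ?case using \<delta> \<delta>' by (intro exI[of _ "max m m'"] exI[of _ "min \<delta> \<delta>'"]) auto
  qed (rule exI[of _ 0], rule exI[of _ 1], simp)
  from this[of N] obtain mh \<delta>h
    where \<delta>h: "0 < \<delta>h" and h: "\<And>n x. n < N \<Longrightarrow> nrm mh x < \<delta>h \<Longrightarrow> \<psi> n x \<le> e"
    by blast
  have "\<psi> n x \<le> e" if x: "nrm (max mt mh) x < min \<delta>t \<delta>h" for n x
  proof -
    have "nrm mt x < \<delta>t" "nrm mh x < \<delta>h"
      using x nrm_mono[of mt "max mt mh" x] nrm_mono[of mh "max mt mh" x] by auto
    then show ?thesis using t h by (cases "n < N") auto
  qed
  then show ?thesis using \<delta>t \<delta>h by (intro exI[of _ "max mt mh"] exI[of _ "min \<delta>t \<delta>h"]) auto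
qed

text \<open>Each induction step replaces \<open>g\<close> by \<open>g + t *\<^sub>R e\<close> with a
  standard Gaussian t and integrates over t by Fubini. The cosine gains the factor
  \<open>exp (- (X e \<omega>)\<^sup>2 / 2)\<close>; on the right the term linear in t has mean zero
  and the quadratic one leaves \<open>ip m e e\<close>. The free \<open>g\<close> is what lets the
  induction run.\<close>

lemma gaussian_average:
  fixes X :: "'a \<Rightarrow> 'w \<Rightarrow> real"
  assumes P: "prob_space P" and meas [measurable]: "\<And>f. X f \<in> borel_measurable P"
    and lin: "\<And>f g t \<omega>. X (f + t *\<^sub>R g) \<omega> = X f \<omega> + t * X g \<omega>"
    and bound: "\<And>f. (\<integral>\<omega>. 1 - cos (X f \<omega>) \<partial>P) \<le> \<epsilon> + C * ip m f f"
    and E: "finite E"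
  shows "(\<integral>\<omega>. 1 - cos (X g \<omega>) * exp (- (\<Sum>e\<in>E. (X e \<omega>)\<^sup>2) / 2) \<partial>P)
      \<le> \<epsilon> + C * (ip m g g + (\<Sum>e\<in>E. ip m e e))"
  using E
proof (induction E arbitrary: g)
  case empty
  show ?case using bound[of g] by simp
next
  case (insert e E)
  interpret P: prob_space P by (rule P)
  interpret N: real_distribution std_normal_distribution by (rule real_dist_normal_dist)
  interpret PN: pair_prob_space P std_normal_distribution ..
  define h where "h \<omega> = exp (- (\<Sum>e\<in>E. (X e \<omega>)\<^sup>2) / 2)" for \<omega>
  have h: "0 \<le> h \<omega>" "h \<omega> \<le> 1" for \<omega> by (auto simp: h_def sum_nonneg)
  have [measurable]: "h \<in> borel_measurable P" unfolding h_def by measurable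
  have hc: "\<bar>1 - cos x * h \<omega>\<bar> \<le> 2" for x \<omega>
  proof -
    have "\<bar>cos x * h \<omega>\<bar> \<le> 1 * 1"
      unfolding abs_mult by (rule mult_mono) (use h[of \<omega>] in auto)
    then show ?thesis by linarith
  qed
  have int: "integrable std_normal_distribution (\<lambda>t. cos (X g \<omega> + t * X e \<omega>) * h \<omega>)" for \<omega>
  proof (rule N.integrable_const_bound[of _ 3])
    show "AE t in std_normal_distribution. norm (cos (X g \<omega> + t * X e \<omega>) * h \<omega>) \<le> 3"
    proof (rule AE_I2)
      fix t show "norm (cos (X g \<omega> + t * X e \<omega>) * h \<omega>) \<le> 3"
        using hc[of "X g \<omega> + t * X e \<omega>" \<omega>] unfolding real_norm_def by linarith
    qed
  qed simp
  have "(\<integral>\<omega>. 1 - cos (X g \<omega>) * exp (- (\<Sum>e\<in>insert e E. (X e \<omega>)\<^sup>2) / 2) \<partial>P)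
      = (\<integral>\<omega>. (\<integral>t. 1 - cos (X g \<omega> + t * X e \<omega>) * h \<omega> \<partial>std_normal_distribution) \<partial>P)"
  proof (intro Bochner_Integration.integral_cong refl)
    fix \<omega>
    have "exp (- (\<Sum>e\<in>insert e E. (X e \<omega>)\<^sup>2) / 2) = exp (- (X e \<omega>)\<^sup>2 / 2) * h \<omega>"
      using insert(1,2) by (simp add: h_def exp_add[symmetric] field_simps)
    then show "1 - cos (X g \<omega>) * exp (- (\<Sum>e\<in>insert e E. (X e \<omega>)\<^sup>2) / 2)
      = (\<integral>t. 1 - cos (X g \<omega> + t * X e \<omega>) * h \<omega> \<partial>std_normal_distribution)"
      using int[of \<omega>] N.prob_space by (simp add: integral_std_normal_cos)
  qed
  also have "\<dots> = (\<integral>t. (\<integral>\<omega>. 1 - cos (X g \<omega> + t * X e \<omega>) * h \<omega> \<partial>P) \<partial>std_normal_distribution)"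
    by (rule PN.Fubini_integral[symmetric], rule PN.integrable_const_bound[of _ 2]) (auto simp: hc)
  also have "\<dots> \<le> (\<integral>t. \<epsilon> + C * (ip m g g + (\<Sum>e\<in>E. ip m e e)) + 2 * C * ip m g e * t + C * ip m e e * t\<^sup>2
      \<partial>std_normal_distribution)"
  proof (rule integral_mono)
    have "\<bar>\<integral>\<omega>. 1 - cos (X g \<omega> + t * X e \<omega>) * h \<omega> \<partial>P\<bar> \<le> 2" for t
    proof -
      have "\<bar>\<integral>\<omega>. 1 - cos (X g \<omega> + t * X e \<omega>) * h \<omega> \<partial>P\<bar>
          \<le> (\<integral>\<omega>. \<bar>1 - cos (X g \<omega> + t * X e \<omega>) * h \<omega>\<bar> \<partial>P)"
        by (rule integral_abs_bound)
      also have "\<dots> \<le> (\<integral>\<omega>. 2 \<partial>P)"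
        by (intro integral_mono P.integrable_const_bound[of _ 2]) (auto simp: hc)
      finally have "\<bar>\<integral>\<omega>. 1 - cos (X g \<omega> + t * X e \<omega>) * h \<omega> \<partial>P\<bar> \<le> (\<integral>\<omega>. 2 \<partial>P)" .
      then show ?thesis using P.prob_space by simp
    qed
    then show "integrable std_normal_distribution (\<lambda>t. \<integral>\<omega>. 1 - cos (X g \<omega> + t * X e \<omega>) * h \<omega> \<partial>P)"
      by (intro N.integrable_const_bound[of _ 2]) auto
    show "integrable std_normal_distribution
        (\<lambda>t. \<epsilon> + C * (ip m g g + (\<Sum>e\<in>E. ip m e e)) + 2 * C * ip m g e * t + C * ip m e e * t\<^sup>2)"
      using std_normal_moments by auto
    fix t
    have "(\<integral>\<omega>. 1 - cos (X g \<omega> + t * X e \<omega>) * h \<omega> \<partial>P)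
        \<le> \<epsilon> + C * (ip m (g + t *\<^sub>R e) (g + t *\<^sub>R e) + (\<Sum>e\<in>E. ip m e e))"
      using insert.IH[of "g + t *\<^sub>R e"] by (simp add: lin h_def)
    also have "\<dots> = \<epsilon> + C * (ip m g g + (\<Sum>e\<in>E. ip m e e)) + 2 * C * ip m g e * t + C * ip m e e * t\<^sup>2"
      by (simp add: ip_simps ip_sym[of m e g] power2_eq_square algebra_simps)
    finally show "(\<integral>\<omega>. 1 - cos (X g \<omega> + t * X e \<omega>) * h \<omega> \<partial>P)
      \<le> \<epsilon> + C * (ip m g g + (\<Sum>e\<in>E. ip m e e)) + 2 * C * ip m g e * t + C * ip m e e * t\<^sup>2" .
  qed
  also have "\<dots> = \<epsilon> + C * (ip m g g + (\<Sum>e\<in>insert e E. ip m e e))"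
    using std_normal_moments insert(1,2) N.prob_space by (simp add: algebra_simps)
  finally show ?case .
qed

end

section \<open>Symmetry of partial derivatives\<close>

lemma has_real_derivative_along_axis:
  fixes f :: "real ^ 'n::finite \<Rightarrow> real"
  assumes "f differentiable (at (x + t *\<^sub>R axis i 1))"
  shows "((\<lambda>s. f (x + s *\<^sub>R axis i 1)) has_real_derivative
      partial_deriv i f (x + t *\<^sub>R axis i 1)) (at t)"
proof -
  let ?y = "x + t *\<^sub>R axis i 1"
  have f: "(f has_derivative frechet_derivative f (at ?y)) (at ?y)"
    using assms by (simp add: frechet_derivative_works)
  have "((\<lambda>s. x + s *\<^sub>R axis i 1) has_derivative (\<lambda>h. h *\<^sub>R axis i 1)) (at t)"
    by (auto intro!: derivative_eq_intros)
  from has_derivative_compose[OF this f]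
  have "((\<lambda>s. f (x + s *\<^sub>R axis i 1)) has_derivative
      (\<lambda>h. frechet_derivative f (at ?y) (h *\<^sub>R axis i 1))) (at t)" .
  moreover have "(\<lambda>h. frechet_derivative f (at ?y) (h *\<^sub>R axis i 1)) =
      (\<lambda>h. partial_deriv i f ?y * h)"
    using has_derivative_bounded_linear[OF f]
    by (auto simp: partial_deriv_def bounded_linear.linear linear_cmul mult.commute)
  ultimately show ?thesis by (simp add: has_field_derivative_def)
qed

text \<open>The mean value theorem twice: in direction i for the increment of \<open>f\<close> in
  direction j, then in direction j for the i-th derivative. The left side is symmetric in i and j,
  the right side is not.\<close>

lemma second_difference_eq:
  fixes f :: "real ^ 'n::finite \<Rightarrow> real"
  assumes f: "\<And>x. f differentiable (at x)" and fi: "\<And>x. partial_deriv i f differentiable (at x)"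
    and h: "0 < h"
  shows "\<exists>s t. 0 < s \<and> s < h \<and> 0 < t \<and> t < h \<and>
    f (x + h *\<^sub>R axis i 1 + h *\<^sub>R axis j 1) - f (x + h *\<^sub>R axis i 1) - f (x + h *\<^sub>R axis j 1) + f x
      = h * h * partial_deriv j (partial_deriv i f) (x + s *\<^sub>R axis i 1 + t *\<^sub>R axis j 1)"
proof -
  let ?a = "axis i 1 :: real ^ 'n" and ?b = "axis j 1 :: real ^ 'n"
  have "\<exists>s. 0 < s \<and> s < h \<and>
      (f ((x + h *\<^sub>R ?b) + h *\<^sub>R ?a) - f (x + h *\<^sub>R ?a)) - (f ((x + h *\<^sub>R ?b) + 0 *\<^sub>R ?a) - f (x + 0 *\<^sub>R ?a))
      = (h - 0) * (partial_deriv i f ((x + h *\<^sub>R ?b) + s *\<^sub>R ?a) - partial_deriv i f (x + s *\<^sub>R ?a))"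
    by (rule MVT2[OF h]) (intro DERIV_diff has_real_derivative_along_axis f)
  then obtain s where s: "0 < s" "s < h" and 1:
      "(f ((x + h *\<^sub>R ?b) + h *\<^sub>R ?a) - f (x + h *\<^sub>R ?a)) - (f (x + h *\<^sub>R ?b) - f x)
      = h * (partial_deriv i f ((x + h *\<^sub>R ?b) + s *\<^sub>R ?a) - partial_deriv i f (x + s *\<^sub>R ?a))"
    by auto
  have "\<exists>t. 0 < t \<and> t < h \<and>
      partial_deriv i f ((x + s *\<^sub>R ?a) + h *\<^sub>R ?b) - partial_deriv i f ((x + s *\<^sub>R ?a) + 0 *\<^sub>R ?b)
      = (h - 0) * partial_deriv j (partial_deriv i f) ((x + s *\<^sub>R ?a) + t *\<^sub>R ?b)"
    by (rule MVT2[OF h]) (intro has_real_derivative_along_axis fi)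
  then obtain t where t: "0 < t" "t < h" and 2:
      "partial_deriv i f ((x + s *\<^sub>R ?a) + h *\<^sub>R ?b) - partial_deriv i f (x + s *\<^sub>R ?a)
      = h * partial_deriv j (partial_deriv i f) ((x + s *\<^sub>R ?a) + t *\<^sub>R ?b)"
    by auto
  have comm: "x + h *\<^sub>R ?b + r *\<^sub>R ?a = x + r *\<^sub>R ?a + h *\<^sub>R ?b" for r by (simp add: algebra_simps)
  have "f (x + h *\<^sub>R ?a + h *\<^sub>R ?b) - f (x + h *\<^sub>R ?a) - f (x + h *\<^sub>R ?b) + f x
      = h * h * partial_deriv j (partial_deriv i f) (x + s *\<^sub>R ?a + t *\<^sub>R ?b)"
    using 1 2 unfolding comm by (simp add: algebra_simps)
  then show ?thesis using s t by blast
qed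

text \<open>Both mixed derivatives, taken at points within \<open>2 * h n\<close> of
  \<open>x\<close>, equal the same second difference divided by the square of \<open>h n\<close>;
  continuity moves both points to \<open>x\<close>.\<close>

theorem partial_deriv_commute:
  fixes f :: "real ^ 'n::finite \<Rightarrow> real"
  assumes f: "\<And>x. f differentiable (at x)"
    and fi: "\<And>x. partial_deriv i f differentiable (at x)"
    and fj: "\<And>x. partial_deriv j f differentiable (at x)"
    and cij: "continuous_on UNIV (partial_deriv i (partial_deriv j f))"
    and cji: "continuous_on UNIV (partial_deriv j (partial_deriv i f))"
  shows "partial_deriv i (partial_deriv j f) = partial_deriv j (partial_deriv i f)"
proof
  fix x
  let ?a = "axis i 1 :: real ^ 'n" and ?b = "axis j 1 :: real ^ 'n"
  define h where "h n = 1 / real (Suc n)" for n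
  have h: "0 < h n" for n by (simp add: h_def)
  have h0: "h \<longlonglongrightarrow> 0" unfolding h_def using LIMSEQ_inverse_real_of_nat by (simp add: inverse_eq_divide)
  have "\<exists>p q. norm (p - x) \<le> 2 * h n \<and> norm (q - x) \<le> 2 * h n \<and>
      partial_deriv j (partial_deriv i f) p = partial_deriv i (partial_deriv j f) q" for n
  proof -
    obtain s t where st: "0 < s" "s < h n" "0 < t" "t < h n" and 1:
      "f (x + h n *\<^sub>R ?a + h n *\<^sub>R ?b) - f (x + h n *\<^sub>R ?a) - f (x + h n *\<^sub>R ?b) + f x
      = h n * h n * partial_deriv j (partial_deriv i f) (x + s *\<^sub>R ?a + t *\<^sub>R ?b)"
      using second_difference_eq[OF f fi h] by blast
    obtain s' t' where st': "0 < s'" "s' < h n" "0 < t'" "t' < h n" and 2: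
      "f (x + h n *\<^sub>R ?b + h n *\<^sub>R ?a) - f (x + h n *\<^sub>R ?b) - f (x + h n *\<^sub>R ?a) + f x
      = h n * h n * partial_deriv i (partial_deriv j f) (x + s' *\<^sub>R ?b + t' *\<^sub>R ?a)"
      using second_difference_eq[OF f fj h] by blast
    have "x + h n *\<^sub>R ?b + h n *\<^sub>R ?a = x + h n *\<^sub>R ?a + h n *\<^sub>R ?b" by (simp add: algebra_simps)
    then have "h n * h n * partial_deriv j (partial_deriv i f) (x + s *\<^sub>R ?a + t *\<^sub>R ?b)
      = h n * h n * partial_deriv i (partial_deriv j f) (x + s' *\<^sub>R ?b + t' *\<^sub>R ?a)"
      using 1 2 by (simp add: algebra_simps)
    then have eq: "partial_deriv j (partial_deriv i f) (x + s *\<^sub>R ?a + t *\<^sub>R ?b)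
      = partial_deriv i (partial_deriv j f) (x + s' *\<^sub>R ?b + t' *\<^sub>R ?a)"
      using h[of n] by simp
    have "norm (s *\<^sub>R ?a + t *\<^sub>R ?b) \<le> 2 * h n" "norm (s' *\<^sub>R ?b + t' *\<^sub>R ?a) \<le> 2 * h n"
      using st st' norm_triangle_ineq[of "s *\<^sub>R ?a" "t *\<^sub>R ?b"]
        norm_triangle_ineq[of "s' *\<^sub>R ?b" "t' *\<^sub>R ?a"] by auto
    let ?p = "x + s *\<^sub>R ?a + t *\<^sub>R ?b" and ?q = "x + s' *\<^sub>R ?b + t' *\<^sub>R ?a"
    from \<open>norm (s *\<^sub>R ?a + t *\<^sub>R ?b) \<le> 2 * h n\<close> have "norm (?p - x) \<le> 2 * h n"
      by (simp add: add.assoc)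
    moreover from \<open>norm (s' *\<^sub>R ?b + t' *\<^sub>R ?a) \<le> 2 * h n\<close> have "norm (?q - x) \<le> 2 * h n"
      by (simp add: add.assoc)
    ultimately show ?thesis using eq by blast
  qed
  then obtain p q where pq: "\<And>n. norm (p n - x) \<le> 2 * h n" "\<And>n. norm (q n - x) \<le> 2 * h n"
    and eq: "\<And>n. partial_deriv j (partial_deriv i f) (p n) = partial_deriv i (partial_deriv j f) (q n)"
    by metis
  have "(\<lambda>n. 2 * h n) \<longlonglongrightarrow> 2 * 0" by (intro tendsto_intros h0)
  then have "(\<lambda>n. 2 * h n) \<longlonglongrightarrow> 0" by simp
  note 0 = Lim_null_comparison[OF always_eventually this]
  have "(\<lambda>n. p n - x) \<longlonglongrightarrow> 0" by (rule 0) (use pq in blast)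
  moreover have "(\<lambda>n. q n - x) \<longlonglongrightarrow> 0" by (rule 0) (use pq in blast)
  ultimately have "p \<longlonglongrightarrow> x" "q \<longlonglongrightarrow> x" by (simp_all only: LIM_zero_iff)
  then have "(\<lambda>n. partial_deriv j (partial_deriv i f) (p n)) \<longlonglongrightarrow> partial_deriv j (partial_deriv i f) x"
    by (intro continuous_on_tendsto_compose[OF cji]) simp_all
  moreover have "(\<lambda>n. partial_deriv i (partial_deriv j f) (q n)) \<longlonglongrightarrow> partial_deriv i (partial_deriv j f) x"
    using \<open>q \<longlonglongrightarrow> x\<close> by (intro continuous_on_tendsto_compose[OF cij]) simp_all
  ultimately show "partial_deriv i (partial_deriv j f) x = partial_deriv j (partial_deriv i f) x"
    unfolding eq by (rule LIMSEQ_unique[symmetric])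
qed

lemma smooth_iter_partial_differentiable: "smooth f \<Longrightarrow> iter_partial l f differentiable (at x)"
  by (auto simp: smooth_def differentiable_on_def)

lemma smooth_iter_partial_continuous: "smooth f \<Longrightarrow> continuous_on UNIV (iter_partial l f)"
  by (auto simp: smooth_def differentiable_imp_continuous_on)

lemma iter_partial_swap:
  assumes "smooth f"
  shows "iter_partial (i # j # l) f = iter_partial (j # i # l) f"
  using partial_deriv_commute[of "iter_partial l f" i j]
    smooth_iter_partial_differentiable[OF assms, of l]
    smooth_iter_partial_differentiable[OF assms, of "i # l"]
    smooth_iter_partial_differentiable[OF assms, of "j # l"]
    smooth_iter_partial_continuous[OF assms, of "i # j # l"]
    smooth_iter_partial_continuous[OF assms, of "j # i # l"]
  by simp

lemma iter_partial_move:
  assumes "smooth f"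
  shows "iter_partial (u @ i # v) f = iter_partial (i # u @ v) f"
proof (induction u)
  case (Cons a u)
  have "iter_partial ((a # u) @ i # v) f = iter_partial (a # i # u @ v) f" using Cons by simp
  also have "\<dots> = iter_partial (i # a # u @ v) f" by (rule iter_partial_swap[OF assms])
  finally show ?case by simp
qed simp

lemma iter_partial_mset_eq:
  assumes "smooth f" "mset l = mset l'"
  shows "iter_partial l f = iter_partial l' f"
  using assms(2)
proof (induction l arbitrary: l')
  case (Cons i l)
  then have "i \<in> set l'" by (metis list.set_intros(1) set_mset_mset)
  then obtain u v where l': "l' = u @ i # v" by (meson split_list)
  have "iter_partial l f = iter_partial (u @ v) f" using Cons by (simp add: l' del: foldr_append)
  then show ?case unfolding l' using iter_partial_move[OF assms(1), of u i v] by simp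
qed simp

text \<open>\<open>multi_deriv\<close> picks its list by \<open>SOME\<close>. Symmetry of
  derivatives makes the choice immaterial, so the semi-norms of the definition control derivatives
  along every list.\<close>

lemma multi_deriv_count_list:
  fixes f :: "real ^ 'n::finite \<Rightarrow> real"
  assumes "smooth f"
  shows "multi_deriv (\<chi> i. count_list l i) f = iter_partial l f"
proof -
  let ?j = "(\<chi> i. count_list l i) :: nat ^ 'n"
  have "\<forall>i. count_list (SOME l. \<forall>i. count_list l i = ?j $ i) i = ?j $ i"
    by (rule someI_ex[OF ex_list_multi_index])
  then have "mset (SOME l. \<forall>i. count_list l i = ?j $ i) = mset l"
    by (intro multiset_eqI) (simp add: count_mset)
  then show ?thesis unfolding multi_deriv_def by (rule iter_partial_mset_eq[OF assms])
qed

lemma has_derivative_partial_derivs: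
  fixes f :: "real ^ 'n::finite \<Rightarrow> real"
  assumes "f differentiable (at x)"
  shows "(f has_derivative (\<lambda>h. \<Sum>i\<in>UNIV. h $ i * partial_deriv i f x)) (at x)"
proof -
  have f: "(f has_derivative frechet_derivative f (at x)) (at x)"
    using assms by (simp add: frechet_derivative_works)
  then interpret linear "frechet_derivative f (at x)"
    using has_derivative_bounded_linear bounded_linear.linear by blast
  have "frechet_derivative f (at x) h = (\<Sum>i\<in>UNIV. h $ i * partial_deriv i f x)" for h
  proof -
    have "frechet_derivative f (at x) h = frechet_derivative f (at x) (\<Sum>i\<in>UNIV. h $ i *\<^sub>R axis i 1)"
      by (simp add: basis_expansion scalar_mult_eq_scaleR[symmetric])
    then show ?thesis by (simp add: sum scale partial_deriv_def)
  qed
  then have "frechet_derivative f (at x) = (\<lambda>h. \<Sum>i\<in>UNIV. h $ i * partial_deriv i f x)"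
    by blast
  then show ?thesis using f by simp
qed

lemma partial_deriv_eqI:
  fixes f :: "real ^ 'n::finite \<Rightarrow> real"
  assumes "(f has_derivative (\<lambda>h. \<Sum>i\<in>UNIV. h $ i * d i)) (at x)"
  shows "partial_deriv i f x = d i"
proof -
  have "frechet_derivative f (at x) = (\<lambda>h. \<Sum>i\<in>UNIV. h $ i * d i)"
    using frechet_derivative_at[OF assms] by simp
  then show ?thesis by (simp add: partial_deriv_def axis_def if_distrib[of "\<lambda>x. x * _"] sum.delta cong: if_cong)
qed

section \<open>Hilbert norms on the Schwartz space\<close>

text \<open>Indexed by lists instead of multi-indices, so that one further derivative is a
  \<open>Cons\<close>.\<close>

definition sderiv :: "'n list \<Rightarrow> 'n::finite schwartz \<Rightarrow> real ^ 'n \<Rightarrow> real" where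
  "sderiv l f = iter_partial l (schwartz_fun f)"

text \<open>A smooth weight comparable to \<open>(1 + norm x)\<^sup>2\<close> whose derivatives
  along the axes are bounded by the weight itself.\<close>

definition wt :: "real ^ 'n::finite \<Rightarrow> real" where
  "wt x = 1 + (norm x)\<^sup>2"

text \<open>A multi-index is counted once for each of its orderings, which changes Sobolev norms by
  constant factors at most. Prefixing a letter maps \<open>lists_upto k\<close> injectively into
  \<open>lists_upto (Suc k)\<close>.\<close>

definition lists_upto :: "nat \<Rightarrow> 'n::finite list set" where
  "lists_upto m = {l. length l \<le> m}"

text \<open>Lebesgue measure as a product over coordinates, which lets coordinates be integrated out
  one by one; \<open>vec_lambda\<close> leads back to vectors.\<close>

abbreviation coord_measure :: "('n::finite \<Rightarrow> real) measure" where
  "coord_measure \<equiv> Pi\<^sub>M UNIV (\<lambda>_. lborel)"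

lemma finite_lists_upto [simp]: "finite (lists_upto m :: 'n::finite list set)"
  using finite_lists_length_le[of "UNIV :: 'n set" m] by (simp add: lists_upto_def)

lemma Nil_in_lists_upto [simp]: "[] \<in> lists_upto m"
  by (simp add: lists_upto_def)

lemma smooth_schwartz_fun: "smooth (schwartz_fun f)"
  using schwartz_fun[of f] by (simp add: is_schwartz_def)

lemma sderiv_Nil: "sderiv [] f = schwartz_fun f"
  by (simp add: sderiv_def)

lemma sderiv_Cons: "sderiv (i # l) f = partial_deriv i (sderiv l f)"
  by (simp add: sderiv_def)

lemma sderiv_differentiable: "sderiv l f differentiable (at x)"
  unfolding sderiv_def by (rule smooth_iter_partial_differentiable[OF smooth_schwartz_fun])

lemma sderiv_continuous: "continuous_on A (sderiv l f)"
  unfolding sderiv_def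
  by (rule continuous_on_subset[OF smooth_iter_partial_continuous[OF smooth_schwartz_fun]]) simp

lemma sderiv_add: "sderiv l (f + g) x = sderiv l f x + sderiv l g x"
proof -
  have "schwartz_fun (f + g) = (\<lambda>x. schwartz_fun f x + schwartz_fun g x)"
    by transfer (rule refl)
  then show ?thesis
    using iter_partial_add[OF smooth_schwartz_fun[of f] smooth_schwartz_fun[of g], of l]
    by (simp add: sderiv_def)
qed

lemma sderiv_scale: "sderiv l (c *\<^sub>R f) x = c * sderiv l f x"
proof -
  have "schwartz_fun (c *\<^sub>R f) = (\<lambda>x. c * schwartz_fun f x)"
    by transfer (rule refl)
  then show ?thesis
    using iter_partial_scale[OF smooth_schwartz_fun[of f], of l c] by (simp add: sderiv_def)
qed

lemma sderiv_zero [simp]: "sderiv l 0 x = 0"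
  using sderiv_scale[of l 0 0 x] by simp

lemma sderiv_diff: "sderiv l (f - g) x = sderiv l f x - sderiv l g x"
  using sderiv_add[of l f "- 1 *\<^sub>R g" x] sderiv_scale[of l "-1" g x] by simp

lemma sderiv_sum: "sderiv l (\<Sum>i\<in>I. h i) x = (\<Sum>i\<in>I. sderiv l (h i) x)"
  by (induction I rule: infinite_finite_induct) (auto simp: sderiv_add)

lemma multi_deriv_sderiv:
  "\<exists>l. \<forall>f :: 'n::finite schwartz. multi_deriv j (schwartz_fun f) = sderiv l f"
  by (auto simp: multi_deriv_def sderiv_def)

lemma seminorm_bound:
  "(1 + norm x) ^ m * \<bar>multi_deriv j (schwartz_fun f) x\<bar> \<le> schwartz_seminorm m j f"
  unfolding schwartz_seminorm_def
  using schwartz_fun[of f] by (intro cSUP_upper) (auto simp: is_schwartz_def)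

lemma sderiv_seminorm_bound:
  "(1 + norm x) ^ m * \<bar>sderiv l f x\<bar> \<le> schwartz_seminorm m (\<chi> i. count_list l i) f"
  using seminorm_bound[of x m "\<chi> i. count_list l i" f]
    multi_deriv_count_list[OF smooth_schwartz_fun[of f], of l] by (simp add: sderiv_def)

section \<open>Polynomial weights and integrability of rapidly decreasing functions\<close>

lemma wt_ge_1: "1 \<le> wt x"
  by (simp add: wt_def)

lemma wt_pos: "0 < wt x"
  using wt_ge_1[of x] by simp

lemma wt_nonneg: "0 \<le> wt x"
  using wt_ge_1[of x] by simp

lemma wt_le: "wt x \<le> (1 + norm x)\<^sup>2"
  by (simp add: wt_def power2_sum)

lemma wt_ge: "(1 + norm x)\<^sup>2 \<le> 2 * wt x"
  using sum_squares_bound[of 1 "norm x"] by (simp add: wt_def power2_sum)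

lemma one_plus_norm_power_le: "(1 + norm x) ^ m \<le> (2 * wt x) ^ m"
proof -
  have "(1 + norm x) ^ m \<le> ((1 + norm x)\<^sup>2) ^ m"
    by (intro power_mono self_le_power) auto
  also have "\<dots> \<le> (2 * wt x) ^ m" by (rule power_mono[OF wt_ge]) simp
  finally show ?thesis .
qed

lemma wt_continuous: "continuous_on A wt"
  unfolding wt_def by (intro continuous_intros)

lemma wt_power_sderiv_le:
  "wt x ^ m * \<bar>sderiv l f x\<bar> \<le> schwartz_seminorm (2 * m) (\<chi> i. count_list l i) f"
proof -
  have "wt x ^ m * \<bar>sderiv l f x\<bar> \<le> ((1 + norm x)\<^sup>2) ^ m * \<bar>sderiv l f x\<bar>"
    by (intro mult_right_mono power_mono wt_le) (auto simp: wt_nonneg)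
  also have "\<dots> \<le> schwartz_seminorm (2 * m) (\<chi> i. count_list l i) f"
    using sderiv_seminorm_bound[of x "2 * m" l f] by (simp add: power_mult)
  finally show ?thesis .
qed

lemma borel_measurable_vec_components:
  fixes g :: "'a \<Rightarrow> real ^ 'n::finite"
  assumes "\<And>i. (\<lambda>y. g y $ i) \<in> borel_measurable M"
  shows "g \<in> borel_measurable M"
proof (rule borel_measurable_euclidean_space[THEN iffD2], rule ballI)
  fix b :: "real ^ 'n" assume "b \<in> Basis"
  then obtain i where "b = axis i 1" by (auto simp: Basis_vec_def)
  then show "(\<lambda>y. g y \<bullet> b) \<in> borel_measurable M"
    using assms[of i] by (simp add: cart_eq_inner_axis)
qed

lemma measurable_vec_lambda: "vec_lambda \<in> borel_measurable (coord_measure :: ('n::finite \<Rightarrow> real) measure)"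
  by (rule borel_measurable_vec_components) simp

lemma continuous_vec_lambda_measurable:
  fixes g :: "real ^ 'n::finite \<Rightarrow> real"
  assumes "continuous_on UNIV g"
  shows "(\<lambda>y. g (vec_lambda y)) \<in> borel_measurable coord_measure"
  using measurable_compose[OF measurable_vec_lambda borel_measurable_continuous_onI[OF assms]]
  by (simp add: comp_def)

lemma prod_one_plus_square_le: "(\<Prod>i\<in>UNIV. 1 + (x $ i)\<^sup>2) \<le> wt x ^ CARD('n)" for x :: "real ^ 'n::finite"
proof -
  have "(\<Prod>i\<in>UNIV. 1 + (x $ i)\<^sup>2) \<le> (\<Prod>i\<in>(UNIV :: 'n set). wt x)"
  proof (intro prod_mono conjI)
    fix i
    have "(x $ i)\<^sup>2 \<le> (norm x)\<^sup>2"
      using component_le_norm_cart[of x i] by (metis abs_ge_zero power2_abs power_mono)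
    then show "1 + (x $ i)\<^sup>2 \<le> wt x" by (simp add: wt_def)
  qed (simp add: add_nonneg_nonneg)
  then show ?thesis by simp
qed

lemma integrable_inverse_one_plus_square: "integrable lborel (\<lambda>t::real. 1 / (1 + t\<^sup>2))"
  using integrable_inverse_1_plus_square
  by (simp add: set_integrable_def inverse_eq_divide)

text \<open>The power \<open>wt x ^ CARD('n)\<close> dominates the product of the
  \<open>1 + (x $ i)\<^sup>2\<close>, and the inverse of that product is a product of integrable
  functions of one variable.\<close>

lemma integrable_inverse_wt:
  "integrable coord_measure (\<lambda>y. 1 / wt (vec_lambda y :: real ^ 'n::finite) ^ CARD('n))"
proof (rule Bochner_Integration.integrable_bound)
  interpret product_sigma_finite "\<lambda>_::'n. lborel :: real measure" ..
  show "integrable coord_measure (\<lambda>y. \<Prod>i\<in>(UNIV::'n set). 1 / (1 + (y i)\<^sup>2) :: real)"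
    by (rule product_integrable_prod) (auto intro: integrable_inverse_one_plus_square)
  show "(\<lambda>y. 1 / wt (vec_lambda y :: real ^ 'n) ^ CARD('n)) \<in> borel_measurable coord_measure"
    by (rule continuous_vec_lambda_measurable[where g = "\<lambda>x. 1 / wt x ^ CARD('n)"])
       (intro continuous_on_divide continuous_on_power continuous_on_const wt_continuous ballI,
        simp add: wt_pos[THEN less_imp_neq, symmetric])
  have "1 / wt x ^ CARD('n) \<le> (\<Prod>i\<in>UNIV. 1 / (1 + (x $ i)\<^sup>2))" for x :: "real ^ 'n"
    using prod_one_plus_square_le[of x]
    by (auto simp: prod_dividef intro!: divide_left_mono mult_pos_pos prod_pos zero_less_power wt_pos add_pos_nonneg)
  from this[of "vec_lambda y" for y]
  have "1 / wt (vec_lambda y :: real ^ 'n) ^ CARD('n) \<le> (\<Prod>i\<in>UNIV. 1 / (1 + (y i)\<^sup>2))" for y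
    by simp
  then show "AE y in coord_measure. norm (1 / wt (vec_lambda y :: real ^ 'n) ^ CARD('n))
      \<le> norm (\<Prod>i\<in>(UNIV::'n set). 1 / (1 + (y i)\<^sup>2) :: real)"
    by (intro AE_I2) (auto simp: wt_nonneg abs_of_nonneg intro!: order_trans[OF _ abs_ge_self])
qed

lemma integrable_of_decay:
  fixes g :: "real ^ 'n::finite \<Rightarrow> real"
  assumes "continuous_on UNIV g" and "\<And>x. wt x ^ CARD('n) * \<bar>g x\<bar> \<le> C"
  shows "integrable coord_measure (\<lambda>y. g (vec_lambda y))"
proof (rule Bochner_Integration.integrable_bound)
  show "integrable coord_measure (\<lambda>y. C * (1 / wt (vec_lambda y :: real ^ 'n) ^ CARD('n)))"
    by (intro integrable_mult_right integrable_inverse_wt)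
  show "(\<lambda>y. g (vec_lambda y)) \<in> borel_measurable coord_measure"
    by (rule continuous_vec_lambda_measurable[OF assms(1)])
  have "\<bar>g x\<bar> \<le> \<bar>C * (1 / wt x ^ CARD('n))\<bar>" for x
  proof -
    have "\<bar>g x\<bar> \<le> C / wt x ^ CARD('n)"
      using assms(2)[of x] wt_pos[of x] by (simp add: field_simps)
    then show ?thesis using abs_ge_self[of "C / wt x ^ CARD('n)"] by simp
  qed
  then show "AE y in coord_measure. norm (g (vec_lambda y)) \<le> norm (C * (1 / wt (vec_lambda y :: real ^ 'n) ^ CARD('n)))"
    by simp
qed

text \<open>The factor from \<open>f\<close> absorbs the whole weight, including the
  \<open>CARD('n)\<close> powers that buy integrability; the factor from \<open>g\<close> is simply
  bounded.\<close>

lemma sderiv_product_integrable: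
  fixes f g :: "'n::finite schwartz"
  shows "integrable coord_measure
    (\<lambda>y. wt (vec_lambda y) ^ m * (sderiv l f (vec_lambda y) * sderiv l' g (vec_lambda y)))"
proof (rule integrable_of_decay[where g = "\<lambda>x. wt x ^ m * (sderiv l f x * sderiv l' g x)"])
  show "continuous_on UNIV (\<lambda>x. wt x ^ m * (sderiv l f x * sderiv l' g x))"
    by (intro continuous_intros wt_continuous sderiv_continuous)
  fix x :: "real ^ 'n"
  let ?A = "schwartz_seminorm (2 * (CARD('n) + m)) (\<chi> i. count_list l i) f"
  let ?B = "schwartz_seminorm (2 * 0) (\<chi> i. count_list l' i) g"
  have "wt x ^ CARD('n) * \<bar>wt x ^ m * (sderiv l f x * sderiv l' g x)\<bar>
      = (wt x ^ (CARD('n) + m) * \<bar>sderiv l f x\<bar>) * (wt x ^ 0 * \<bar>sderiv l' g x\<bar>)"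
    using wt_nonneg[of x] by (simp add: abs_mult power_add)
  also have "\<dots> \<le> ?A * ?B"
    by (intro mult_mono' wt_power_sderiv_le) (auto simp: wt_nonneg)
  finally show "wt x ^ CARD('n) * \<bar>wt x ^ m * (sderiv l f x * sderiv l' g x)\<bar> \<le> ?A * ?B" .
qed

section \<open>Weighted Sobolev inner products and a Sobolev inequality\<close>

definition sip :: "nat \<Rightarrow> 'n::finite schwartz \<Rightarrow> 'n schwartz \<Rightarrow> real" where
  "sip m f g = (\<Sum>l\<in>lists_upto m. \<integral>y. wt (vec_lambda y) ^ m *
     (sderiv l f (vec_lambda y) * sderiv l g (vec_lambda y)) \<partial>coord_measure)"

text \<open>Weight exponent and order of differentiation are separate parameters because the Sobolev
  inequality raises the order and keeps the weight.\<close>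

definition sdensity :: "nat \<Rightarrow> nat \<Rightarrow> 'n::finite schwartz \<Rightarrow> real ^ 'n \<Rightarrow> real" where
  "sdensity m k f x = (\<Sum>l\<in>lists_upto k. wt x ^ m * (sderiv l f x)\<^sup>2)"

lemma sdensity_nonneg: "0 \<le> sdensity m k f x"
  by (simp add: sdensity_def sum_nonneg wt_nonneg)

lemma sdensity_mono:
  assumes "m \<le> m'" "k \<le> k'"
  shows "sdensity m k f x \<le> sdensity m' k' f x"
proof -
  have "sdensity m k f x \<le> (\<Sum>l\<in>lists_upto k. wt x ^ m' * (sderiv l f x)\<^sup>2)"
    unfolding sdensity_def by (intro sum_mono mult_right_mono power_increasing assms wt_ge_1) simp
  also have "\<dots> \<le> sdensity m' k' f x"
    unfolding sdensity_def using assms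
    by (intro sum_mono2 finite_lists_upto mult_nonneg_nonneg) (auto simp: lists_upto_def wt_nonneg)
  finally show ?thesis .
qed

lemma sdensity_continuous: "continuous_on A (sdensity m k f)"
  unfolding sdensity_def[abs_def] by (intro continuous_intros wt_continuous sderiv_continuous)

lemma sdensity_integrable: "integrable coord_measure (\<lambda>y. sdensity m k f (vec_lambda y))"
  unfolding sdensity_def
  using sderiv_product_integrable[of m _ f _ f] by (auto simp: power2_eq_square)

lemma sip_eq_sdensity: "sip m f f = (\<integral>y. sdensity m m f (vec_lambda y) \<partial>coord_measure)"
  unfolding sdensity_def sip_def
  using sderiv_product_integrable[of m _ f _ f] by (subst Bochner_Integration.integral_sum) (auto simp: power2_eq_square)

lemma sip_nonneg: "0 \<le> sip m f f"
  unfolding sip_eq_sdensity by (intro integral_nonneg_AE AE_I2 sdensity_nonneg)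

lemma sip_mono: "m \<le> k \<Longrightarrow> sip m f f \<le> sip k f f"
  unfolding sip_eq_sdensity by (intro integral_mono sdensity_integrable sdensity_mono)

lemma sip_sym: "sip m f g = sip m g f"
  by (simp add: sip_def mult.commute)

lemma sip_scale: "sip m (c *\<^sub>R f) g = c * sip m f g"
  by (simp add: sip_def sderiv_scale sum_distrib_left mult.left_commute mult.assoc)

lemma sip_add: "sip m (f + g) h = sip m f h + sip m g h"
  unfolding sip_def sderiv_add distrib_right distrib_left sum.distrib[symmetric]
  by (intro sum.cong refl Bochner_Integration.integral_add sderiv_product_integrable)

text \<open>Pointwise bounds control the norm once \<open>CARD('n)\<close> surplus powers of the
  weight are at hand, because \<open>1 / wt x ^ CARD('n)\<close> is integrable. This is the easy
  converse of the Sobolev inequality.\<close>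

lemma sip_le:
  fixes f :: "'n::finite schwartz"
  assumes "\<And>l x. l \<in> lists_upto m \<Longrightarrow> wt x ^ (m + CARD('n)) * (sderiv l f x)\<^sup>2 \<le> C"
  shows "sip m f f \<le> real (card (lists_upto m :: 'n list set)) * C *
    (\<integral>y. 1 / wt (vec_lambda y :: real ^ 'n) ^ CARD('n) \<partial>coord_measure)"
proof -
  have "sip m f f \<le> (\<integral>y. real (card (lists_upto m :: 'n list set)) * C *
      (1 / wt (vec_lambda y :: real ^ 'n) ^ CARD('n)) \<partial>coord_measure)"
    unfolding sip_eq_sdensity
  proof (intro integral_mono sdensity_integrable integrable_mult_right integrable_inverse_wt)
    fix y
    have "sdensity m m f x \<le> (\<Sum>l\<in>(lists_upto m :: 'n list set). C * (1 / wt x ^ CARD('n)))" for x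
      unfolding sdensity_def using assms[of _ x] wt_pos[of x]
      by (intro sum_mono) (simp add: power_add field_simps)
    then show "sdensity m m f (vec_lambda y) \<le> real (card (lists_upto m :: 'n list set)) * C *
      (1 / wt (vec_lambda y :: real ^ 'n) ^ CARD('n))" by simp
  qed
  then show ?thesis unfolding integral_mult_right_zero .
qed

text \<open>The fundamental theorem of calculus from minus infinity to \<open>x\<close>, with
  \<open>G'\<close> replaced by its majorant. In extended reals an infinite integral is a trivial
  case, so the iteration over coordinates can postpone integrability to its end.\<close>

lemma le_nn_integral_dominating_derivative:
  fixes G G' v :: "real \<Rightarrow> real"
  assumes G: "\<And>t. (G has_real_derivative G' t) (at t)" and le: "\<And>t. G' t \<le> v t"
    and v: "continuous_on UNIV v" "\<And>t. 0 \<le> v t" and lim: "(G \<longlongrightarrow> 0) at_bot"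
  shows "ennreal (G x) \<le> (\<integral>\<^sup>+t. ennreal (v t) \<partial>lborel)"
proof (cases "(\<integral>\<^sup>+t. ennreal (v t) \<partial>lborel)")
  case (real r)
  have "G x - G a \<le> r" if "a \<le> x" for a
  proof -
    define F where "F t = integral {a..t} v" for t
    have vi: "v integrable_on {a..x}"
      by (intro integrable_continuous_interval continuous_on_subset[OF v(1)]) simp
    have "(G' has_integral G x - G a) {a..x}"
      using G by (intro fundamental_theorem_of_calculus that)
        (auto simp: has_real_derivative_iff_has_vector_derivative[symmetric] intro: has_field_derivative_at_within)
    then have 1: "G x - G a \<le> F x"
      using has_integral_le[OF _ integrable_integral[OF vi]] le by (auto simp: F_def)
    have "ennreal (F x) = (\<integral>\<^sup>+t. ennreal (v t) * indicator {a..x} t \<partial>lborel)"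
      unfolding F_def using v(2)
      by (intro nn_integral_has_integral_lebesgue'[symmetric] integrable_integral vi) auto
    also have "\<dots> \<le> (\<integral>\<^sup>+t. ennreal (v t) \<partial>lborel)"
      by (intro nn_integral_mono) (auto simp: indicator_def)
    finally have "F x \<le> r" using real by simp
    then show ?thesis using 1 by simp
  qed
  then have "eventually (\<lambda>a. G x - G a \<le> r) at_bot"
    by (rule eventually_mono[OF eventually_le_at_bot])
  moreover have "((\<lambda>a. G x - G a) \<longlongrightarrow> G x - 0) at_bot" by (intro tendsto_intros lim)
  ultimately have "G x - 0 \<le> r" by (intro tendsto_upperbound[of _ _ at_bot]) auto
  then show ?thesis using real by (simp add: ennreal_leI)
qed simp

text \<open>Along an axis \<open>wt\<close> has derivative \<open>2 * z $ i\<close> at z, and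
  \<open>2 * norm z \<le> 1 + (norm z)\<^sup>2 = wt z\<close>. Differentiating a power of the weight
  thus costs a constant but no power.\<close>

lemma wt_power_derivative:
  "\<exists>D. ((\<lambda>s. wt (x + s *\<^sub>R axis i 1) ^ m) has_real_derivative D) (at t) \<and>
     \<bar>D\<bar> \<le> real m * wt (x + t *\<^sub>R axis i 1) ^ m"
proof -
  let ?z = "\<lambda>s. x + s *\<^sub>R axis i 1"
  have w: "wt (?z s) = 1 + (norm x)\<^sup>2 + 2 * s * (x $ i) + s\<^sup>2" for s
    unfolding wt_def power2_norm_eq_inner
    by (simp add: inner_add_left inner_add_right inner_axis inner_axis' power2_eq_square)
       (simp add: axis_def algebra_simps)
  have z: "?z t $ i = x $ i + t" by (simp add: axis_def)
  have d: "((\<lambda>s. wt (?z s)) has_real_derivative 2 * (x $ i + t)) (at t)"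
    unfolding w by (auto intro!: derivative_eq_intros)
  have "2 * \<bar>x $ i + t\<bar> \<le> wt (?z t)"
  proof -
    have "\<bar>x $ i + t\<bar> \<le> norm (?z t)" using component_le_norm_cart[of "?z t" i] z by simp
    then have "2 * \<bar>x $ i + t\<bar> \<le> 2 * norm (?z t)" by simp
    also have "2 * norm (?z t) \<le> wt (?z t)"
      using sum_squares_bound[of 1 "norm (?z t)"] by (simp add: wt_def)
    finally show ?thesis .
  qed
  then have "\<bar>real m * wt (?z t) ^ (m - 1) * (2 * (x $ i + t))\<bar> \<le> real m * wt (?z t) ^ m"
  proof (cases m)
    case (Suc k)
    have "\<bar>real m * wt (?z t) ^ (m - 1) * (2 * (x $ i + t))\<bar> = real m * wt (?z t) ^ k * (2 * \<bar>x $ i + t\<bar>)"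
      using wt_nonneg[of "?z t"] abs_mult[of 2 "x $ i + t"] Suc
      by (simp add: abs_mult[of _ "2 * (x $ i + t)"] del: distrib_left_numeral)
    also have "\<dots> \<le> real m * wt (?z t) ^ k * wt (?z t)"
      using \<open>2 * \<bar>x $ i + t\<bar> \<le> wt (?z t)\<close> wt_nonneg[of "?z t"] by (intro mult_left_mono) auto
    finally show ?thesis by (simp add: Suc mult.assoc power_commutes)
  qed simp
  then show ?thesis
    using DERIV_power[OF d, of m] by (intro exI[of _ "real m * wt (?z t) ^ (m - 1) * (2 * (x $ i + t))"])
      (simp add: mult.commute mult.left_commute)
qed

text \<open>Product rule and \<open>2 * a * b \<le> a\<^sup>2 + b\<^sup>2\<close>. The integrand is
  quadratic in \<open>f\<close>, so its derivative is controlled by an integrand of the same kind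
  with one more order, and the estimate can be iterated.\<close>

lemma sdensity_derivative:
  "\<exists>D. ((\<lambda>s. sdensity m k f (x + s *\<^sub>R axis i 1)) has_real_derivative D) (at t) \<and>
     D \<le> 2 * real (m + 1) * sdensity m (Suc k) f (x + t *\<^sub>R axis i 1)"
proof -
  let ?z = "\<lambda>s. x + s *\<^sub>R axis i 1"
  have "\<exists>D. ((\<lambda>s. wt (?z s) ^ m * (sderiv l f (?z s))\<^sup>2) has_real_derivative D) (at t) \<and>
     D \<le> real (m + 1) * (wt (?z t) ^ m * (sderiv l f (?z t))\<^sup>2 + wt (?z t) ^ m * (sderiv (i # l) f (?z t))\<^sup>2)" (is "\<exists>D. ?P l D \<and> ?Q l D") for l
  proof -
    obtain D where D: "((\<lambda>s. wt (?z s) ^ m) has_real_derivative D) (at t)" "\<bar>D\<bar> \<le> real m * wt (?z t) ^ m"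
      using wt_power_derivative by blast
    have d: "((\<lambda>s. sderiv l f (?z s)) has_real_derivative sderiv (i # l) f (?z t)) (at t)"
      unfolding sderiv_Cons by (intro has_real_derivative_along_axis sderiv_differentiable)
    let ?g = "sderiv l f (?z t)" and ?h = "sderiv (i # l) f (?z t)" and ?W = "wt (?z t) ^ m"
    have "((\<lambda>s. wt (?z s) ^ m * (sderiv l f (?z s))\<^sup>2) has_real_derivative
        D * ?g\<^sup>2 + ?W * (2 * ?g * ?h)) (at t)"
      using DERIV_mult[OF D(1) DERIV_power[OF d, of 2]] by (simp add: ac_simps)
    moreover have "D * ?g\<^sup>2 + ?W * (2 * ?g * ?h) \<le> real (m + 1) * (?W * ?g\<^sup>2 + ?W * ?h\<^sup>2)"
    proof -
      have "D * ?g\<^sup>2 \<le> real m * ?W * ?g\<^sup>2"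
        using D(2) by (intro mult_right_mono) auto
      moreover have "?W * (2 * ?g * ?h) \<le> ?W * (?g\<^sup>2 + ?h\<^sup>2)"
        by (intro mult_left_mono sum_squares_bound zero_le_power wt_nonneg)
      moreover have "0 \<le> real m * (?W * ?h\<^sup>2)" by (simp add: wt_nonneg)
      ultimately show ?thesis by (simp add: algebra_simps)
    qed
    ultimately show ?thesis by blast
  qed
  then have "\<exists>D. \<forall>l. ?P l (D l) \<and> ?Q l (D l)" by (intro choice allI)
  then obtain D where D: "\<And>l. ?P l (D l)" "\<And>l. ?Q l (D l)" by blast
  have "((\<lambda>s. sdensity m k f (?z s)) has_real_derivative (\<Sum>l\<in>lists_upto k. D l)) (at t)"
    unfolding sdensity_def by (intro DERIV_sum D(1))
  moreover have "(\<Sum>l\<in>lists_upto k. D l) \<le> 2 * real (m + 1) * sdensity m (Suc k) f (?z t)"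
  proof -
    \<comment> \<open>The sum over \<open>l\<close> and the sum over \<open>i # l\<close> are each
      part of the sum over \<open>lists_upto (Suc k)\<close>, hence the factor 2.\<close>
    have "(\<Sum>l\<in>lists_upto k. wt (?z t) ^ m * (sderiv (i # l) f (?z t))\<^sup>2)
        = (\<Sum>l\<in>(\<lambda>l. i # l) ` lists_upto k. wt (?z t) ^ m * (sderiv l f (?z t))\<^sup>2)"
      by (subst sum.reindex) auto
    also have "\<dots> \<le> sdensity m (Suc k) f (?z t)"
      unfolding sdensity_def
      by (intro sum_mono2 finite_lists_upto mult_nonneg_nonneg) (auto simp: lists_upto_def wt_nonneg)
    finally have "sdensity m k f (?z t) + (\<Sum>l\<in>lists_upto k. wt (?z t) ^ m * (sderiv (i # l) f (?z t))\<^sup>2)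
        \<le> 2 * sdensity m (Suc k) f (?z t)"
      using sdensity_mono[of m m k "Suc k" f "?z t"] by simp
    then have "real (m + 1) * (sdensity m k f (?z t) +
        (\<Sum>l\<in>lists_upto k. wt (?z t) ^ m * (sderiv (i # l) f (?z t))\<^sup>2))
        \<le> real (m + 1) * (2 * sdensity m (Suc k) f (?z t))"
      by (rule mult_left_mono) simp
    moreover have "(\<Sum>l\<in>lists_upto k. D l) \<le> real (m + 1) * (sdensity m k f (?z t) +
        (\<Sum>l\<in>lists_upto k. wt (?z t) ^ m * (sderiv (i # l) f (?z t))\<^sup>2))"
      unfolding sdensity_def sum.distrib[symmetric] sum_distrib_left by (intro sum_mono D(2))
    ultimately show ?thesis by (simp add: algebra_simps)
  qed
  ultimately show ?thesis by blast
qed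

lemma sdensity_decay: "\<exists>C. \<forall>x. wt x * sdensity m k f x \<le> C"
proof (intro exI allI)
  fix x
  let ?p = "\<lambda>a l. schwartz_seminorm (2 * a) (\<chi> i. count_list l i) f"
  have "wt x * sdensity m k f x = (\<Sum>l\<in>lists_upto k. (wt x ^ Suc m * \<bar>sderiv l f x\<bar>) * (wt x ^ 0 * \<bar>sderiv l f x\<bar>))"
    by (simp add: sdensity_def sum_distrib_left power2_eq_square[of "sderiv _ f x"] mult.assoc abs_mult_self_eq)
  also have "\<dots> \<le> (\<Sum>l\<in>lists_upto k. ?p (Suc m) l * ?p 0 l)"
    by (intro sum_mono mult_mono' wt_power_sderiv_le) (auto simp: wt_nonneg)
  finally show "wt x * sdensity m k f x \<le> (\<Sum>l\<in>lists_upto k. ?p (Suc m) l * ?p 0 l)" .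
qed

lemma sdensity_tendsto_0:
  "((\<lambda>s. sdensity m k f (x + s *\<^sub>R axis i 1)) \<longlongrightarrow> 0) at_bot"
proof -
  obtain C where C: "\<And>x. wt x * sdensity m k f x \<le> C" using sdensity_decay by blast
  have "0 \<le> C" using C[of 0] sdensity_nonneg[of m k f 0] wt_nonneg[of 0] by (meson mult_nonneg_nonneg order_trans)
  have "sdensity m k f (x + s *\<^sub>R axis i 1) \<le> C / (1 + (x $ i + s)\<^sup>2)" for s
  proof -
    let ?z = "x + s *\<^sub>R axis i 1"
    have "(?z $ i)\<^sup>2 \<le> (norm ?z)\<^sup>2"
      using component_le_norm_cart[of ?z i] by (metis abs_ge_zero power2_abs power_mono)
    then have le: "1 + (x $ i + s)\<^sup>2 \<le> wt ?z" by (simp add: wt_def axis_def)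
    have "(1 + (x $ i + s)\<^sup>2) * sdensity m k f ?z \<le> wt ?z * sdensity m k f ?z"
      by (intro mult_right_mono le sdensity_nonneg)
    also have "\<dots> \<le> C" by (rule C)
    finally show ?thesis by (subst pos_le_divide_eq) (auto simp: mult.commute add_pos_nonneg)
  qed
  moreover have "((\<lambda>s. C / (1 + (x $ i + s)\<^sup>2)) \<longlongrightarrow> 0) at_bot"
    by real_asymp
  ultimately show ?thesis
    using tendsto_sandwich[of "\<lambda>_. 0" "\<lambda>s. sdensity m k f (x + s *\<^sub>R axis i 1)" at_bot
        "\<lambda>s. C / (1 + (x $ i + s)\<^sup>2)" 0] by (simp add: sdensity_nonneg)
qed

text \<open>Integrating out the coordinates in \<open>I\<close> one after the other, each at the cost of one
  derivative.\<close>

lemma sdensity_le_partial_integral: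
  fixes f :: "'n::finite schwartz"
  assumes "finite I"
  shows "ennreal (sdensity m k f x) \<le> ennreal (2 * real (m + 1)) ^ card I *
    (\<integral>\<^sup>+y. ennreal (sdensity m (k + card I) f (\<chi> j. if j \<in> I then y j else x $ j)) \<partial>Pi\<^sub>M I (\<lambda>_. lborel))"
  using assms
proof (induction I)
  case empty
  have "(\<chi> j. x $ j) = x" by (simp add: vec_eq_iff)
  then show ?case by (simp add: nn_integral_empty PiM_empty nn_integral_count_space_finite)
next
  case (insert i I)
  interpret product_sigma_finite "\<lambda>_::'n. lborel :: real measure" ..
  let ?c = "2 * real (m + 1)" and ?z = "\<lambda>J y. (\<chi> j. if j \<in> J then y j else x $ j) :: real ^ 'n"
  let ?J = "insert i I"
  have step: "ennreal (sdensity m (k + card I) f (?z I y)) \<le>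
      ennreal ?c * (\<integral>\<^sup>+t. ennreal (sdensity m (k + card ?J) f (?z ?J (y(i := t)))) \<partial>lborel)" for y
  proof -
    \<comment> \<open>With i-th coordinate \<open>0\<close> at the base point, the line in direction
      i is parametrized by that coordinate itself.\<close>
    let ?x0 = "?z ?J (y(i := 0))"
    have z: "?x0 + t *\<^sub>R axis i 1 = ?z ?J (y(i := t))" for t
      by (auto simp: vec_eq_iff axis_def)
    have zI: "?z I y = ?x0 + (x $ i) *\<^sub>R axis i 1"
      using insert(2) by (auto simp: vec_eq_iff axis_def)
    have "\<exists>D. \<forall>t. ((\<lambda>s. sdensity m (k + card I) f (?x0 + s *\<^sub>R axis i 1)) has_real_derivative D t) (at t) \<and>
        D t \<le> ?c * sdensity m (Suc (k + card I)) f (?x0 + t *\<^sub>R axis i 1)"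
      by (intro choice allI sdensity_derivative)
    then obtain D where D:
      "\<And>t. ((\<lambda>s. sdensity m (k + card I) f (?x0 + s *\<^sub>R axis i 1)) has_real_derivative D t) (at t)"
      "\<And>t. D t \<le> ?c * sdensity m (Suc (k + card I)) f (?x0 + t *\<^sub>R axis i 1)"
      by blast
    have "ennreal (sdensity m (k + card I) f (?x0 + (x $ i) *\<^sub>R axis i 1)) \<le>
        (\<integral>\<^sup>+t. ennreal (?c * sdensity m (Suc (k + card I)) f (?x0 + t *\<^sub>R axis i 1)) \<partial>lborel)"
    proof (rule le_nn_integral_dominating_derivative[OF D])
      show "continuous_on UNIV (\<lambda>t. ?c * sdensity m (Suc (k + card I)) f (?x0 + t *\<^sub>R axis i 1))"
        by (intro continuous_on_mult continuous_on_const continuous_on_compose2[OF sdensity_continuous[of UNIV]]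
            continuous_intros) auto
    qed (auto intro!: sdensity_tendsto_0 mult_nonneg_nonneg sdensity_nonneg)
    also have "\<dots> = ennreal ?c * (\<integral>\<^sup>+t. ennreal (sdensity m (k + card ?J) f (?x0 + t *\<^sub>R axis i 1)) \<partial>lborel)"
      using insert(1,2)
      by (subst nn_integral_cmult[symmetric])
         (auto intro!: borel_measurable_continuous_onI continuous_on_compose2[OF sdensity_continuous[of UNIV]]
           continuous_intros simp: ennreal_mult sdensity_nonneg)
    finally show ?thesis unfolding z zI by simp
  qed
  have meas: "(\<lambda>y. ennreal (sdensity m (k + card ?J) f (?z ?J y))) \<in> borel_measurable (Pi\<^sub>M ?J (\<lambda>_. lborel))"
  proof (intro measurable_compose[OF _ measurable_ennreal]
      measurable_compose[OF _ borel_measurable_continuous_onI[OF sdensity_continuous]] borel_measurable_vec_components)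
    fix j
    show "(\<lambda>y. ?z ?J y $ j) \<in> borel_measurable (Pi\<^sub>M ?J (\<lambda>_. lborel))"
      by (cases "j \<in> ?J") (auto simp del: insert_iff)
  qed
  have meas': "(\<lambda>y. \<integral>\<^sup>+t. ennreal (sdensity m (k + card ?J) f (?z ?J (y(i := t)))) \<partial>lborel)
      \<in> borel_measurable (Pi\<^sub>M I (\<lambda>_. lborel))"
  proof -
    have "(\<lambda>p. (fst p)(i := snd p)) \<in> measurable (Pi\<^sub>M I (\<lambda>_. lborel) \<Otimes>\<^sub>M lborel) (Pi\<^sub>M ?J (\<lambda>_. lborel :: real measure))"
      by (rule measurable_add_dim[unfolded case_prod_beta'])
    from measurable_compose[OF this meas]
    have "(\<lambda>(y, t). ennreal (sdensity m (k + card ?J) f (?z ?J (y(i := t)))))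
      \<in> borel_measurable (Pi\<^sub>M I (\<lambda>_. lborel) \<Otimes>\<^sub>M lborel)"
      unfolding case_prod_beta' .
    then show ?thesis by (intro sigma_finite_measure.borel_measurable_nn_integral) (auto intro: sigma_finite_lborel)
  qed
  have "ennreal (sdensity m k f x) \<le> ennreal ?c ^ card I *
      (\<integral>\<^sup>+y. ennreal (sdensity m (k + card I) f (?z I y)) \<partial>Pi\<^sub>M I (\<lambda>_. lborel))"
    by (rule insert.IH)
  also have "\<dots> \<le> ennreal ?c ^ card I * (\<integral>\<^sup>+y. ennreal ?c *
      (\<integral>\<^sup>+t. ennreal (sdensity m (k + card ?J) f (?z ?J (y(i := t)))) \<partial>lborel) \<partial>Pi\<^sub>M I (\<lambda>_. lborel))"
    by (intro mult_left_mono nn_integral_mono step) simp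
  also have "\<dots> = ennreal ?c ^ card ?J * (\<integral>\<^sup>+y.
      (\<integral>\<^sup>+t. ennreal (sdensity m (k + card ?J) f (?z ?J (y(i := t)))) \<partial>lborel) \<partial>Pi\<^sub>M I (\<lambda>_. lborel))"
    using insert(1,2) by (subst nn_integral_cmult[OF meas']) (simp add: ac_simps)
  also have "\<dots> = ennreal ?c ^ card ?J *
      (\<integral>\<^sup>+y. ennreal (sdensity m (k + card ?J) f (?z ?J y)) \<partial>Pi\<^sub>M ?J (\<lambda>_. lborel))"
    by (subst product_nn_integral_insert[OF insert(1,2) meas]) simp
  finally show ?case .
qed

text \<open>Integrating out all coordinates costs \<open>CARD('n)\<close> derivatives and one factor
  \<open>2 * (m + 1)\<close> for each of them.\<close>

lemma sobolev:
  fixes f :: "'n::finite schwartz"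
  assumes "m \<le> M" "k + CARD('n) \<le> M"
  shows "sdensity m k f x \<le> (2 * real (m + 1)) ^ CARD('n) * sip M f f"
proof -
  define c where "c = 2 * real (m + 1)"
  have c: "ennreal c ^ CARD('n) * ennreal (sip M f f) = ennreal (c ^ CARD('n) * sip M f f)"
  proof -
    have "0 \<le> c" by (simp add: c_def)
    then show ?thesis by (simp add: ennreal_power ennreal_mult sip_nonneg)
  qed
  have "ennreal (sdensity m k f x) \<le> ennreal c ^ CARD('n) *
    (\<integral>\<^sup>+y. ennreal (sdensity m (k + CARD('n)) f (vec_lambda y)) \<partial>coord_measure)"
    using sdensity_le_partial_integral[OF finite_class.finite_UNIV, of m k f x] by (simp add: c_def)
  also have "(\<integral>\<^sup>+y. ennreal (sdensity m (k + CARD('n)) f (vec_lambda y)) \<partial>coord_measure)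
      = ennreal (\<integral>y. sdensity m (k + CARD('n)) f (vec_lambda y) \<partial>coord_measure)"
    by (intro nn_integral_eq_integral sdensity_integrable AE_I2 sdensity_nonneg)
  also have "\<dots> \<le> ennreal (sip M f f)"
    unfolding sip_eq_sdensity
    by (intro ennreal_leI integral_mono sdensity_integrable sdensity_mono assms)
  finally have "ennreal (sdensity m k f x) \<le> ennreal (c ^ CARD('n) * sip M f f)"
    unfolding c[symmetric] by (simp add: mult_left_mono)
  then show ?thesis by (simp add: sip_nonneg c_def)
qed

text \<open>The shift by \<open>CARD('n)\<close> provides the derivatives that the Sobolev
  inequality spends; with it every form of the scale is positive definite.\<close>

definition schwartz_ip :: "nat \<Rightarrow> 'n::finite schwartz \<Rightarrow> 'n schwartz \<Rightarrow> real" where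
  "schwartz_ip m = sip (m + CARD('n))"

lemma wt_power_sderiv_square_le_sip:
  fixes f :: "'n::finite schwartz"
  assumes "length l \<le> k" "m \<le> M" "k + CARD('n) \<le> M"
  shows "wt x ^ m * (sderiv l f x)\<^sup>2 \<le> (2 * real (m + 1)) ^ CARD('n) * sip M f f"
proof -
  have "wt x ^ m * (sderiv l f x)\<^sup>2 \<le> sdensity m k f x"
  proof -
    have "l \<in> lists_upto k" using assms(1) by (simp add: lists_upto_def)
    then show ?thesis unfolding sdensity_def
      by (rule member_le_sum) (auto simp: wt_nonneg)
  qed
  also have "\<dots> \<le> (2 * real (m + 1)) ^ CARD('n) * sip M f f"
    by (rule sobolev) fact+
  finally show ?thesis .
qed

text \<open>The square root of the Sobolev inequality with weight exponent \<open>2 * m\<close>,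
  which explains the index \<open>2 * m + length l\<close>.\<close>

lemma wt_power_sderiv_le_sip:
  fixes l :: "'n::finite list"
  shows "\<exists>C>0. \<forall>f x. wt x ^ m * \<bar>sderiv l f x\<bar> \<le> C * sqrt (schwartz_ip (2 * m + length l) f f)"
proof (intro exI[of _ "sqrt ((2 * real (2 * m + 1)) ^ CARD('n))"] conjI allI)
  fix f :: "'n schwartz" and x
  have "sqrt (wt x ^ (2 * m) * (sderiv l f x)\<^sup>2)
      \<le> sqrt ((2 * real (2 * m + 1)) ^ CARD('n) * schwartz_ip (2 * m + length l) f f)"
    unfolding schwartz_ip_def
    by (intro real_sqrt_le_mono wt_power_sderiv_square_le_sip[of _ "length l"]) auto
  moreover have "sqrt (wt x ^ (2 * m) * (sderiv l f x)\<^sup>2) = wt x ^ m * \<bar>sderiv l f x\<bar>"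
    using wt_nonneg[of x] by (simp add: real_sqrt_mult power_even_eq mult.commute[of 2 m] power_mult)
  ultimately show "wt x ^ m * \<bar>sderiv l f x\<bar> \<le>
      sqrt ((2 * real (2 * m + 1)) ^ CARD('n)) * sqrt (schwartz_ip (2 * m + length l) f f)"
    by (simp only: real_sqrt_mult)
qed simp

lemma sip_pos:
  fixes f :: "'n::finite schwartz"
  assumes "f \<noteq> 0" "CARD('n) \<le> M"
  shows "0 < sip M f f"
proof (rule ccontr)
  assume "\<not> 0 < sip M f f"
  then have "sip M f f = 0" using sip_nonneg[of M f] by simp
  then have "(schwartz_fun f x)\<^sup>2 \<le> 0" for x
    using wt_power_sderiv_square_le_sip[of "[]" 0 0 M x f] assms(2) by (simp add: sderiv_Nil)
  then have "schwartz_fun f = schwartz_fun 0" by (simp add: zero_schwartz.rep_eq fun_eq_iff)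
  then show False using assms(1) by (simp add: schwartz_fun_inject)
qed

text \<open>The Hilbert-Schmidt bound comes from the Sobolev inequality alone: apply it at the point \<open>x\<close>
  to the combination of the \<open>e\<close> with coefficients \<open>sderiv l e x\<close>.\<close>

lemma orthonormal_sderiv_square_sum_le:
  fixes E :: "'n::finite schwartz set"
  assumes E: "finite E" "\<forall>e\<in>E. \<forall>f\<in>E. sip M e f = (if e = f then 1 else 0)"
    and l: "length l \<le> k" "m \<le> M" "k + CARD('n) \<le> M"
  shows "wt x ^ m * (\<Sum>e\<in>E. (sderiv l e x)\<^sup>2) \<le> (2 * real (m + 1)) ^ CARD('n)"
proof -
  define s where "s = (\<Sum>e\<in>E. (sderiv l e x)\<^sup>2)"
  define f where "f = (\<Sum>e\<in>E. sderiv l e x *\<^sub>R e)"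
  let ?C = "(2 * real (m + 1)) ^ CARD('n)"
  have s: "sderiv l f x = s"
    by (simp add: f_def s_def sderiv_sum sderiv_scale power2_eq_square)
  have sum_left: "sip M (\<Sum>e\<in>E. g e) h = (\<Sum>e\<in>E. sip M (g e) h)" for g h
    using sip_scale[of M 0 0 h] by (induction E rule: infinite_finite_induct) (auto simp: sip_add)
  have "sip M f f = (\<Sum>e\<in>E. sderiv l e x * sip M e f)"
    by (subst (1) f_def) (simp only: sum_left sip_scale)
  also have "\<dots> = (\<Sum>e\<in>E. sderiv l e x * sderiv l e x)"
  proof (intro sum.cong refl arg_cong[where f = "\<lambda>t. _ * t"])
    fix e assume e: "e \<in> E"
    have "sip M e f = (\<Sum>e'\<in>E. sderiv l e' x * sip M e' e)"
      unfolding sip_sym[of M e f] by (simp only: f_def sum_left sip_scale)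
    also have "\<dots> = (\<Sum>e'\<in>E. if e' = e then sderiv l e' x else 0)"
      using E e by (intro sum.cong) auto
    finally show "sip M e f = sderiv l e x" using E e by simp
  qed
  finally have "sip M f f = s" by (simp add: s_def power2_eq_square)
  \<comment> \<open>\<open>s\<close> is at once the derivative of \<open>f\<close> at
    \<open>x\<close> and the squared norm of \<open>f\<close>, so one factor \<open>s\<close>
    cancels.\<close>
  then have "wt x ^ m * s\<^sup>2 \<le> ?C * s"
    using wt_power_sderiv_square_le_sip[OF l, of x f] s by simp
  moreover have "0 \<le> s" by (simp add: s_def sum_nonneg)
  ultimately have "wt x ^ m * s \<le> ?C"
    by (cases "s = 0") (auto simp: power2_eq_square mult.assoc[symmetric])
  then show ?thesis by (simp add: s_def)
qed

text \<open>Integrates the pointwise trace bound, used with weight exponent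
  \<open>m + CARD('n)\<close> and order \<open>m\<close>; both are admissible for the norm of index
  \<open>m + CARD('n)\<close>, and the surplus weight leaves an integrable majorant.\<close>

lemma sip_hilbert_schmidt:
  "\<exists>C. \<forall>E :: 'n::finite schwartz set. finite E \<and>
     (\<forall>e\<in>E. \<forall>f\<in>E. sip (m + CARD('n)) e f = (if e = f then 1 else 0)) \<longrightarrow> (\<Sum>e\<in>E. sip m e e) \<le> C"
proof (intro exI allI impI)
  fix E :: "'n schwartz set"
  let ?L = "lists_upto m :: 'n list set" and ?C = "(2 * real (m + CARD('n) + 1)) ^ CARD('n)"
  let ?I = "\<integral>y. 1 / wt (vec_lambda y :: real ^ 'n) ^ CARD('n) \<partial>coord_measure"
  assume E: "finite E \<and> (\<forall>e\<in>E. \<forall>f\<in>E. sip (m + CARD('n)) e f = (if e = f then 1 else 0))"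
  have "(\<Sum>e\<in>E. sip m e e) = (\<integral>y. (\<Sum>e\<in>E. sdensity m m e (vec_lambda y)) \<partial>coord_measure)"
    unfolding sip_eq_sdensity by (intro Bochner_Integration.integral_sum[symmetric] sdensity_integrable)
  also have "\<dots> \<le> (\<integral>y. real (card ?L) * ?C * (1 / wt (vec_lambda y :: real ^ 'n) ^ CARD('n)) \<partial>coord_measure)"
  proof (intro integral_mono Bochner_Integration.integrable_sum sdensity_integrable
      integrable_mult_right integrable_inverse_wt)
    fix y
    have "(\<Sum>e\<in>E. sdensity m m e x) \<le> (\<Sum>l\<in>?L. ?C * (1 / wt x ^ CARD('n)))" for x
    proof -
      have "(\<Sum>e\<in>E. sdensity m m e x) = (\<Sum>l\<in>?L. wt x ^ m * (\<Sum>e\<in>E. (sderiv l e x)\<^sup>2))"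
        unfolding sdensity_def sum_distrib_left by (rule sum.swap)
      also have "\<dots> \<le> (\<Sum>l\<in>?L. ?C * (1 / wt x ^ CARD('n)))"
      proof (rule sum_mono)
        fix l assume "l \<in> ?L"
        then have "wt x ^ (m + CARD('n)) * (\<Sum>e\<in>E. (sderiv l e x)\<^sup>2) \<le> ?C"
          using E by (intro orthonormal_sderiv_square_sum_le[of E "m + CARD('n)" l m]) (auto simp: lists_upto_def)
        then show "wt x ^ m * (\<Sum>e\<in>E. (sderiv l e x)\<^sup>2) \<le> ?C * (1 / wt x ^ CARD('n))"
          using wt_pos[of x] by (simp add: power_add field_simps)
      qed
      finally show ?thesis .
    qed
    then show "(\<Sum>e\<in>E. sdensity m m e (vec_lambda y))
        \<le> real (card ?L) * ?C * (1 / wt (vec_lambda y :: real ^ 'n) ^ CARD('n))" by simp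
  qed
  also have "\<dots> = real (card ?L) * ?C * ?I" by (rule integral_mult_right_zero)
  finally show "(\<Sum>e\<in>E. sip m e e) \<le> real (card ?L) * ?C * ?I" .
qed

text \<open>Cauchy in all Hilbert norms means uniformly Cauchy in all weighted sup norms. The limits
  \<open>g l\<close> are the derivatives of \<open>g []\<close>, which is therefore a Schwartz
  function; uniform convergence with surplus weight then gives back convergence in the Hilbert
  norms.\<close>

lemma schwartz_complete:
  fixes u :: "nat \<Rightarrow> 'n::finite schwartz"
  assumes cauchy: "\<And>m e. 0 < e \<Longrightarrow> \<exists>N. \<forall>i\<ge>N. \<forall>j\<ge>N. schwartz_ip m (u i - u j) (u i - u j) < e"
  shows "\<exists>x. \<forall>m. (\<lambda>i. schwartz_ip m (u i - x) (u i - x)) \<longlonglongrightarrow> 0"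
proof -
  have unif: "\<exists>N. \<forall>i\<ge>N. \<forall>j\<ge>N. \<forall>x. wt x ^ m * \<bar>sderiv l (u i) x - sderiv l (u j) x\<bar> \<le> e"
    if e: "0 < e" for l m e
  proof -
    obtain C where C: "0 < C"
      "\<And>f x. wt x ^ m * \<bar>sderiv l f x\<bar> \<le> C * sqrt (schwartz_ip (2 * m + length l) f f)"
      using wt_power_sderiv_le_sip[of m l] by blast
    obtain N where N: "\<And>i j. N \<le> i \<Longrightarrow> N \<le> j \<Longrightarrow>
        schwartz_ip (2 * m + length l) (u i - u j) (u i - u j) < (e / C)\<^sup>2"
      using cauchy[of "(e / C)\<^sup>2" "2 * m + length l"] e C(1) by auto
    have "wt x ^ m * \<bar>sderiv l (u i) x - sderiv l (u j) x\<bar> \<le> e" if "N \<le> i" "N \<le> j" for i j x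
    proof -
      have "sqrt (schwartz_ip (2 * m + length l) (u i - u j) (u i - u j)) \<le> sqrt ((e / C)\<^sup>2)"
        using N[OF that] by (intro real_sqrt_le_mono) simp
      also have "\<dots> = e / C" using e C(1) by simp
      finally have "C * sqrt (schwartz_ip (2 * m + length l) (u i - u j) (u i - u j)) \<le> e"
        using C(1) by (simp add: field_simps)
      then show ?thesis using C(2)[of x "u i - u j"] by (simp add: sderiv_diff)
    qed
    then show ?thesis by blast
  qed
  define g where "g l x = lim (\<lambda>i. sderiv l (u i) x)" for l x
  have g: "(\<lambda>i. sderiv l (u i) x) \<longlonglongrightarrow> g l x" for l x
  proof -
    have "Cauchy (\<lambda>i. sderiv l (u i) x)"
    proof (rule CauchyI)
      fix e :: real assume "0 < e"
      then have "0 < e / 2" by simp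
      from unif[OF this, of 0 l] obtain N where
        N: "\<And>i j. N \<le> i \<Longrightarrow> N \<le> j \<Longrightarrow> wt x ^ 0 * \<bar>sderiv l (u i) x - sderiv l (u j) x\<bar> \<le> e / 2"
        by blast
      have "norm (sderiv l (u m) x - sderiv l (u n) x) < e" if "N \<le> m" "N \<le> n" for m n
        using N[OF that] \<open>0 < e\<close> by simp
      then show "\<exists>M. \<forall>m\<ge>M. \<forall>n\<ge>M. norm (sderiv l (u m) x - sderiv l (u n) x) < e" by blast
    qed
    then show ?thesis unfolding g_def by (simp add: Cauchy_convergent_iff convergent_LIMSEQ_iff)
  qed
  have unif_g: "\<exists>N. \<forall>i\<ge>N. \<forall>x. wt x ^ m * \<bar>sderiv l (u i) x - g l x\<bar> \<le> e" if e: "0 < e" for l m e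
  proof -
    obtain N where N: "\<And>i j x. N \<le> i \<Longrightarrow> N \<le> j \<Longrightarrow> wt x ^ m * \<bar>sderiv l (u i) x - sderiv l (u j) x\<bar> \<le> e"
      using unif[OF e] by blast
    have "wt x ^ m * \<bar>sderiv l (u i) x - g l x\<bar> \<le> e" if "N \<le> i" for i x
    proof (rule tendsto_upperbound)
      show "(\<lambda>j. wt x ^ m * \<bar>sderiv l (u i) x - sderiv l (u j) x\<bar>) \<longlonglongrightarrow> wt x ^ m * \<bar>sderiv l (u i) x - g l x\<bar>"
        by (intro tendsto_intros g)
      show "eventually (\<lambda>j. wt x ^ m * \<bar>sderiv l (u i) x - sderiv l (u j) x\<bar> \<le> e) sequentially"
        using N[OF that] by (auto simp: eventually_sequentially)
    qed simp
    then show ?thesis by blast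
  qed
  \<comment> \<open>Uniform convergence of the finitely many partial derivatives yields uniform
    convergence of the total derivatives, the condition for differentiating a limit.\<close>
  have deriv: "(g l has_derivative (\<lambda>h. \<Sum>i\<in>UNIV. h $ i * g (i # l) x)) (at x)" for l x
  proof -
    have "\<exists>G. \<forall>x\<in>UNIV. (\<lambda>n. sderiv l (u n) x) \<longlonglongrightarrow> G x \<and>
        (G has_derivative (\<lambda>h. \<Sum>i\<in>UNIV. h $ i * g (i # l) x)) (at x within UNIV)"
    proof (rule has_derivative_sequence[where f' = "\<lambda>n x h. \<Sum>i\<in>UNIV. h $ i * sderiv (i # l) (u n) x" and ?x0.0 = 0])
      show "(sderiv l (u n) has_derivative (\<lambda>h. \<Sum>i\<in>UNIV. h $ i * sderiv (i # l) (u n) x)) (at x within UNIV)" for n x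
        unfolding sderiv_Cons using has_derivative_partial_derivs[OF sderiv_differentiable[of l "u n" x]] by simp
      show "(\<lambda>n. sderiv l (u n) 0) \<longlonglongrightarrow> g l 0" by (rule g)
      fix e :: real assume e: "0 < e"
      have "\<forall>i. \<exists>N. \<forall>n\<ge>N. \<forall>x. wt x ^ 0 * \<bar>sderiv (i # l) (u n) x - g (i # l) x\<bar> \<le> e / real CARD('n)"
        using e by (intro allI unif_g) simp
      then obtain N where N: "\<And>i n x. N i \<le> n \<Longrightarrow> \<bar>sderiv (i # l) (u n) x - g (i # l) x\<bar> \<le> e / real CARD('n)"
        unfolding power_0 mult_1 by metis
      have "\<bar>(\<Sum>i\<in>UNIV. h $ i * sderiv (i # l) (u n) x) - (\<Sum>i\<in>UNIV. h $ i * g (i # l) x)\<bar> \<le> e * norm h"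
        if n: "Max (range N) \<le> n" for n x h
      proof -
        have Nn: "N i \<le> n" for i using n by (meson Max_ge finite finite_imageI order_trans rangeI)
        have "\<bar>(\<Sum>i\<in>UNIV. h $ i * sderiv (i # l) (u n) x) - (\<Sum>i\<in>UNIV. h $ i * g (i # l) x)\<bar>
            = \<bar>\<Sum>i\<in>UNIV. h $ i * (sderiv (i # l) (u n) x - g (i # l) x)\<bar>"
          by (simp add: sum_subtractf[symmetric] right_diff_distrib)
        also have "\<dots> \<le> (\<Sum>i\<in>(UNIV :: 'n set). norm h * (e / real CARD('n)))"
        proof (intro order_trans[OF sum_abs] sum_mono)
          fix i
          show "\<bar>h $ i * (sderiv (i # l) (u n) x - g (i # l) x)\<bar> \<le> norm h * (e / real CARD('n))"
            unfolding abs_mult by (rule mult_mono[OF component_le_norm_cart N[OF Nn]]) auto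
        qed
        also have "\<dots> = e * norm h" by simp
        finally show ?thesis .
      qed
      then show "eventually (\<lambda>n. \<forall>x\<in>UNIV. \<forall>h. norm ((\<Sum>i\<in>UNIV. h $ i * sderiv (i # l) (u n) x)
          - (\<Sum>i\<in>UNIV. h $ i * g (i # l) x)) \<le> e * norm h) sequentially"
        unfolding eventually_sequentially real_norm_def by blast
    qed simp_all
    then obtain G where G: "\<And>x. (\<lambda>n. sderiv l (u n) x) \<longlonglongrightarrow> G x"
        "\<And>x. (G has_derivative (\<lambda>h. \<Sum>i\<in>UNIV. h $ i * g (i # l) x)) (at x)" by auto
    have "G = g l" using LIMSEQ_unique[OF G(1) g] by blast
    then show ?thesis using G(2) by simp
  qed
  have iter: "iter_partial l (g []) = g l" for l
  proof (induction l)
    case (Cons i l)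
    show ?case
    proof
      fix x
      show "iter_partial (i # l) (g []) x = g (i # l) x"
        using partial_deriv_eqI[OF deriv[of l x], of i] Cons by simp
    qed
  qed simp
  have smooth: "smooth (g [])"
    unfolding smooth_def iter using deriv
    by (auto simp: differentiable_on_def differentiable_def intro: has_derivative_at_withinI)
  have bound: "\<exists>B. \<forall>x. wt x ^ m * \<bar>g l x\<bar> \<le> B" for l m
  proof -
    obtain N where N: "\<And>x. wt x ^ m * \<bar>sderiv l (u N) x - g l x\<bar> \<le> 1"
      using unif_g[of 1 m l] by auto
    have "wt x ^ m * \<bar>g l x\<bar> \<le> schwartz_seminorm (2 * m) (\<chi> i. count_list l i) (u N) + 1" for x
    proof -
      have "wt x ^ m * \<bar>g l x\<bar> \<le> wt x ^ m * (\<bar>sderiv l (u N) x\<bar> + \<bar>sderiv l (u N) x - g l x\<bar>)"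
        by (intro mult_left_mono) (auto simp: wt_nonneg)
      then show ?thesis using wt_power_sderiv_le[of x m l "u N"] N[of x] by (simp add: distrib_left)
    qed
    then show ?thesis by blast
  qed
  have "is_schwartz (g [])"
    unfolding is_schwartz_def
  proof (intro conjI smooth allI)
    fix m and j :: "nat ^ 'n"
    obtain l where l: "multi_deriv j (g []) = g l" unfolding multi_deriv_def iter by blast
    obtain B where B: "\<And>x. wt x ^ m * \<bar>g l x\<bar> \<le> B" using bound by blast
    have "(1 + norm x) ^ m * \<bar>g l x\<bar> \<le> 2 ^ m * B" for x
    proof -
      have "(1 + norm x) ^ m * \<bar>g l x\<bar> \<le> (2 * wt x) ^ m * \<bar>g l x\<bar>"
        by (intro mult_right_mono one_plus_norm_power_le) simp
      also have "\<dots> \<le> 2 ^ m * B" using B[of x] by (simp add: power_mult_distrib mult.assoc)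
      finally show ?thesis .
    qed
    then show "bdd_above (range (\<lambda>x. (1 + norm x) ^ m * \<bar>multi_deriv j (g []) x\<bar>))"
      unfolding l by (intro bdd_aboveI2)
  qed
  then have lim: "sderiv l (Abs_schwartz (g [])) = g l" for l
    by (simp add: sderiv_def Abs_schwartz_inverse iter)
  have "(\<lambda>i. schwartz_ip m (u i - Abs_schwartz (g [])) (u i - Abs_schwartz (g []))) \<longlonglongrightarrow> 0" for m
  proof -
    let ?M = "m + CARD('n)" and ?x = "Abs_schwartz (g [])"
    define K where "K = real (card (lists_upto ?M :: 'n list set)) *
        (\<integral>y. 1 / wt (vec_lambda y :: real ^ 'n) ^ CARD('n) \<partial>coord_measure)"
    have K: "0 \<le> K" unfolding K_def
      by (intro mult_nonneg_nonneg integral_nonneg_AE AE_I2) (auto simp: wt_nonneg)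
    have "\<exists>N. \<forall>i\<ge>N. norm (schwartz_ip m (u i - ?x) (u i - ?x) - 0) < r" if r: "0 < r" for r
    proof -
      \<comment> \<open>This gives \<open>K * e\<^sup>2 \<le> r / 2\<close>; adding 1 to
        \<open>K\<close> avoids division by zero.\<close>
      define e where "e = sqrt (r / (K + 1) / 2)"
      have e: "0 < e" using r K by (simp add: e_def)
      have "\<forall>l. \<exists>N. \<forall>i\<ge>N. \<forall>x. wt x ^ (?M + CARD('n)) * \<bar>sderiv l (u i) x - g l x\<bar> \<le> e"
        using unif_g[OF e] by blast
      then obtain N where N: "\<And>l i x. N l \<le> i \<Longrightarrow> wt x ^ (?M + CARD('n)) * \<bar>sderiv l (u i) x - g l x\<bar> \<le> e"
        by metis
      have "norm (schwartz_ip m (u i - ?x) (u i - ?x) - 0) < r"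
        if i: "Max (N ` (lists_upto ?M :: 'n list set)) \<le> i" for i
      proof -
        have "schwartz_ip m (u i - ?x) (u i - ?x) \<le> real (card (lists_upto ?M :: 'n list set)) * e\<^sup>2 *
          (\<integral>y. 1 / wt (vec_lambda y :: real ^ 'n) ^ CARD('n) \<partial>coord_measure)"
          unfolding schwartz_ip_def
        proof (rule sip_le)
          fix l :: "'n list" and x assume l: "l \<in> lists_upto ?M"
          have "N l \<le> i"
            by (rule order_trans[OF Max_ge i]) (use l in auto)
          then have le: "wt x ^ (?M + CARD('n)) * \<bar>sderiv l (u i) x - g l x\<bar> \<le> e" by (rule N)
          have "wt x ^ (?M + CARD('n)) * (sderiv l (u i - ?x) x)\<^sup>2
              \<le> (wt x ^ (?M + CARD('n)))\<^sup>2 * (sderiv l (u i - ?x) x)\<^sup>2"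
            by (intro mult_right_mono self_le_power one_le_power wt_ge_1) auto
          also have "\<dots> = (wt x ^ (?M + CARD('n)) * \<bar>sderiv l (u i) x - g l x\<bar>)\<^sup>2"
            by (simp add: sderiv_diff lim power_mult_distrib)
          also have "\<dots> \<le> e\<^sup>2" by (intro power_mono le) (auto simp: wt_nonneg)
          finally show "wt x ^ (?M + CARD('n)) * (sderiv l (u i - ?x) x)\<^sup>2 \<le> e\<^sup>2" .
        qed
        also have "\<dots> = K * e\<^sup>2" by (simp add: K_def)
        also have "\<dots> = K / (K + 1) * (r / 2)" using r K by (simp add: e_def)
        also have "\<dots> \<le> 1 * (r / 2)" using r K by (intro mult_right_mono) auto
        finally have "schwartz_ip m (u i - ?x) (u i - ?x) < r" using r by simp
        moreover have "0 \<le> schwartz_ip m (u i - ?x) (u i - ?x)"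
          unfolding schwartz_ip_def by (rule sip_nonneg)
        ultimately show ?thesis by simp
      qed
      then show ?thesis by blast
    qed
    then show ?thesis by (rule LIMSEQ_I)
  qed
  then show ?thesis by blast
qed

interpretation S: hilbert_scale "schwartz_ip :: nat \<Rightarrow> 'n::finite schwartz \<Rightarrow> 'n schwartz \<Rightarrow> real"
proof (rule hilbert_scale.intro)
  fix m
  have "m \<le> m + CARD('n)" by simp
  then show "\<exists>k\<ge>m. \<exists>C. \<forall>E. finite E \<and> (\<forall>e\<in>E. \<forall>f\<in>E. schwartz_ip k e f = (if e = f then 1 else 0)) \<longrightarrow>
      (\<Sum>e\<in>E. schwartz_ip m e (e :: 'n schwartz)) \<le> C"
    unfolding schwartz_ip_def using sip_hilbert_schmidt[of "m + CARD('n)", where 'n = 'n] by iprover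
next
  fix u :: "nat \<Rightarrow> 'n schwartz"
  assume "\<And>m e. 0 < e \<Longrightarrow> \<exists>N. \<forall>i\<ge>N. \<forall>j\<ge>N. schwartz_ip m (u i - u j) (u i - u j) < e"
  then show "\<exists>x. \<forall>m. (\<lambda>i. schwartz_ip m (u i - x) (u i - x)) \<longlonglongrightarrow> 0"
    by (rule schwartz_complete)
qed (auto simp: schwartz_ip_def sip_add sip_scale sip_pos intro: sip_sym sip_mono)

section \<open>The Hilbert norms generate the Schwartz topology\<close>

lemma schwartz_seminorm_le_nrm:
  fixes j :: "nat ^ 'n::finite"
  shows "\<exists>M. \<exists>C>0. \<forall>f. schwartz_seminorm a j f \<le> C * S.nrm M f"
proof -
  obtain l where l: "\<And>f :: 'n schwartz. multi_deriv j (schwartz_fun f) = sderiv l f"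
    using multi_deriv_sderiv by blast
  obtain C where C: "0 < C"
      "\<And>f x. wt x ^ a * \<bar>sderiv l f x\<bar> \<le> C * sqrt (schwartz_ip (2 * a + length l) f f)"
    using wt_power_sderiv_le_sip[of a l] by blast
  have "schwartz_seminorm a j f \<le> (2 ^ a * C) * S.nrm (2 * a + length l) f" for f
    unfolding schwartz_seminorm_def
  proof (rule cSUP_least)
    fix x :: "real ^ 'n"
    have "(1 + norm x) ^ a * \<bar>sderiv l f x\<bar> \<le> (2 * wt x) ^ a * \<bar>sderiv l f x\<bar>"
      by (intro mult_right_mono one_plus_norm_power_le) simp
    also have "\<dots> = 2 ^ a * (wt x ^ a * \<bar>sderiv l f x\<bar>)"
      unfolding power_mult_distrib mult.assoc ..
    also have "\<dots> \<le> 2 ^ a * (C * S.nrm (2 * a + length l) f)"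
      unfolding S.nrm_def by (intro mult_left_mono C(2)) simp
    finally show "(1 + norm x) ^ a * \<bar>multi_deriv j (schwartz_fun f) x\<bar> \<le> (2 ^ a * C) * S.nrm (2 * a + length l) f"
      by (simp add: l mult.assoc)
  qed simp
  then show ?thesis using C(1) by (intro exI[of _ "2 * a + length l"] exI[of _ "2 ^ a * C"]) auto
qed

lemma schwartz_seminorm_nonneg: "0 \<le> schwartz_seminorm m j f"
  using seminorm_bound[of 0 m j f] by (rule order_trans[rotated]) simp

lemma schwartz_seminorm_triangle:
  fixes f g :: "'n::finite schwartz"
  shows "schwartz_seminorm m j (f + g) \<le> schwartz_seminorm m j f + schwartz_seminorm m j g"
proof -
  obtain l where l: "\<And>f :: 'n schwartz. multi_deriv j (schwartz_fun f) = sderiv l f"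
    using multi_deriv_sderiv by blast
  show ?thesis
    unfolding schwartz_seminorm_def[of m j "f + g"]
  proof (rule cSUP_least)
    fix x :: "real ^ 'n"
    have "(1 + norm x) ^ m * \<bar>sderiv l (f + g) x\<bar> \<le> (1 + norm x) ^ m * (\<bar>sderiv l f x\<bar> + \<bar>sderiv l g x\<bar>)"
      by (intro mult_left_mono) (auto simp: sderiv_add)
    then show "(1 + norm x) ^ m * \<bar>multi_deriv j (schwartz_fun (f + g)) x\<bar>
        \<le> schwartz_seminorm m j f + schwartz_seminorm m j g"
      using seminorm_bound[of x m j f] seminorm_bound[of x m j g] by (simp add: l distrib_left)
  qed simp
qed

lemma nrm_le_schwartz_seminorms:
  "\<exists>C>0. \<forall>f :: 'n::finite schwartz. S.nrm m f \<le>
     C * (\<Sum>l\<in>lists_upto (m + CARD('n)). schwartz_seminorm (2 * (m + CARD('n) + CARD('n))) (\<chi> i. count_list l i) f)"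
proof -
  let ?M = "m + CARD('n)"
  define K where "K = real (card (lists_upto ?M :: 'n list set)) *
      (\<integral>y. 1 / wt (vec_lambda y :: real ^ 'n) ^ CARD('n) \<partial>coord_measure)"
  have K: "0 \<le> K" unfolding K_def
    by (intro mult_nonneg_nonneg integral_nonneg_AE AE_I2) (auto simp: wt_nonneg)
  let ?p = "\<lambda>l f. schwartz_seminorm (2 * (?M + CARD('n))) (\<chi> i. count_list l i) (f :: 'n schwartz)"
  have "S.nrm m f \<le> sqrt (K + 1) * (\<Sum>l\<in>lists_upto ?M. ?p l f)" for f
  proof -
    define s where "s = (\<Sum>l\<in>lists_upto ?M. ?p l f)"
    have s: "0 \<le> s" unfolding s_def by (intro sum_nonneg schwartz_seminorm_nonneg)
    have "schwartz_ip m f f \<le> real (card (lists_upto ?M :: 'n list set)) * s\<^sup>2 *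
        (\<integral>y. 1 / wt (vec_lambda y :: real ^ 'n) ^ CARD('n) \<partial>coord_measure)"
      unfolding schwartz_ip_def
    proof (rule sip_le)
      fix l :: "'n list" and x assume l: "l \<in> lists_upto ?M"
      have "wt x ^ (?M + CARD('n)) * (sderiv l f x)\<^sup>2 \<le> (wt x ^ (?M + CARD('n)))\<^sup>2 * (sderiv l f x)\<^sup>2"
        by (intro mult_right_mono self_le_power one_le_power wt_ge_1) auto
      also have "\<dots> = (wt x ^ (?M + CARD('n)) * \<bar>sderiv l f x\<bar>)\<^sup>2"
        by (simp add: power_mult_distrib)
      also have "\<dots> \<le> s\<^sup>2"
      proof (rule power_mono)
        have "wt x ^ (?M + CARD('n)) * \<bar>sderiv l f x\<bar> \<le> ?p l f" by (rule wt_power_sderiv_le)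
        also have "\<dots> \<le> s" unfolding s_def
          by (rule member_le_sum[OF l]) (auto simp: schwartz_seminorm_nonneg)
        finally show "wt x ^ (?M + CARD('n)) * \<bar>sderiv l f x\<bar> \<le> s" .
      qed (simp add: wt_nonneg)
      finally show "wt x ^ (?M + CARD('n)) * (sderiv l f x)\<^sup>2 \<le> s\<^sup>2" .
    qed
    also have "\<dots> = K * s\<^sup>2" by (simp add: K_def)
    also have "\<dots> \<le> (K + 1) * s\<^sup>2" by (intro mult_right_mono) auto
    finally have "sqrt (schwartz_ip m f f) \<le> sqrt ((K + 1) * s\<^sup>2)" by (rule real_sqrt_le_mono)
    then show ?thesis using s by (simp add: S.nrm_def real_sqrt_mult s_def)
  qed
  then show ?thesis using K by (intro exI[of _ "sqrt (K + 1)"]) auto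
qed

text \<open>The norms increase with their index, so a finite intersection of subbasic sets still
  contains a ball of a single norm.\<close>

lemma open_schwartz_imp_nrm_ball:
  fixes U :: "'n::finite schwartz set"
  assumes "open U" "x \<in> U"
  shows "\<exists>m. \<exists>\<delta>>0. \<forall>y. S.nrm m (y - x) < \<delta> \<longrightarrow> y \<in> U"
proof -
  have "generate_topology {{y. p (y - x) < e} | p x e. p \<in> {schwartz_seminorm m j | m j. True} \<and> 0 < e} U"
    using assms(1) by (simp add: open_schwartz_def seminorm_open_def)
  then show ?thesis using assms(2)
  proof (induction arbitrary: x)
    case UNIV
    show ?case by (auto intro: exI[of _ "1 :: real"])
  next
    case (Int A B)
    obtain m \<delta> where 1: "0 < \<delta>" "\<And>y. S.nrm m (y - x) < \<delta> \<Longrightarrow> y \<in> A" using Int by blast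
    obtain m' \<delta>' where 2: "0 < \<delta>'" "\<And>y. S.nrm m' (y - x) < \<delta>' \<Longrightarrow> y \<in> B" using Int by blast
    show ?case
    proof (intro exI[of _ "max m m'"] exI[of _ "min \<delta> \<delta>'"] conjI allI impI)
      fix y assume y: "S.nrm (max m m') (y - x) < min \<delta> \<delta>'"
      then have "S.nrm m (y - x) < \<delta>" "S.nrm m' (y - x) < \<delta>'"
        using S.nrm_mono[of m "max m m'" "y - x"] S.nrm_mono[of m' "max m m'" "y - x"] by auto
      then show "y \<in> A \<inter> B" using 1 2 by blast
    qed (use 1 2 in auto)
  next
    case (UN K)
    then obtain A where "A \<in> K" "x \<in> A" by blast
    then show ?case using UN.IH[of A x] by blast
  next
    case (Basis A)
    then obtain a j z e where A: "A = {y. schwartz_seminorm a j (y - z) < e}" "0 < e" by blast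
    obtain M C where C: "0 < C" "\<And>f. schwartz_seminorm a j f \<le> C * S.nrm M f"
      using schwartz_seminorm_le_nrm[of a j] by blast
    have x: "schwartz_seminorm a j (x - z) < e" using Basis A by simp
    show ?case
    proof (intro exI[of _ M] exI[of _ "(e - schwartz_seminorm a j (x - z)) / C"] conjI allI impI)
      fix y assume "S.nrm M (y - x) < (e - schwartz_seminorm a j (x - z)) / C"
      then have "C * S.nrm M (y - x) < e - schwartz_seminorm a j (x - z)"
        using C(1) by (simp add: field_simps)
      then show "y \<in> A"
        using schwartz_seminorm_triangle[of a j "y - x" "x - z"] C(2)[of "y - x"] by (simp add: A)
    qed (use x C in simp)
  qed
qed

lemma nrm_ball_contains_open:
  fixes x :: "'n::finite schwartz"
  assumes \<delta>: "0 < \<delta>"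
  shows "\<exists>U. open U \<and> x \<in> U \<and> (\<forall>y\<in>U. S.nrm m (y - x) < \<delta>)"
proof -
  let ?L = "lists_upto (m + CARD('n)) :: 'n list set"
  let ?p = "\<lambda>l f. schwartz_seminorm (2 * (m + CARD('n) + CARD('n))) (\<chi> i. count_list l i) (f :: 'n schwartz)"
  obtain C where C: "0 < C" "\<And>f. S.nrm m f \<le> C * (\<Sum>l\<in>?L. ?p l f)"
    using nrm_le_schwartz_seminorms[of m, where 'n = 'n] by blast
  \<comment> \<open>The sum has \<open>card ?L\<close> terms, each below \<open>\<eta>\<close>, so
    \<open>C\<close> times the sum stays below \<open>\<delta>\<close>.\<close>
  define \<eta> where "\<eta> = \<delta> / (C * real (card ?L))"
  have card: "0 < card ?L" using Nil_in_lists_upto finite_lists_upto by (metis card_gt_0_iff empty_iff)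
  have \<eta>: "0 < \<eta>" using \<delta> C(1) card by (simp add: \<eta>_def)
  define U where "U = (\<Inter>l\<in>?L. {y. ?p l (y - x) < \<eta>})"
  have "open {y. ?p l (y - x) < \<eta>}" for l
    unfolding open_schwartz_def seminorm_open_def using \<eta> by (intro generate_topology.Basis) blast
  then have "open U" unfolding U_def by (intro open_INT) auto
  moreover have "?p l (x - x) = 0" for l
  proof -
    obtain l' where "\<And>f :: 'n schwartz. multi_deriv (\<chi> i. count_list l i) (schwartz_fun f) = sderiv l' f"
      using multi_deriv_sderiv by blast
    then show ?thesis by (simp add: schwartz_seminorm_def)
  qed
  then have "x \<in> U" using \<eta> by (simp add: U_def)
  moreover have "S.nrm m (y - x) < \<delta>" if "y \<in> U" for y
  proof -
    have "(\<Sum>l\<in>?L. ?p l (y - x)) < (\<Sum>l\<in>?L. \<eta>)"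
      using that card by (intro sum_strict_mono) (auto simp: U_def)
    then have "C * (\<Sum>l\<in>?L. ?p l (y - x)) < C * (\<Sum>l\<in>?L. \<eta>)" using C(1) by simp
    also have "\<dots> = \<delta>" using C(1) card by (auto simp: \<eta>_def card_gt_0_iff)
    finally show ?thesis using C(2)[of "y - x"] by simp
  qed
  ultimately show ?thesis by blast
qed

section \<open>Weak compactness for sequences of reals\<close>

lemma compact_Pi_UNIV:
  fixes S :: "nat \<Rightarrow> real set"
  assumes "\<And>i. compact (S i)"
  shows "compact {x. \<forall>i. x i \<in> S i}"
proof -
  have "compactin (product_topology (\<lambda>i. euclidean) UNIV) (PiE UNIV S)"
    using assms by (simp add: compactin_PiE)
  moreover have "PiE UNIV S = {x. \<forall>i. x i \<in> S i}" by (auto simp: PiE_UNIV_domain)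
  ultimately show ?thesis by (simp add: euclidean_product_topology)
qed

section \<open>Coding sequences of reals by points of a Cantor set\<close>

definition bit_sequences :: "(nat \<Rightarrow> real) set" where
  "bit_sequences = {b. \<forall>k. b k \<in> {0, 1}}"

text \<open>Digits 0 and 1 in base 3. Beyond position k two codes differ by at most half of
  \<open>(1 / 3) ^ k\<close>, so the first differing digit decides and, unlike with binary
  expansions, the code is injective.\<close>

definition cantor_code :: "(nat \<Rightarrow> real) \<Rightarrow> real" where
  "cantor_code b = (\<Sum>k. b k * (1 / 3) ^ k)"

lemma summable_third: "summable (\<lambda>k. (1 / 3 :: real) ^ (k + n))"
  using summable_ignore_initial_segment[of "\<lambda>k. (1 / 3 :: real) ^ k" n] by simp

lemma suminf_third: "(\<Sum>k. (1 / 3 :: real) ^ (k + Suc n)) = (1 / 3) ^ n / 2"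
proof -
  have "(\<Sum>k. (1 / 3 :: real) ^ (k + Suc n)) = (\<Sum>k. (1 / 3) ^ Suc n * (1 / 3) ^ k)"
    by (simp add: power_add mult.commute)
  also have "\<dots> = (1 / 3) ^ Suc n * (\<Sum>k. (1 / 3) ^ k)" by (rule suminf_mult) simp
  also have "(\<Sum>k. (1 / 3 :: real) ^ k) = 3 / 2" by (subst suminf_geometric) auto
  finally show ?thesis by simp
qed

lemma cantor_summable:
  assumes "\<And>k. \<bar>b k\<bar> \<le> 1"
  shows "summable (\<lambda>k. b (k + n) * (1 / 3 :: real) ^ (k + n))"
  by (rule summable_comparison_test'[OF summable_third[of n], of 0])
     (simp add: abs_mult mult_left_le_one_le assms)

lemma cantor_code_inj: "inj_on cantor_code bit_sequences"
proof (rule inj_onI, rule ccontr)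
  fix b b' assume b: "b \<in> bit_sequences" "b' \<in> bit_sequences" and eq: "cantor_code b = cantor_code b'"
    and neq: "b \<noteq> b'"
  define c where "c k = b k - b' k" for k
  have b1: "\<bar>b k\<bar> \<le> 1" "\<bar>b' k\<bar> \<le> 1" for k
    using b by (auto simp: bit_sequences_def dest!: spec[of _ k])
  have c: "c k \<in> {-1, 0, 1}" for k
    using b by (auto simp: bit_sequences_def c_def dest!: spec[of _ k])
  then have c1: "\<bar>c k\<bar> \<le> 1" for k by (metis abs_0 abs_1 abs_minus_cancel empty_iff insert_iff order_refl zero_le_one)
  have "(\<Sum>k. c k * (1 / 3) ^ k) = cantor_code b - cantor_code b'"
    unfolding cantor_code_def c_def left_diff_distrib
    using cantor_summable[of b 0] cantor_summable[of b' 0] b1 by (intro suminf_diff[symmetric]) auto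
  then have sum0: "(\<Sum>k. c k * (1 / 3) ^ k) = 0" using eq by simp
  define k where "k = (LEAST k. c k \<noteq> 0)"
  have "\<exists>k. c k \<noteq> 0" using neq by (auto simp: c_def)
  then have ck: "c k \<noteq> 0" unfolding k_def by (rule LeastI_ex)
  have cj: "c j = 0" if "j < k" for j using not_less_Least that by (auto simp: k_def)
  have sm: "summable (\<lambda>k. c k * (1 / 3) ^ k)" using cantor_summable[of c 0] c1 by simp
  have "0 = (\<Sum>j. c (j + Suc k) * (1 / 3) ^ (j + Suc k)) + (\<Sum>j<Suc k. c j * (1 / 3) ^ j)"
    using suminf_split_initial_segment[OF sm, of "Suc k"] sum0 by simp
  also have "(\<Sum>j<Suc k. c j * (1 / 3) ^ j) = c k * (1 / 3) ^ k"
    using cj by simp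
  finally have "\<bar>c k * (1 / 3) ^ k\<bar> = \<bar>\<Sum>j. c (j + Suc k) * (1 / 3) ^ (j + Suc k)\<bar>" by linarith
  also have "\<dots> \<le> (\<Sum>j. \<bar>c (j + Suc k) * (1 / 3) ^ (j + Suc k)\<bar>)"
    using cantor_summable[of "\<lambda>k. \<bar>c k\<bar>" "Suc k"] c1 by (intro summable_rabs) (simp add: abs_mult)
  also have "\<dots> \<le> (\<Sum>j. (1 / 3) ^ (j + Suc k))"
    using cantor_summable[of "\<lambda>k. \<bar>c k\<bar>" "Suc k"] c1 summable_third[of "Suc k"]
    by (intro suminf_le) (auto simp: abs_mult mult_left_le_one_le)
  also have "\<dots> = (1 / 3) ^ k / 2" by (rule suminf_third)
  finally have "\<bar>c k\<bar> * (1 / 3) ^ k \<le> (1 / 3) ^ k / 2" by (simp add: abs_mult)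
  then have "\<bar>c k\<bar> \<le> 1 / 2" by (simp add: field_simps)
  then show False using c[of k] ck by auto
qed

lemma cantor_code_continuous: "continuous_on bit_sequences cantor_code"
proof -
  have "uniform_limit bit_sequences (\<lambda>n b. \<Sum>k<n. b k * (1 / 3) ^ k) cantor_code sequentially"
    unfolding cantor_code_def[abs_def]
  proof (rule Weierstrass_m_test)
    fix k b assume "b \<in> bit_sequences"
    then have "b k \<in> {0, 1}" by (simp add: bit_sequences_def)
    then show "norm (b k * (1 / 3) ^ k) \<le> (1 / 3) ^ k" by auto
  qed simp
  then show ?thesis
    by (rule uniform_limit_theorem[rotated])
       (auto intro!: always_eventually continuous_intros continuous_on_subset[OF continuous_on_product_coordinates])
qed

lemma cantor_code_bounds:
  assumes "b \<in> bit_sequences"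
  shows "0 \<le> cantor_code b" "cantor_code b \<le> 2"
proof -
  have b: "0 \<le> b k" "b k \<le> 1" for k using assms by (auto simp: bit_sequences_def dest!: spec[of _ k])
  have s: "summable (\<lambda>k. b k * (1 / 3) ^ k)" using cantor_summable[of b 0] b by simp
  show "0 \<le> cantor_code b" unfolding cantor_code_def using s b by (intro suminf_nonneg) auto
  have "cantor_code b \<le> (\<Sum>k. (1 / 3) ^ k)"
    unfolding cantor_code_def using s b by (intro suminf_le) (auto intro: mult_left_le_one_le)
  also have "\<dots> \<le> 2" by (subst suminf_geometric) auto
  finally show "cantor_code b \<le> 2" .
qed

definition threshold :: "nat \<Rightarrow> nat \<times> rat" where
  "threshold = from_nat_into UNIV"

lemma threshold_surj: "\<exists>k. threshold k = (j, q)"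
  using range_from_nat_into[of "UNIV :: (nat \<times> rat) set"]
  by (metis UNIV_I UNIV_not_empty countableI_type image_iff threshold_def)

text \<open>Each bit compares one coordinate with one rational; all bits together are the Dedekind
  cuts of all coordinates.\<close>

definition cut_bits :: "(nat \<Rightarrow> real) \<Rightarrow> nat \<Rightarrow> real" where
  "cut_bits x k = (if of_rat (snd (threshold k)) < x (fst (threshold k)) then 1 else 0)"

text \<open>The closed relation containing the graph of the discontinuous map \<open>cut_bits\<close>; it
  still determines the sequence from its bits.\<close>

definition compatible :: "(nat \<Rightarrow> real) \<Rightarrow> (nat \<Rightarrow> real) \<Rightarrow> bool" where
  "compatible b x \<longleftrightarrow> b \<in> bit_sequences \<and>
     (\<forall>k. 0 \<le> (2 * b k - 1) * (x (fst (threshold k)) - of_rat (snd (threshold k))))"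

lemma compatible_cut_bits: "compatible (cut_bits x) x"
  by (auto simp: compatible_def bit_sequences_def cut_bits_def)

text \<open>A rational strictly between two differing coordinates would force its bit to be 1 for
  one sequence and 0 for the other.\<close>

lemma compatible_unique:
  assumes "compatible b x" "compatible b y"
  shows "x = y"
proof -
  have le: "x j \<le> y j" if x: "compatible b x" and y: "compatible b y" for x y j
  proof (rule ccontr)
    assume "\<not> x j \<le> y j"
    then obtain q where q: "y j < of_rat q" "of_rat q < x j" using of_rat_dense[of "y j" "x j"] by auto
    obtain k where k: "threshold k = (j, q)" using threshold_surj by blast
    have "0 \<le> (2 * b k - 1) * (x j - of_rat q)" "0 \<le> (2 * b k - 1) * (y j - of_rat q)"
      using x y k by (auto simp: compatible_def dest!: spec[of _ k])
    moreover have "b k \<in> {0, 1}" using x by (auto simp: compatible_def bit_sequences_def)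
    ultimately show False using q by auto
  qed
  show ?thesis using le[OF assms] le[OF assms(2,1)] by (simp add: fun_eq_iff antisym)
qed

text \<open>The conditions in \<open>compatible\<close> are weak inequalities between continuous
  functions. When a coordinate equals the rational both bits are allowed, and this is what closes
  the relation.\<close>

lemma compact_compatible:
  assumes K: "compact K"
  shows "compact {(b, x). x \<in> K \<and> compatible b x}"
proof -
  have B: "compact bit_sequences"
    unfolding bit_sequences_def by (rule compact_Pi_UNIV) (simp add: finite_imp_compact)
  have proj: "continuous_on UNIV (\<lambda>p :: (nat \<Rightarrow> real) \<times> (nat \<Rightarrow> real). fst p k)"
    "continuous_on UNIV (\<lambda>p :: (nat \<Rightarrow> real) \<times> (nat \<Rightarrow> real). snd p k)" for k
    using continuous_on_compose2[OF continuous_on_product_coordinates[of k]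
        continuous_on_fst[OF continuous_on_id, of UNIV]]
      continuous_on_compose2[OF continuous_on_product_coordinates[of k]
        continuous_on_snd[OF continuous_on_id, of UNIV]] by auto
  have "closed {p :: (nat \<Rightarrow> real) \<times> (nat \<Rightarrow> real). 0 \<le> (2 * fst p k - 1) * (snd p (fst (threshold k)) - of_rat (snd (threshold k)))}" for k
    by (intro closed_Collect_le continuous_intros proj)
  then have "closed (\<Inter>k. {p :: (nat \<Rightarrow> real) \<times> (nat \<Rightarrow> real).
      0 \<le> (2 * fst p k - 1) * (snd p (fst (threshold k)) - of_rat (snd (threshold k)))})"
    by (intro closed_INT) auto
  from compact_Int_closed[OF compact_Times[OF B K] this]
  show ?thesis
    by (rule back_subst[where P = compact]) (auto simp: compatible_def)
qed

definition seq_code :: "(nat \<Rightarrow> real) \<Rightarrow> real" where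
  "seq_code x = cantor_code (cut_bits x)"

text \<open>The choice is over pairs because a number is first turned into bits and then into a
  sequence; off the codes of compatible pairs the value is arbitrary.\<close>

definition seq_decode :: "real \<Rightarrow> nat \<Rightarrow> real" where
  "seq_decode w = snd (SOME p. compatible (fst p) (snd p) \<and> cantor_code (fst p) = w)"

text \<open>The image of the closed relation, not of \<open>K\<close> under \<open>seq_code\<close>:
  the latter need not be closed, since \<open>cut_bits\<close> jumps.\<close>

definition code_image :: "(nat \<Rightarrow> real) set \<Rightarrow> real set" where
  "code_image K = (\<lambda>(b, x). cantor_code b) ` {(b, x). x \<in> K \<and> compatible b x}"

lemma seq_decode_eq:
  assumes "compatible b x"
  shows "seq_decode (cantor_code b) = x"
proof -
  define p where "p = (SOME p. compatible (fst p) (snd p) \<and> cantor_code (fst p) = cantor_code b)"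
  have "compatible (fst (b, x)) (snd (b, x)) \<and> cantor_code (fst (b, x)) = cantor_code b"
    using assms by simp
  then have p: "compatible (fst p) (snd p) \<and> cantor_code (fst p) = cantor_code b"
    unfolding p_def by (rule someI)
  then have "fst p = b"
    using assms inj_onD[OF cantor_code_inj] by (auto simp: compatible_def)
  then have "compatible b (snd p)" using p by simp
  then have "snd p = x" using assms by (rule compatible_unique)
  then show ?thesis unfolding seq_decode_def p_def .
qed

lemma seq_decode_code: "seq_decode (seq_code x) = x"
  unfolding seq_code_def by (rule seq_decode_eq[OF compatible_cut_bits])

lemma seq_code_in_image: "x \<in> K \<Longrightarrow> seq_code x \<in> code_image K"
  unfolding code_image_def seq_code_def using compatible_cut_bits by force

lemma seq_decode_in: "w \<in> code_image K \<Longrightarrow> seq_decode w \<in> K"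
  unfolding code_image_def using seq_decode_eq by auto

text \<open>On the compact relation the code is a continuous injection, hence a homeomorphism onto
  its image, and decoding is the second component of the inverse. So decoding is continuous there
  although coding is merely measurable.\<close>

lemma compact_code_image:
  assumes "compact K"
  shows "compact (code_image K)" "continuous_on (code_image K) seq_decode"
proof -
  let ?A = "{(b, x). x \<in> K \<and> compatible b x}" and ?f = "\<lambda>(b, x). cantor_code b"
  have f: "continuous_on ?A ?f"
    unfolding case_prod_beta'
    by (rule continuous_on_compose2[OF cantor_code_continuous continuous_on_fst[OF continuous_on_id]])
       (auto simp: compatible_def)
  show "compact (code_image K)"
    unfolding code_image_def by (rule compact_continuous_image[OF f compact_compatible[OF assms]])
  define g where "g w = (SOME p. p \<in> ?A \<and> ?f p = w)" for w
  have g: "g (?f p) = p" if p: "p \<in> ?A" for p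
  proof -
    have *: "g (?f p) \<in> ?A \<and> ?f (g (?f p)) = ?f p"
      unfolding g_def by (rule someI[of _ p]) (use p in simp)
    have "q = p" if "q \<in> ?A" "?f q = ?f p" for q
      using that p inj_onD[OF cantor_code_inj, of "fst q" "fst p"] compatible_unique
      by (auto simp: compatible_def[of "fst _"] split: prod.splits) (auto simp: compatible_def)+
    from this[OF conjunct1[OF *] conjunct2[OF *]] show ?thesis .
  qed
  have "continuous_on (code_image K) g"
    unfolding code_image_def
    by (rule continuous_on_inv[OF f compact_compatible[OF assms]]) (use g in blast)
  then have "continuous_on (code_image K) (\<lambda>w. snd (g w))" by (rule continuous_on_snd)
  moreover have "snd (g w) = seq_decode w" if "w \<in> code_image K" for w
    using that g seq_decode_eq by (fastforce simp: code_image_def)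
  ultimately show "continuous_on (code_image K) seq_decode"
    by (simp cong: continuous_on_cong)
qed

lemma seq_code_measurable [measurable]: "seq_code \<in> borel_measurable borel"
proof -
  have "(\<lambda>x. cut_bits x k) \<in> borel_measurable borel" for k
    unfolding cut_bits_def by measurable
  then show ?thesis
    unfolding seq_code_def cantor_code_def by measurable
qed

text \<open>The error estimate behind every replacement of a function by a substitute that is close
  to it on a set of almost full measure.\<close>

lemma integral_diff_le_outside:
  fixes f g :: "'a \<Rightarrow> real"
  assumes N: "prob_space N" and f [measurable]: "f \<in> borel_measurable N" and g [measurable]: "g \<in> borel_measurable N"
    and bf: "\<And>x. \<bar>f x\<bar> \<le> B" and bg: "\<And>x. \<bar>g x\<bar> \<le> B'"
    and A [measurable]: "A \<in> sets N" and close: "\<And>x. x \<in> A \<Longrightarrow> \<bar>f x - g x\<bar> \<le> e" and m: "1 - \<epsilon> \<le> measure N A"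
    and e: "0 \<le> e"
  shows "\<bar>(\<integral>x. f x \<partial>N) - (\<integral>x. g x \<partial>N)\<bar> \<le> e + (B + B') * \<epsilon>"
proof -
  interpret prob_space N by (rule N)
  have B: "0 \<le> B" "0 \<le> B'" using bf bg by (meson abs_ge_zero order_trans)+
  have fi: "integrable N f" "integrable N g"
    using bf bg by (simp_all add: integrable_const_bound[of _ B] integrable_const_bound[of _ B'])
  have ind: "integrable N (indicator (space N - A) :: 'a \<Rightarrow> real)"
    by (rule integrable_real_indicator) (auto simp: less_top[symmetric])
  have "\<bar>(\<integral>x. f x \<partial>N) - (\<integral>x. g x \<partial>N)\<bar> = \<bar>\<integral>x. f x - g x \<partial>N\<bar>"
    using fi by simp
  also have "\<dots> \<le> (\<integral>x. \<bar>f x - g x\<bar> \<partial>N)" by (rule integral_abs_bound)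
  also have "\<dots> \<le> (\<integral>x. e + (B + B') * indicator (space N - A) x \<partial>N)"
  proof (rule integral_mono)
    show "integrable N (\<lambda>x. \<bar>f x - g x\<bar>)" using fi by auto
    show "integrable N (\<lambda>x. e + (B + B') * indicator (space N - A) x)"
      by (intro Bochner_Integration.integrable_add integrable_const integrable_mult_right ind)
    fix x assume "x \<in> space N"
    then show "\<bar>f x - g x\<bar> \<le> e + (B + B') * indicator (space N - A) x"
      using close[of x] bf[of x] bg[of x] e by (cases "x \<in> A") (auto simp: abs_le_iff)
  qed
  also have "\<dots> = e + (B + B') * measure N (space N - A)"
    using ind prob_space by (simp add: Bochner_Integration.integral_add)
  also have "\<dots> \<le> e + (B + B') * \<epsilon>"
    using m B by (intro add_left_mono mult_left_mono) (auto simp: prob_compl)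
  finally show ?thesis .
qed

text \<open>One half of the portmanteau theorem. The continuous functions \<open>f k\<close> lie
  above the indicator of \<open>C\<close> and converge to it pointwise, because a point outside a
  closed set has positive distance from it.\<close>

lemma weak_conv_m_closed_lower_bound:
  fixes C :: "real set"
  assumes \<nu>: "\<And>n. real_distribution (\<nu> n)" and M: "real_distribution M" and conv: "weak_conv_m \<nu> M"
    and C: "closed C" and c: "\<And>n. c \<le> measure (\<nu> n) C"
  shows "c \<le> measure M C"
\<comment> \<open>\<open>infdist\<close> to the empty set is \<open>0\<close>, so the distance
  functions would fail in this case.\<close>
proof (cases "C = {}")
  case False
  interpret M: real_distribution M by (rule M)
  define f where "f k x = max 0 (1 - real k * infdist x C)" for k x
  have f01: "0 \<le> f k x" "f k x \<le> 1" for k x by (auto simp: f_def infdist_nonneg)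
  have fcont: "continuous_on UNIV (f k)" for k
    unfolding f_def by (intro continuous_intros)
  have fk: "c \<le> (\<integral>x. f k x \<partial>M)" for k
  proof (rule tendsto_lowerbound)
    show "(\<lambda>n. \<integral>x. f k x \<partial>\<nu> n) \<longlonglongrightarrow> (\<integral>x. f k x \<partial>M)"
      using fcont f01 by (intro weak_conv_imp_integral_bdd_continuous_conv[OF \<nu> M conv, of _ 1])
        (auto simp: continuous_on_eq_continuous_at)
    show "eventually (\<lambda>n. c \<le> (\<integral>x. f k x \<partial>\<nu> n)) sequentially"
    proof (intro always_eventually allI)
      fix n
      interpret real_distribution "\<nu> n" by (rule \<nu>)
      have "measure (\<nu> n) C = (\<integral>x. indicator C x \<partial>\<nu> n)" using C by simp
      also have "\<dots> \<le> (\<integral>x. f k x \<partial>\<nu> n)"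
      proof (rule integral_mono)
        show "integrable (\<nu> n) (indicator C :: real \<Rightarrow> real)"
          using C by (intro integrable_real_indicator) (auto simp: less_top[symmetric])
        show "integrable (\<nu> n) (f k)"
          using borel_measurable_continuous_onI[OF fcont] f01
          by (intro integrable_const_bound[of _ 1]) auto
        show "indicator C x \<le> f k x" for x
          using f01[of k x] by (auto simp: indicator_def f_def)
      qed
      finally show "c \<le> (\<integral>x. f k x \<partial>\<nu> n)" using c[of n] by simp
    qed
  qed simp
  have "(\<lambda>k. \<integral>x. f k x \<partial>M) \<longlonglongrightarrow> (\<integral>x. indicator C x \<partial>M)"
  proof (rule integral_dominated_convergence[where w = "\<lambda>_. 1"])
    show "f k \<in> borel_measurable M" for k
      using borel_measurable_continuous_onI[OF fcont] by simp
    show "AE x in M. (\<lambda>k. f k x) \<longlonglongrightarrow> indicator C x"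
    proof (rule AE_I2)
      fix x
      show "(\<lambda>k. f k x) \<longlonglongrightarrow> indicator C x"
      proof (cases "x \<in> C")
        case False
        then have pos: "0 < infdist x C"
          using C \<open>C \<noteq> {}\<close> in_closed_iff_infdist_zero infdist_nonneg[of x C] by (metis less_eq_real_def)
        have "eventually (\<lambda>k. f k x = 0) sequentially"
        proof -
          obtain k0 where k0: "1 / infdist x C < real k0" using reals_Archimedean2 by blast
          have "f k x = 0" if "k0 \<le> k" for k
          proof -
            have "1 / infdist x C < real k" using k0 that by linarith
            then show ?thesis using pos by (simp add: f_def field_simps)
          qed
          then show ?thesis by (auto simp: eventually_sequentially)
        qed
        then show ?thesis using False by (simp add: tendsto_eventually)
      qed (simp add: f_def)
    qed
  qed (use C f01 in auto)
  then have "c \<le> (\<integral>x. indicator C x \<partial>M)"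
    using fk by (intro tendsto_lowerbound[of _ _ sequentially]) auto
  then show ?thesis using C by simp
qed (use c in auto)

text \<open>Meant for decoding maps, which are continuous on each of countably many closed sets but
  possibly not on their union.\<close>

lemma borel_measurable_closed_union:
  fixes f :: "'a::topological_space \<Rightarrow> 'b::topological_space" and C :: "nat \<Rightarrow> 'a set"
  assumes C: "\<And>i. closed (C i)" and f: "\<And>i. continuous_on (C i) f"
  shows "(\<lambda>x. if x \<in> (\<Union>i. C i) then f x else c) \<in> borel_measurable borel"
proof -
  let ?U = "\<Union>i. C i" and ?g = "\<lambda>x. if x \<in> (\<Union>i. C i) then f x else c"
  have U: "?U \<in> sets borel" using C by (intro sets.countable_UN) auto
  show ?thesis
  proof (rule measurable_piecewise_restrict[of "insert (- ?U) (range C)"])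
    show "\<Omega> \<inter> space borel \<in> sets borel" if "\<Omega> \<in> insert (- ?U) (range C)" for \<Omega>
      using that U C by (auto simp: borel_comp)
    fix \<Omega> assume "\<Omega> \<in> insert (- ?U) (range C)"
    then consider "\<Omega> = - ?U" | i where "\<Omega> = C i" by auto
    then show "?g \<in> borel_measurable (restrict_space borel \<Omega>)"
    proof cases
      case 1
      then have "continuous_on \<Omega> ?g"
        by (subst continuous_on_cong[OF refl, of _ _ "\<lambda>_. c"]) auto
      then show ?thesis by (rule borel_measurable_continuous_on_restrict)
    next
      case (2 i)
      then have "continuous_on \<Omega> ?g"
        using f[of i] by (subst continuous_on_cong[OF refl, of _ _ f]) auto
      then show ?thesis by (rule borel_measurable_continuous_on_restrict)
    qed
  qed auto
qed

text \<open>Test functions are Borel and continuous on each \<open>K i\<close>, rather than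
  continuous throughout: a strongly continuous function of a distribution, read in coordinates, is
  known to be continuous just on the images of polars.\<close>

theorem prokhorov_sequences:
  fixes P :: "nat \<Rightarrow> (nat \<Rightarrow> real) measure" and K :: "nat \<Rightarrow> (nat \<Rightarrow> real) set"
  assumes P: "\<And>n. prob_space (P n)" and sets_P [measurable_cong]: "\<And>n. sets (P n) = sets borel"
    and K: "\<And>i. compact (K i)" and tight: "\<And>i n. 1 - \<epsilon> i \<le> measure (P n) (K i)" and \<epsilon>: "\<epsilon> \<longlonglongrightarrow> 0"
  shows "\<exists>s Q. strict_mono s \<and> prob_space Q \<and> sets Q = sets borel \<and> (\<forall>i. 1 - \<epsilon> i \<le> measure Q (K i)) \<and>
    (\<forall>(\<phi> :: _ \<Rightarrow> real) B. \<phi> \<in> borel_measurable borel \<longrightarrow> (\<forall>i. continuous_on (K i) \<phi>) \<longrightarrow> (\<forall>x. \<bar>\<phi> x\<bar> \<le> B) \<longrightarrow>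
      (\<lambda>n. \<integral>x. \<phi> x \<partial>P (s n)) \<longlonglongrightarrow> (\<integral>x. \<phi> x \<partial>Q))"
proof -
  define \<nu> where "\<nu> n = distr (P n) borel seq_code" for n
  have mc: "seq_code \<in> borel_measurable (P n)" for n by measurable
  have \<nu>: "real_distribution (\<nu> n)" for n
    unfolding \<nu>_def by (intro prob_space.real_distribution_distr P mc)
  have sub: "code_image (K i) \<inter> UNIV \<in> sets borel" for i
    using compact_code_image(1)[OF K] by (simp add: compact_imp_closed)
  have Kb [measurable]: "K i \<in> sets borel" for i using K by (simp add: compact_imp_closed)
  have \<nu>K: "1 - \<epsilon> i \<le> measure (\<nu> n) (code_image (K i))" for i n
  proof -
    interpret prob_space "P n" by (rule P)
    have "measure (P n) (K i) \<le> measure (P n) (seq_code -` code_image (K i) \<inter> space (P n))"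
      using sub[of i] seq_code_in_image sets.sets_into_space[of "K i" "P n"]
      by (intro finite_measure_mono measurable_sets[OF mc]) (auto simp: sets_P)
    then show ?thesis
      using tight[of i n] sub[of i] mc by (simp add: \<nu>_def measure_distr)
  qed
  have "tight \<nu>"
    unfolding tight_def
  proof (intro conjI allI impI \<nu>)
    fix e :: real assume e: "0 < e"
    \<comment> \<open>Codes lie between 0 and 2; the interval begins at -1 because
      \<open>tight\<close> uses intervals that are open on the left.\<close>
    have "1 - e < measure (\<nu> n) {-1<..2}" for n
    proof -
      interpret prob_space "P n" by (rule P)
      have "seq_code x \<in> {-1<..2}" for x
        using cantor_code_bounds[of "cut_bits x"] compatible_cut_bits[of x]
        by (auto simp: seq_code_def compatible_def intro: less_le_trans[of "-1" 0])
      then have "seq_code -` {-1<..2} \<inter> space (P n) = space (P n)" by blast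
      then show ?thesis using e prob_space by (simp add: \<nu>_def measure_distr mc)
    qed
    then show "\<exists>a b. a < b \<and> (\<forall>n. 1 - e < measure (\<nu> n) {a<..b})"
      by (intro exI[of _ "-1"] exI[of _ 2]) auto
  qed
  from tight_imp_convergent_subsubsequence[OF this strict_mono_id]
  obtain s M where s: "strict_mono s" and M: "real_distribution M" and conv: "weak_conv_m (\<lambda>n. \<nu> (s n)) M"
    by (auto simp: comp_def)
  interpret M: real_distribution M by (rule M)
  \<comment> \<open>Code images are closed and so keep their mass in the limit. As
    \<open>\<epsilon>\<close> tends to 0, \<open>M\<close> lives on their union and can be decoded
    almost surely.\<close>
  have MK: "1 - \<epsilon> i \<le> measure M (code_image (K i))" for i
    using \<nu>K compact_code_image(1)[OF K]
    by (intro weak_conv_m_closed_lower_bound[OF \<nu> M conv]) (auto simp: compact_imp_closed)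
  define U where "U = (\<Union>i. code_image (K i))"
  define R where "R w = (if w \<in> U then seq_decode w else (\<lambda>_. 0))" for w
  have R [measurable]: "R \<in> borel_measurable borel"
    unfolding R_def U_def
    by (intro borel_measurable_closed_union compact_imp_closed compact_code_image K)
  define Q where "Q = distr M borel R"
  have Q: "prob_space Q" unfolding Q_def by (intro M.prob_space_distr) simp
  have QK: "1 - \<epsilon> i \<le> measure Q (K i)" for i
  proof -
    have "measure M (code_image (K i)) \<le> measure M (R -` K i \<inter> space M)"
    proof (rule M.finite_measure_mono)
      have "R w \<in> K i" if "w \<in> code_image (K i)" for w
        using that seq_decode_in[OF that] unfolding R_def U_def by (simp only: UN_I[OF UNIV_I] if_True)
      then show "code_image (K i) \<subseteq> R -` K i \<inter> space M" by auto
      show "R -` K i \<inter> space M \<in> M.events" by measurable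
    qed
    then show ?thesis using MK[of i] by (simp add: Q_def measure_distr)
  qed
  have "(\<lambda>n. \<integral>x. \<phi> x \<partial>P (s n)) \<longlonglongrightarrow> (\<integral>x. \<phi> x \<partial>Q)"
    if \<phi> [measurable]: "\<phi> \<in> borel_measurable borel" and cont: "\<And>i. continuous_on (K i) \<phi>"
      and B: "\<And>x. \<bar>\<phi> x\<bar> \<le> B" for \<phi> :: "(nat \<Rightarrow> real) \<Rightarrow> real" and B
  proof (rule LIMSEQ_I)
    fix r :: real assume r: "0 < r"
    have B0: "0 \<le> B" by (rule order_trans[OF abs_ge_zero B])
    have "(\<lambda>i. (B + B) * \<epsilon> i) \<longlonglongrightarrow> (B + B) * 0" by (intro tendsto_intros \<epsilon>)
    then have "eventually (\<lambda>i. (B + B) * \<epsilon> i < r / 3) sequentially"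
      using r by (intro order_tendstoD(2)[of _ "(B + B) * 0"]) auto
    then obtain i where i: "(B + B) * \<epsilon> i < r / 3" by (auto simp: eventually_sequentially)
    let ?C = "code_image (K i)"
    \<comment> \<open>Weak convergence tests functions continuous on the whole line, so the decoded
      function is extended from the code image by Tietze with the same bound.\<close>
    have "continuous_on ?C (\<lambda>w. \<phi> (seq_decode w))"
      by (rule continuous_on_compose2[OF cont[of i] compact_code_image(2)[OF K]]) (auto intro: seq_decode_in)
    moreover have "closedin (top_of_set UNIV) ?C"
      using compact_code_image(1)[OF K[of i]] by (simp add: compact_imp_closed)
    ultimately obtain \<psi> where \<psi>: "continuous_on UNIV \<psi>" "\<And>w. w \<in> ?C \<Longrightarrow> \<psi> w = \<phi> (seq_decode w)"
        "\<And>w. \<bar>\<psi> w\<bar> \<le> B"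
      using Tietze[of ?C "\<lambda>w. \<phi> (seq_decode w)" UNIV B] B B0 by (metis UNIV_I real_norm_def)
    have [measurable]: "\<psi> \<in> borel_measurable borel" by (rule borel_measurable_continuous_onI[OF \<psi>(1)])
    have 1: "\<bar>(\<integral>x. \<phi> x \<partial>P n) - (\<integral>w. \<psi> w \<partial>\<nu> n)\<bar> \<le> (B + B) * \<epsilon> i" for n
    proof -
      have "\<bar>(\<integral>x. \<phi> x \<partial>P n) - (\<integral>x. \<psi> (seq_code x) \<partial>P n)\<bar> \<le> 0 + (B + B) * \<epsilon> i"
        using B \<psi>(3) tight[of i n] \<psi>(2)[OF seq_code_in_image]
        by (intro integral_diff_le_outside[where A = "K i", OF P]) (auto simp: seq_decode_code)
      then show ?thesis by (simp add: \<nu>_def integral_distr mc)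
    qed
    have 2: "\<bar>(\<integral>x. \<phi> x \<partial>Q) - (\<integral>w. \<psi> w \<partial>M)\<bar> \<le> (B + B) * \<epsilon> i"
    proof -
      have "\<bar>(\<integral>w. \<phi> (R w) \<partial>M) - (\<integral>w. \<psi> w \<partial>M)\<bar> \<le> 0 + (B + B) * \<epsilon> i"
      proof (rule integral_diff_le_outside[where A = ?C, OF M.prob_space_axioms])
        show "(\<lambda>w. \<phi> (R w)) \<in> borel_measurable M" by measurable
        show "\<bar>\<phi> (R w) - \<psi> w\<bar> \<le> 0" if "w \<in> ?C" for w
          using that \<psi>(2)[OF that] by (auto simp: R_def U_def)
      qed (use B \<psi>(3) MK[of i] sub[of i] in auto)
      then show ?thesis by (simp add: Q_def integral_distr)
    qed
    have "(\<lambda>n. \<integral>w. \<psi> w \<partial>\<nu> (s n)) \<longlonglongrightarrow> (\<integral>w. \<psi> w \<partial>M)"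
      using \<psi>(1,3) by (intro weak_conv_imp_integral_bdd_continuous_conv[OF \<nu> M conv, of _ B])
        (auto simp: continuous_on_eq_continuous_at)
    then obtain N where N: "\<And>n. N \<le> n \<Longrightarrow> norm ((\<integral>w. \<psi> w \<partial>\<nu> (s n)) - (\<integral>w. \<psi> w \<partial>M)) < r / 3"
      using LIMSEQ_D[of _ _ "r / 3"] r by (metis divide_pos_pos zero_less_numeral)
    have "norm ((\<integral>x. \<phi> x \<partial>P (s n)) - (\<integral>x. \<phi> x \<partial>Q)) < r" if "N \<le> n" for n
      using 1[of "s n"] 2 N[OF that] i unfolding real_norm_def by linarith
    then show "\<exists>N. \<forall>n\<ge>N. norm ((\<integral>x. \<phi> x \<partial>P (s n)) - (\<integral>x. \<phi> x \<partial>Q)) < r" by blast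
  qed
  moreover have "sets Q = sets borel" by (simp add: Q_def)
  ultimately show ?thesis using s Q QK by blast
qed

section \<open>Polars in the space of tempered distributions\<close>

lemma bracket_linear: "linear (bracket F)"
  using bracket[of F] by simp

lemmas bracket_add = linear_add[OF bracket_linear]
  and bracket_diff = linear_diff[OF bracket_linear]
  and bracket_scale = linear_scale[OF bracket_linear]
  and bracket_zero = linear_0[OF bracket_linear]
  and bracket_sum = linear_sum[OF bracket_linear]

lemma bracket_diff_left: "bracket (F - G) f = bracket F f - bracket G f"
  by transfer simp

lemma bracket_nrm_bound:
  fixes F :: "'n::finite tempered"
  shows "\<exists>m. \<exists>C>0. \<forall>f. \<bar>bracket F f\<bar> \<le> C * S.nrm m f"
proof -
  have "open (bracket F -` {-1<..<1})"
    using bracket[of F] by (intro open_vimage) auto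
  moreover have "0 \<in> bracket F -` {-1<..<1}" by (simp add: bracket_zero)
  ultimately obtain m \<delta> where \<delta>: "0 < \<delta>" "\<And>y. S.nrm m (y - 0) < \<delta> \<Longrightarrow> y \<in> bracket F -` {-1<..<1}"
    using open_schwartz_imp_nrm_ball by blast
  have "\<bar>bracket F f\<bar> \<le> 2 / \<delta> * S.nrm m f" for f
  proof (cases "f = 0")
    case False
    then have n: "0 < S.nrm m f" by (rule S.nrm_pos)
    \<comment> \<open>Scales \<open>f\<close> to norm \<open>\<delta> / 2\<close>, inside the ball
      on which the bracket is below 1 in modulus.\<close>
    define c where "c = \<delta> / (2 * S.nrm m f)"
    have c: "0 < c" using \<delta>(1) n by (simp add: c_def)
    have "S.nrm m (c *\<^sub>R f - 0) < \<delta>"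
      using \<delta>(1) n c by (simp add: S.nrm_scale) (simp add: c_def)
    then have "\<bar>bracket F (c *\<^sub>R f)\<bar> < 1" using \<delta>(2)[of "c *\<^sub>R f"] by (auto simp: abs_less_iff)
    then have "c * \<bar>bracket F f\<bar> < 1" using c by (simp add: bracket_scale abs_mult)
    then show ?thesis using \<delta>(1) n by (simp add: c_def field_simps)
  qed (simp add: bracket_zero)
  then show ?thesis using \<delta>(1) by (intro exI[of _ m] exI[of _ "2 / \<delta>"]) auto
qed

lemma nrm_bounded_functional_continuous:
  fixes G :: "'n::finite schwartz \<Rightarrow> real"
  assumes G: "linear G" and bound: "\<And>f. \<bar>G f\<bar> \<le> C * S.nrm m f"
  shows "continuous_on UNIV G"
proof (rule continuous_on_open_vimage[THEN iffD2, OF open_UNIV], intro allI impI)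
  fix B :: "real set" assume B: "open B"
  show "open (G -` B \<inter> UNIV)"
  proof (rule topological_space_class.openI)
    fix x assume "x \<in> G -` B \<inter> UNIV"
    then obtain e where e: "0 < e" "\<And>r. dist r (G x) < e \<Longrightarrow> r \<in> B"
      using B by (auto simp: open_dist)
    have C: "0 < \<bar>C\<bar> + 1" by simp
    obtain U where U: "open U" "x \<in> U" "\<And>y. y \<in> U \<Longrightarrow> S.nrm m (y - x) < e / (\<bar>C\<bar> + 1)"
      using nrm_ball_contains_open[of "e / (\<bar>C\<bar> + 1)" x m] e(1) by auto
    have "y \<in> G -` B" if "y \<in> U" for y
    proof -
      have "\<bar>G y - G x\<bar> \<le> C * S.nrm m (y - x)"
        using bound[of "y - x"] by (simp add: linear_diff[OF G])
      also have "\<dots> \<le> (\<bar>C\<bar> + 1) * S.nrm m (y - x)" by (intro mult_right_mono) auto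
      also have "\<dots> < e" using U(3)[OF that] C by (simp add: field_simps)
      finally show ?thesis using e(2)[of "G y"] by (simp add: dist_real_def)
    qed
    then show "\<exists>T. open T \<and> x \<in> T \<and> T \<subseteq> G -` B \<inter> UNIV" using U by blast
  qed
qed

lemma tvs_bounded_nrm_bound:
  fixes B :: "'n::finite schwartz set"
  assumes "tvs_bounded B"
  shows "\<exists>R>0. \<forall>f\<in>B. S.nrm m f \<le> R"
proof -
  have "\<exists>U. open U \<and> (0 :: 'n schwartz) \<in> U \<and> (\<forall>y\<in>U. S.nrm m (y - 0) < 1)"
    by (rule nrm_ball_contains_open) simp
  then obtain U where U: "open U" "(0 :: 'n schwartz) \<in> U" "\<forall>y\<in>U. S.nrm m (y - 0) < 1"
    by (elim exE conjE)
  obtain s where s: "0 < s" "\<And>t. s < t \<Longrightarrow> B \<subseteq> (\<lambda>x. t *\<^sub>R x) ` U"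
    using assms U(1,2) unfolding tvs_bounded_def by blast
  have "S.nrm m f \<le> s + 1" if "f \<in> B" for f
  proof -
    have "f \<in> (\<lambda>x. (s + 1) *\<^sub>R x) ` U" using s(2)[OF less_add_one] that by (rule subsetD)
    then obtain u where u: "u \<in> U" "f = (s + 1) *\<^sub>R u" by (rule imageE)
    have "S.nrm m (u - 0) < 1" using U(3) u(1) by (rule bspec)
    then show ?thesis using s(1) by (simp add: u(2) S.nrm_scale)
  qed
  then show ?thesis using s(1) by (intro exI[of _ "s + 1"]) auto
qed

text \<open>Turns each evaluation into a strong semi-norm, so that brackets are strongly continuous
  and hence Borel.\<close>

lemma tvs_bounded_singleton: "tvs_bounded {f :: 'n::finite schwartz}"
  unfolding tvs_bounded_def
proof (intro allI impI, elim conjE)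
  fix U :: "'n schwartz set" assume "open U" "0 \<in> U"
  then obtain m \<delta> where \<delta>: "0 < \<delta>" "\<And>y. S.nrm m (y - 0) < \<delta> \<Longrightarrow> y \<in> U"
    using open_schwartz_imp_nrm_ball by blast
  have "{f} \<subseteq> (\<lambda>x. t *\<^sub>R x) ` U" if t: "S.nrm m f / \<delta> + 1 < t" for t
  proof -
    have "0 \<le> S.nrm m f / \<delta>" using \<delta>(1) by simp
    then have t0: "0 < t" using t by linarith
    have "S.nrm m f / \<delta> < t" using t by linarith
    then have "S.nrm m ((1 / t) *\<^sub>R f - 0) < \<delta>"
      using \<delta>(1) t0 by (simp add: S.nrm_scale field_simps)
    then have "(1 / t) *\<^sub>R f \<in> U" by (rule \<delta>(2))
    moreover have "f = t *\<^sub>R ((1 / t) *\<^sub>R f)" using t0 by simp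
    ultimately show ?thesis by blast
  qed
  moreover have "0 < S.nrm m f / \<delta> + 1" using \<delta>(1) by (simp add: add_nonneg_pos)
  ultimately show "\<exists>s>0. \<forall>t>s. {f} \<subseteq> (\<lambda>x. t *\<^sub>R x) ` U" by blast
qed

lemma continuous_on_bracket: "continuous_on UNIV (\<lambda>F :: 'n::finite tempered. bracket F f)"
proof (rule continuous_on_open_vimage[THEN iffD2, OF open_UNIV], intro allI impI)
  fix B :: "real set" assume B: "open B"
  show "open ((\<lambda>F. bracket F f) -` B \<inter> UNIV)"
  proof (rule topological_space_class.openI)
    fix F :: "'n tempered" assume "F \<in> (\<lambda>F. bracket F f) -` B \<inter> UNIV"
    then obtain e where e: "0 < e" "\<And>r. dist r (bracket F f) < e \<Longrightarrow> r \<in> B"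
      using B by (auto simp: open_dist)
    let ?T = "{G. strong_seminorm {f} (G - F) < e}"
    have "open ?T"
      unfolding open_tempered_def seminorm_open_def
      using e(1) tvs_bounded_singleton[of f] by (intro generate_topology.Basis) blast
    moreover have "F \<in> ?T" using e(1) by (simp add: strong_seminorm_def bracket_diff_left)
    moreover have "?T \<subseteq> (\<lambda>F. bracket F f) -` B \<inter> UNIV"
      using e(2) by (auto simp: strong_seminorm_def bracket_diff_left dist_real_def)
    ultimately show "\<exists>T. open T \<and> F \<in> T \<and> T \<subseteq> (\<lambda>F. bracket F f) -` B \<inter> UNIV" by blast
  qed
qed

lemma bracket_measurable [measurable]: "(\<lambda>F. bracket F f) \<in> borel_measurable borel"
  by (rule borel_measurable_continuous_onI[OF continuous_on_bracket])

text \<open>For positive \<open>\<kappa>\<close> this is the polar of the ball of radius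
  \<open>1 / \<kappa>\<close> in the m-th norm.\<close>

definition polar :: "nat \<Rightarrow> real \<Rightarrow> 'n::finite tempered set" where
  "polar m \<kappa> = {F. \<forall>f. \<bar>bracket F f\<bar> \<le> \<kappa> * S.nrm m f}"

lemma closed_bracket_le: "closed {F :: 'n::finite tempered. \<bar>bracket F f\<bar> \<le> c}"
  by (intro closed_Collect_le continuous_intros continuous_on_bracket)

lemma closed_polar: "closed (polar m \<kappa> :: 'n::finite tempered set)"
proof -
  have "polar m \<kappa> = (\<Inter>f. {F :: 'n tempered. \<bar>bracket F f\<bar> \<le> \<kappa> * S.nrm m f})"
    by (auto simp: polar_def)
  then show ?thesis by (simp only:) (intro closed_INT ballI closed_bracket_le)
qed

section \<open>Coordinates along a total family, and compactness of polars\<close>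

definition total_family :: "nat \<Rightarrow> 'n::finite schwartz" where
  "total_family = (SOME d. \<forall>x m. \<forall>\<epsilon>>0. \<exists>y\<in>span (range d). S.nrm m (x - y) < \<epsilon>)"

lemma total_family:
  fixes x :: "'n::finite schwartz"
  assumes "0 < \<epsilon>"
  shows "\<exists>y\<in>span (range total_family). S.nrm m (x - y) < \<epsilon>"
proof -
  have "\<forall>x m. \<forall>\<epsilon>>0. \<exists>y\<in>span (range (total_family :: nat \<Rightarrow> 'n schwartz)). S.nrm m (x - y) < \<epsilon>"
    unfolding total_family_def by (rule someI_ex[OF S.countable_total_family])
  then show ?thesis using assms by blast
qed

definition coords :: "'n::finite tempered \<Rightarrow> nat \<Rightarrow> real" where
  "coords F i = bracket F (total_family i)"

lemma coords_measurable [measurable]: "coords \<in> borel_measurable borel"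
  by (rule measurable_coordinatewise_then_product) (simp add: coords_def)

text \<open>The difference of two distributions is bounded by some norm of the scale, and in that
  norm the span of the total family is dense.\<close>

lemma inj_coords: "inj (coords :: 'n::finite tempered \<Rightarrow> _)"
proof (rule injI)
  fix F G :: "'n tempered" assume eq: "coords F = coords G"
  have sp: "bracket F y = bracket G y" if "y \<in> span (range total_family)" for y
  proof (rule linear_eq_on_span[OF bracket_linear bracket_linear _ that])
    fix x :: "'n schwartz" assume "x \<in> range total_family"
    then obtain i where "x = total_family i" by blast
    then show "bracket F x = bracket G x" using fun_cong[OF eq, of i] by (simp add: coords_def)
  qed
  have "bracket F f = bracket G f" for f
  proof -
    obtain m C where C: "0 < C" "\<And>f. \<bar>bracket (F - G) f\<bar> \<le> C * S.nrm m f"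
      using bracket_nrm_bound[of "F - G"] by blast
    have "\<bar>bracket (F - G) f\<bar> \<le> e" if e: "0 < e" for e
    proof -
      obtain y where y: "y \<in> span (range total_family)" "S.nrm m (f - y) < e / C"
        using total_family[of "e / C" m f] e C(1) by auto
      have "bracket (F - G) f = bracket (F - G) (f - y)"
        using sp[OF y(1)] bracket_diff[of "F - G" f y] by (simp add: bracket_diff_left)
      then have "\<bar>bracket (F - G) f\<bar> \<le> C * S.nrm m (f - y)" using C(2)[of "f - y"] by simp
      also have "\<dots> \<le> e" using y(2) C(1) by (simp add: field_simps)
      finally show ?thesis .
    qed
    then have "\<bar>bracket (F - G) f\<bar> \<le> 0" by (rule field_le_epsilon[of _ 0, simplified])
    then show ?thesis by (simp add: bracket_diff_left)
  qed
  then show "F = G" by (metis bracket_inject ext)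
qed

text \<open>The common bound on the polar carries convergence from the dense span to every test
  function by an argument with three errors of \<open>e / 3\<close>.\<close>

lemma polar_convergent:
  assumes F: "\<And>n. F n \<in> polar m \<kappa>" and conv: "\<And>i. convergent (\<lambda>n. coords (F n) i)"
  shows "convergent (\<lambda>n. bracket (F n) f)"
proof -
  have sp: "convergent (\<lambda>n. bracket (F n) y)" if "y \<in> span (range total_family)" for y
    using that
  proof (induction rule: span_induct_alt)
    case base
    then show ?case by (simp add: bracket_zero convergent_const)
  next
    case (step c x y)
    then show ?case
      using conv by (auto simp: bracket_add bracket_scale coords_def intro!: convergent_add convergent_mult convergent_const)
  qed
  have "Cauchy (\<lambda>n. bracket (F n) f)"
  proof (rule CauchyI)
    fix e :: real assume e: "0 < e"
    \<comment> \<open>\<open>\<kappa>\<close> may be zero or negative; \<open>c\<close> is an upper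
      bound for it by which one can divide.\<close>
    define c where "c = \<bar>\<kappa>\<bar> + 1"
    have c: "0 < c" "\<kappa> \<le> c" by (auto simp: c_def)
    obtain y where y: "y \<in> span (range total_family)" "S.nrm m (f - y) < e / (3 * c)"
      using total_family[of "e / (3 * c)" m f] e c by auto
    have close: "\<bar>bracket (F n) f - bracket (F n) y\<bar> < e / 3" for n
    proof -
      have "\<bar>bracket (F n) (f - y)\<bar> \<le> \<kappa> * S.nrm m (f - y)"
        using F[of n] by (simp add: polar_def)
      also have "\<dots> \<le> c * S.nrm m (f - y)" using c by (intro mult_right_mono) auto
      also have "\<dots> < e / 3" using y(2) c by (simp add: field_simps)
      finally show ?thesis by (simp add: bracket_diff)
    qed
    obtain N where N: "\<And>i j. N \<le> i \<Longrightarrow> N \<le> j \<Longrightarrow> \<bar>bracket (F i) y - bracket (F j) y\<bar> < e / 3"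
      using CauchyD[OF convergent_Cauchy[OF sp[OF y(1)]], of "e / 3"] e by auto
    have "norm (bracket (F i) f - bracket (F j) f) < e" if "N \<le> i" "N \<le> j" for i j
      using close[of i] close[of j] N[OF that] unfolding real_norm_def by linarith
    then show "\<exists>M. \<forall>i\<ge>M. \<forall>j\<ge>M. norm (bracket (F i) f - bracket (F j) f) < e" by blast
  qed
  then show ?thesis by (simp add: Cauchy_convergent_iff)
qed

text \<open>A sequential Banach-Alaoglu theorem: the pointwise limit is linear and inherits the
  bound of the polar, which makes it a tempered distribution again.\<close>

lemma polar_limit:
  fixes F :: "nat \<Rightarrow> 'n::finite tempered"
  assumes F: "\<And>n. F n \<in> polar m \<kappa>" and lim: "\<And>i. (\<lambda>n. coords (F n) i) \<longlonglongrightarrow> c i"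
  shows "\<exists>G\<in>polar m \<kappa>. coords G = c \<and> (\<forall>f. (\<lambda>n. bracket (F n) f) \<longlonglongrightarrow> bracket G f)"
proof -
  define g where "g f = lim (\<lambda>n. bracket (F n) f)" for f
  have g: "(\<lambda>n. bracket (F n) f) \<longlonglongrightarrow> g f" for f
    unfolding g_def convergent_LIMSEQ_iff[symmetric]
    by (rule polar_convergent[OF F]) (rule convergentI[OF lim])
  have bound: "\<bar>g f\<bar> \<le> \<kappa> * S.nrm m f" for f
    using F by (intro tendsto_upperbound[OF tendsto_rabs[OF g]]) (auto simp: polar_def)
  have lin: "linear g"
  proof (rule linearI)
    fix x y
    have "(\<lambda>n. bracket (F n) (x + y)) \<longlonglongrightarrow> g x + g y"
      unfolding bracket_add by (intro tendsto_add g)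
    then show "g (x + y) = g x + g y" using g LIMSEQ_unique by blast
  next
    fix r x
    have "(\<lambda>n. bracket (F n) (r *\<^sub>R x)) \<longlonglongrightarrow> r *\<^sub>R g x"
      unfolding bracket_scale by (intro tendsto_scaleR tendsto_const g)
    then show "g (r *\<^sub>R x) = r *\<^sub>R g x" using g LIMSEQ_unique by blast
  qed
  have G: "bracket (Abs_tempered g) = g"
    using lin nrm_bounded_functional_continuous[OF lin bound] by (intro Abs_tempered_inverse) simp
  show ?thesis
  proof (intro bexI[of _ "Abs_tempered g"] conjI allI)
    show "coords (Abs_tempered g) = c"
    proof
      fix i
      show "coords (Abs_tempered g) i = c i"
        using LIMSEQ_unique[OF g[of "total_family i"] lim[of i, unfolded coords_def]]
        by (simp add: coords_def G)
    qed
    show "Abs_tempered g \<in> polar m \<kappa>" using bound by (simp add: polar_def G)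
  qed (use g in \<open>simp add: G\<close>)
qed

lemma LIMSEQ_coordinate: "x \<longlonglongrightarrow> a \<Longrightarrow> (\<lambda>n. x n i) \<longlonglongrightarrow> (a i :: 'b::topological_space)"
  using continuous_on_tendsto_compose[OF continuous_on_product_coordinates[of i]] by auto

lemma inv_coords: "inv coords (coords F) = F"
  by (rule inv_f_f[OF inj_coords])

lemma inv_coords_image:
  fixes A :: "'n::finite tempered set"
  shows "x \<in> coords ` A \<Longrightarrow> inv coords x \<in> A \<and> coords (inv coords x :: 'n tempered) = x"
  by (auto simp: inv_coords)

text \<open>The space of real sequences is metrizable, so subsequences suffice. Coordinates lie in a
  product of compact intervals, and a coordinatewise limit comes from a member of the polar.\<close>

lemma compact_coords_polar: "compact (coords ` (polar m \<kappa> :: 'n::finite tempered set))"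
  unfolding compact_eq_seq_compact_metric seq_compact_def
proof (intro allI impI)
  fix x :: "nat \<Rightarrow> nat \<Rightarrow> real" assume "\<forall>n. x n \<in> coords ` (polar m \<kappa> :: 'n tempered set)"
  note x = inv_coords_image[OF this[rule_format]]
  define F :: "nat \<Rightarrow> 'n tempered" where "F n = inv coords (x n)" for n
  have F: "F n \<in> polar m \<kappa>" "x n = coords (F n)" for n
    using x[of n] by (simp_all add: F_def)
  let ?r = "\<lambda>i. \<kappa> * S.nrm m (total_family i :: 'n schwartz)"
  have "compact {x. \<forall>i. x i \<in> {- ?r i..?r i}}" by (rule compact_Pi_UNIV) simp
  moreover have "x n \<in> {x. \<forall>i. x i \<in> {- ?r i..?r i}}" for n
    using F(1)[of n] by (auto simp: F(2) coords_def polar_def abs_le_iff minus_le_iff)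
  ultimately obtain c r where r: "strict_mono r" "(x \<circ> r) \<longlonglongrightarrow> c"
    by (metis (no_types, lifting) compact_eq_seq_compact_metric seq_compactE)
  have "(\<lambda>n. coords ((F \<circ> r) n) i) \<longlonglongrightarrow> c i" for i
    using LIMSEQ_coordinate[OF r(2), of i] by (simp add: F(2) comp_def)
  then obtain G :: "'n tempered" where "G \<in> polar m \<kappa>" "coords G = c"
    using polar_limit[of "F \<circ> r" m \<kappa> c] F(1) by auto
  then show "\<exists>l\<in>coords ` (polar m \<kappa> :: 'n tempered set). \<exists>r. strict_mono r \<and> (x \<circ> r) \<longlonglongrightarrow> l"
    using r by blast
qed

lemma strong_seminorm_upper:
  assumes "tvs_bounded B" "f \<in> B"
  shows "\<bar>bracket F f\<bar> \<le> strong_seminorm B F"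
proof -
  obtain m C where C: "0 < C" "\<And>f. \<bar>bracket F f\<bar> \<le> C * S.nrm m f" using bracket_nrm_bound by blast
  obtain R where R: "0 < R" "\<And>f. f \<in> B \<Longrightarrow> S.nrm m f \<le> R" using tvs_bounded_nrm_bound[OF assms(1)] by blast
  have "\<bar>bracket F f\<bar> \<le> C * R" if "f \<in> B" for f
    using order_trans[OF C(2)[of f] mult_left_mono[OF R(2)[OF that], of C]] C(1) by simp
  then have "bdd_above ((\<lambda>f. \<bar>bracket F f\<bar>) ` B)" by (intro bdd_aboveI2)
  then show ?thesis unfolding strong_seminorm_def using assms(2) by (intro cSUP_upper)
qed

lemma strong_seminorm_triangle:
  assumes "tvs_bounded B" "B \<noteq> {}"
  shows "strong_seminorm B (F - H) \<le> strong_seminorm B (F - G) + strong_seminorm B (G - H)"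
  unfolding strong_seminorm_def[of B "F - H"]
proof (rule cSUP_least[OF assms(2)])
  fix f assume "f \<in> B"
  then show "\<bar>bracket (F - H) f\<bar> \<le> strong_seminorm B (F - G) + strong_seminorm B (G - H)"
    using strong_seminorm_upper[OF assms(1), of f "F - G"] strong_seminorm_upper[OF assms(1), of f "G - H"]
    by (simp add: bracket_diff_left)
qed

text \<open>Bounded sets are totally bounded for each Hilbert norm, so on a polar pointwise convergence is
  uniform on bounded sets.\<close>

lemma polar_strong_convergence:
  fixes F :: "nat \<Rightarrow> 'n::finite tempered"
  assumes F: "\<And>n. F n \<in> polar m \<kappa>" and G: "G \<in> polar m \<kappa>"
    and lim: "\<And>f. (\<lambda>n. bracket (F n) f) \<longlonglongrightarrow> bracket G f"
    and B: "tvs_bounded B" "B \<noteq> {}"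
  shows "(\<lambda>n. strong_seminorm B (F n - G)) \<longlonglongrightarrow> 0"
proof (rule LIMSEQ_I)
  fix e :: real assume e: "0 < e"
  obtain k where k: "\<And>\<epsilon>. 0 < \<epsilon> \<Longrightarrow> \<exists>E. S.orthonormal k E \<and>
      (\<forall>x :: 'n schwartz. S.nrm m (x - S.proj k E x) \<le> \<epsilon> * S.nrm k x)"
    using S.total_boundedness[of m] by blast
  obtain R where R: "0 < R" "\<And>f. f \<in> B \<Longrightarrow> S.nrm k f \<le> R" using tvs_bounded_nrm_bound[OF B(1)] by blast
  define c where "c = \<bar>\<kappa>\<bar> + 1"
  have c: "0 < c" "\<kappa> \<le> c" by (auto simp: c_def)
  \<comment> \<open>Two remainders of \<open>e / 8\<close> and a finite part below
    \<open>e / 2\<close> add up to \<open>3 * e / 4\<close>, which keeps the supremum over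
    \<open>B\<close> strictly below \<open>e\<close>.\<close>
  define \<epsilon> where "\<epsilon> = e / (8 * c * R)"
  have \<epsilon>: "0 < \<epsilon>" using e c R by (simp add: \<epsilon>_def)
  obtain E where E: "S.orthonormal k E"
      "\<And>x :: 'n schwartz. S.nrm m (x - S.proj k E x) \<le> \<epsilon> * S.nrm k x"
    using k[OF \<epsilon>] by blast
  have "(\<lambda>n. \<Sum>e\<in>E. R * \<bar>bracket (F n) e - bracket G e\<bar>) \<longlonglongrightarrow> (\<Sum>e\<in>E. R * \<bar>bracket G e - bracket G e\<bar>)"
    by (intro tendsto_intros lim)
  then have "(\<lambda>n. \<Sum>e\<in>E. R * \<bar>bracket (F n) e - bracket G e\<bar>) \<longlonglongrightarrow> 0" by simp
  then have "eventually (\<lambda>n. (\<Sum>e\<in>E. R * \<bar>bracket (F n) e - bracket G e\<bar>) < e / 2) sequentially"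
    using e by (intro order_tendstoD(2)) auto
  then obtain N where N: "\<And>n. N \<le> n \<Longrightarrow> (\<Sum>e\<in>E. R * \<bar>bracket (F n) e - bracket G e\<bar>) < e / 2"
    by (auto simp: eventually_sequentially)
  have "norm (strong_seminorm B (F n - G) - 0) < e" if n: "N \<le> n" for n
  proof -
    have "\<bar>bracket (F n - G) f\<bar> \<le> e / 2 + e / 4" if f: "f \<in> B" for f
    proof -
      let ?p = "S.proj k E f"
      have "S.nrm m (f - ?p) \<le> \<epsilon> * S.nrm k f" by (rule E(2))
      also have "\<dots> \<le> \<epsilon> * R" using R(2)[OF f] \<epsilon> by simp
      finally have small: "S.nrm m (f - ?p) \<le> \<epsilon> * R" .
      have pol: "\<bar>bracket H (f - ?p)\<bar> \<le> e / 8" if "H \<in> polar m \<kappa>" for H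
      proof -
        have "\<bar>bracket H (f - ?p)\<bar> \<le> \<kappa> * S.nrm m (f - ?p)" using that by (simp add: polar_def)
        also have "\<dots> \<le> c * S.nrm m (f - ?p)" using c by (intro mult_right_mono) auto
        also have "\<dots> \<le> c * (\<epsilon> * R)" using small c by (intro mult_left_mono) auto
        also have "\<dots> = e / 8" using c R by (simp add: \<epsilon>_def)
        finally show ?thesis .
      qed
      have "\<bar>bracket (F n - G) ?p\<bar> \<le> (\<Sum>e\<in>E. \<bar>schwartz_ip k f e * (bracket (F n) e - bracket G e)\<bar>)"
        unfolding S.proj_def bracket_sum bracket_scale bracket_diff_left real_scaleR_def by (rule sum_abs)
      also have "\<dots> \<le> (\<Sum>e\<in>E. R * \<bar>bracket (F n) e - bracket G e\<bar>)"
      proof (rule sum_mono)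
        fix e' assume e': "e' \<in> E"
        have "S.nrm k e' = 1" using E(1) e' by (simp add: S.nrm_def S.orthonormal_def)
        then have "\<bar>schwartz_ip k f e'\<bar> \<le> R" using S.cauchy_schwarz[of k f e'] R(2)[OF f] by simp
        then show "\<bar>schwartz_ip k f e' * (bracket (F n) e' - bracket G e')\<bar> \<le> R * \<bar>bracket (F n) e' - bracket G e'\<bar>"
          unfolding abs_mult by (intro mult_right_mono) auto
      qed
      finally have "\<bar>bracket (F n - G) ?p\<bar> < e / 2" using N[OF n] by simp
      moreover have "bracket (F n - G) f = bracket (F n - G) ?p + bracket (F n) (f - ?p) - bracket G (f - ?p)"
        by (simp add: bracket_diff_left bracket_diff)
      ultimately show ?thesis using pol[OF F[of n]] pol[OF G] by linarith
    qed
    then have "strong_seminorm B (F n - G) \<le> e / 2 + e / 4"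
      unfolding strong_seminorm_def by (intro cSUP_least B(2))
    moreover obtain f where "f \<in> B" using B(2) by blast
    then have "0 \<le> strong_seminorm B (F n - G)"
      using strong_seminorm_upper[OF B(1)] abs_ge_zero order_trans by blast
    ultimately show ?thesis using e by simp
  qed
  then show "\<exists>N. \<forall>n\<ge>N. norm (strong_seminorm B (F n - G) - 0) < e" by blast
qed

text \<open>On a polar the coordinate topology is at least as fine as the strong one. Sequences
  suffice on the metrizable coordinate side, and on the strong side it is enough to pull back
  subbasic sets.\<close>

lemma continuous_on_inv_coords:
  "continuous_on (coords ` (polar m \<kappa> :: 'n::finite tempered set)) (inv coords :: _ \<Rightarrow> 'n tempered)"
proof (rule continuous_on_generate_topology)
  show "open = generate_topology {{y :: 'n tempered. p (y - x) < e} | p x e.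
      p \<in> {strong_seminorm B | B. tvs_bounded B \<and> B \<noteq> {}} \<and> 0 < e}"
    by (simp add: open_tempered_def seminorm_open_def fun_eq_iff)
  fix A assume "A \<in> {{y :: 'n tempered. p (y - x) < e} | p x e.
      p \<in> {strong_seminorm B | B. tvs_bounded B \<and> B \<noteq> {}} \<and> 0 < e}"
  then obtain B H e where A: "A = {y. strong_seminorm B (y - H) < e}" and B: "tvs_bounded B" "B \<noteq> {}"
    by blast
  let ?q = "\<lambda>x. strong_seminorm B (inv coords x - H)"
  have "continuous_on (coords ` (polar m \<kappa> :: 'n tempered set)) ?q"
    unfolding continuous_on_sequentially
  proof (intro allI ballI impI, elim conjE)
    fix x :: "nat \<Rightarrow> nat \<Rightarrow> real" and a assume x: "\<forall>n. x n \<in> coords ` (polar m \<kappa> :: 'n tempered set)" "x \<longlonglongrightarrow> a"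
      and a: "a \<in> coords ` (polar m \<kappa> :: 'n tempered set)"
    define F :: "nat \<Rightarrow> 'n tempered" where "F n = inv coords (x n)" for n
    have F: "F n \<in> polar m \<kappa>" "x n = coords (F n)" for n
      using inv_coords_image[OF x(1)[rule_format, of n]] by (simp_all add: F_def)
    obtain G :: "'n tempered" where G: "G \<in> polar m \<kappa>" "a = coords G" using a by blast
    have "(\<lambda>n. coords (F n) i) \<longlonglongrightarrow> coords G i" for i
      using LIMSEQ_coordinate[OF x(2), of i] by (simp add: F(2) G(2))
    then obtain G' :: "'n tempered" where "coords G' = coords G" "\<forall>f. (\<lambda>n. bracket (F n) f) \<longlonglongrightarrow> bracket G' f"
      using polar_limit[of F m \<kappa> "coords G"] F(1) by blast
    then have "(\<lambda>n. bracket (F n) f) \<longlonglongrightarrow> bracket G f" for f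
      using injD[OF inj_coords] by metis
    from polar_strong_convergence[OF F(1) G(1) this B]
    have 0: "(\<lambda>n. strong_seminorm B (F n - G)) \<longlonglongrightarrow> 0" .
    have sym: "strong_seminorm B (F n - G) = strong_seminorm B (G - F n)" for n
      by (simp add: strong_seminorm_def bracket_diff_left abs_minus_commute)
    have "\<bar>strong_seminorm B (F n - H) - strong_seminorm B (G - H)\<bar> \<le> strong_seminorm B (F n - G)" for n
      using strong_seminorm_triangle[OF B, of "F n" H G] strong_seminorm_triangle[OF B, of G H "F n"] sym[of n]
      by linarith
    then have "(\<lambda>n. strong_seminorm B (F n - H) - strong_seminorm B (G - H)) \<longlonglongrightarrow> 0"
      by (intro Lim_null_comparison[OF _ 0]) simp
    then have "(\<lambda>n. strong_seminorm B (F n - H)) \<longlonglongrightarrow> strong_seminorm B (G - H)"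
      by (simp only: LIM_zero_iff)
    then show "(?q \<circ> x) \<longlonglongrightarrow> ?q a" by (simp add: comp_def F(2) G(2) inv_coords)
  qed
  then have "\<exists>C. open C \<and> C \<inter> coords ` (polar m \<kappa> :: 'n tempered set)
      = ?q -` {..<e} \<inter> coords ` (polar m \<kappa> :: 'n tempered set)"
    by (rule continuous_on_open_invariant[THEN iffD1, rule_format]) simp
  then show "\<exists>C. open C \<and> C \<inter> coords ` (polar m \<kappa> :: 'n tempered set)
      = inv coords -` A \<inter> coords ` (polar m \<kappa> :: 'n tempered set)"
    by (simp add: A vimage_def)
qed

section \<open>Tightness\<close>

text \<open>From \<open>1 - cos t = 2 * (sin (t / 2))\<^sup>2\<close> and the addition formula for
  the sine. Its expectation is the hypothesis \<open>diff\<close> of the equicontinuity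
  argument.\<close>

lemma one_minus_cos_diff_le:
  fixes a b :: real
  shows "1 - cos (a - b) \<le> 2 * (1 - cos a) + 2 * (1 - cos b)"
proof -
  have half: "1 - cos t = 2 * (sin (t / 2))\<^sup>2" for t :: real
    using cos_double_sin[of "t / 2"] by simp
  let ?p = "sin (a / 2)" and ?q = "sin (b / 2)"
  have "sin ((a - b) / 2) = ?p * cos (b / 2) - cos (a / 2) * ?q"
    using sin_diff[of "a / 2" "b / 2"] by (simp add: diff_divide_distrib)
  also have "\<bar>\<dots>\<bar> \<le> \<bar>?p * cos (b / 2)\<bar> + \<bar>cos (a / 2) * ?q\<bar>" by (rule abs_triangle_ineq4)
  also have "\<dots> \<le> \<bar>?p\<bar> + \<bar>?q\<bar>"
    by (intro add_mono) (simp_all add: abs_mult mult_left_le mult_left_le_one_le)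
  finally have "\<bar>sin ((a - b) / 2)\<bar>\<^sup>2 \<le> (\<bar>?p\<bar> + \<bar>?q\<bar>)\<^sup>2" by (intro power_mono) auto
  also have "\<dots> \<le> 2 * \<bar>?p\<bar>\<^sup>2 + 2 * \<bar>?q\<bar>\<^sup>2"
    using sum_squares_bound[of "\<bar>?p\<bar>" "\<bar>?q\<bar>"] by (simp add: power2_sum)
  finally show ?thesis by (simp add: half)
qed

text \<open>\<open>F\<close> is bounded by one norm of the scale, which the m-th norm dominates for
  all large m; so measuring the m-th term in the m-th norm is enough.\<close>

lemma bracket_nrm_convergent:
  fixes F :: "'n::finite tempered"
  assumes "\<And>m. S.nrm m (y m - x) < 1 / real (Suc m)"
  shows "(\<lambda>m. bracket F (y m)) \<longlonglongrightarrow> bracket F x"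
proof -
  obtain k C where C: "0 < C" "\<And>f. \<bar>bracket F f\<bar> \<le> C * S.nrm k f" using bracket_nrm_bound by blast
  have "(\<lambda>m. C * (1 / real (Suc m))) \<longlonglongrightarrow> C * 0"
    using LIMSEQ_inverse_real_of_nat by (intro tendsto_intros) (simp add: inverse_eq_divide)
  then have 0: "(\<lambda>m. C * (1 / real (Suc m))) \<longlonglongrightarrow> 0" by simp
  have "norm (bracket F (y m) - bracket F x) \<le> C * (1 / real (Suc m))" if "k \<le> m" for m
  proof -
    have "norm (bracket F (y m) - bracket F x) \<le> C * S.nrm k (y m - x)"
      using C(2)[of "y m - x"] by (simp add: bracket_diff)
    also have "\<dots> \<le> C * S.nrm m (y m - x)"
      using C(1) S.nrm_mono[OF that] by (intro mult_left_mono) auto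
    also have "\<dots> \<le> C * (1 / real (Suc m))"
      using C(1) assms[of m] by (intro mult_left_mono) auto
    finally show ?thesis .
  qed
  then have "eventually (\<lambda>m. norm (bracket F (y m) - bracket F x) \<le> C * (1 / real (Suc m))) sequentially"
    unfolding eventually_sequentially by blast
  from Lim_null_comparison[OF this 0] show ?thesis by (simp only: LIM_zero_iff)
qed

text \<open>Counterexamples for each index m with radius \<open>1 / Suc m\<close> would form a
  diagonal sequence, which dominated convergence rules out.\<close>

lemma expectation_cos_nrm_continuous:
  fixes P :: "'n::finite tempered measure"
  assumes P: "prob_space P" and sets_P [measurable_cong]: "sets P = sets borel" and e: "0 < e"
  shows "\<exists>m. \<exists>\<delta>>0. \<forall>y. S.nrm m (y - x) < \<delta> \<longrightarrow>
    \<bar>(\<integral>F. cos (bracket F y) \<partial>P) - (\<integral>F. cos (bracket F x) \<partial>P)\<bar> < e"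
proof (rule ccontr)
  interpret prob_space P by (rule P)
  let ?c = "\<lambda>y. \<integral>F. cos (bracket F y) \<partial>P"
  assume "\<not> ?thesis"
  then have "\<exists>y. S.nrm m (y - x) < \<delta> \<and> \<not> \<bar>?c y - ?c x\<bar> < e" if "0 < \<delta>" for m \<delta>
    using that by blast
  then have "\<forall>m. \<exists>y. S.nrm m (y - x) < 1 / real (Suc m) \<and> \<not> \<bar>?c y - ?c x\<bar> < e"
    by simp
  from choice[OF this] obtain y where
    y: "\<forall>m. S.nrm m (y m - x) < 1 / real (Suc m) \<and> \<not> \<bar>?c (y m) - ?c x\<bar> < e" ..
  have "(\<lambda>m. ?c (y m)) \<longlonglongrightarrow> ?c x"
  proof (rule integral_dominated_convergence[where w = "\<lambda>_. 1"])
    show "AE F in P. (\<lambda>m. cos (bracket F (y m))) \<longlonglongrightarrow> cos (bracket F x)"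
      by (intro AE_I2 tendsto_cos bracket_nrm_convergent) (use y in blast)
  qed auto
  from LIMSEQ_D[OF this e] obtain m where "norm (?c (y m) - ?c x) < e" by blast
  then show False using y by simp
qed

text \<open>On \<open>span E\<close> the dual norm of \<open>F\<close> is the Euclidean norm of its
  values on \<open>E\<close>, by Cauchy-Schwarz for the coefficients of \<open>y\<close>.\<close>

lemma parseval_bound:
  assumes E: "S.orthonormal k E" and y: "y \<in> span E" and F: "(\<Sum>e\<in>E. (bracket F e)\<^sup>2) \<le> \<kappa>\<^sup>2" and \<kappa>: "0 \<le> \<kappa>"
  shows "\<bar>bracket F y\<bar> \<le> \<kappa> * S.nrm k y"
proof -
  have "bracket F y = bracket F (S.proj k E y)" using S.proj_span[OF E y] by simp
  also have "\<dots> = (\<Sum>e\<in>E. schwartz_ip k y e * bracket F e)"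
    by (simp only: S.proj_def bracket_sum bracket_scale real_scaleR_def)
  finally have "bracket F y = (\<Sum>e\<in>E. schwartz_ip k y e * bracket F e)" .
  then have "(bracket F y)\<^sup>2 \<le> (\<Sum>e\<in>E. (schwartz_ip k y e)\<^sup>2) * (\<Sum>e\<in>E. (bracket F e)\<^sup>2)"
    using Cauchy_Schwarz_ineq_sum[of "schwartz_ip k y" "bracket F" E] by simp
  also have "\<dots> \<le> (S.nrm k y)\<^sup>2 * \<kappa>\<^sup>2"
    using F S.bessel[OF E, of y] by (intro mult_mono) (auto simp: S.nrm_square sum_nonneg)
  finally have "(bracket F y)\<^sup>2 \<le> (\<kappa> * S.nrm k y)\<^sup>2" by (simp add: power_mult_distrib mult.commute)
  then show ?thesis using \<kappa> by (intro power2_le_imp_le[of "\<bar>bracket F y\<bar>"]) auto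
qed

text \<open>Finite-dimensional estimates pass to the whole space along the increasing spans of the total
  family.\<close>

lemma polar_measure_ge:
  fixes P :: "'n::finite tempered measure"
  assumes P: "prob_space P" and sets_P: "sets P = sets borel" and \<kappa>: "0 \<le> \<kappa>"
    and fin: "\<And>E. S.orthonormal k E \<Longrightarrow> c \<le> measure P {F. (\<Sum>e\<in>E. (bracket F e)\<^sup>2) \<le> \<kappa>\<^sup>2}"
  shows "c \<le> measure P (polar k \<kappa>)"
proof -
  interpret prob_space P by (rule P)
  define V :: "nat \<Rightarrow> 'n schwartz set" where "V r = span (total_family ` {..<r})" for r
  \<comment> \<open>The polar condition on a finite-dimensional span. These sets are closed, hence
    measurable, and decrease with \<open>r\<close>, so \<open>P\<close> is continuous along
    them.\<close>
  define D where "D r = {F :: 'n tempered. \<forall>y\<in>V r. \<bar>bracket F y\<bar> \<le> \<kappa> * S.nrm k y}" for r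
  have D_Inter: "D r = (\<Inter>y\<in>V r. {F. \<bar>bracket F y\<bar> \<le> \<kappa> * S.nrm k y})" for r
    by (auto simp: D_def)
  have closed: "closed (D r)" for r
    unfolding D_Inter by (intro closed_INT ballI closed_bracket_le)
  then have Dm: "D r \<in> events" for r by (simp add: sets_P)
  have lower: "c \<le> measure P (D r)" for r
  proof -
    obtain E :: "'n schwartz set" where E: "S.orthonormal k E" "total_family ` {..<r} \<subseteq> span E"
      using S.gram_schmidt[of "total_family ` {..<r}" k] by auto
    have sub: "V r \<subseteq> span E" unfolding V_def by (rule span_minimal[OF E(2) subspace_span])
    have "{F. (\<Sum>e\<in>E. (bracket F e)\<^sup>2) \<le> \<kappa>\<^sup>2} \<subseteq> D r"
      unfolding D_def using parseval_bound[OF E(1) _ _ \<kappa>] sub by blast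
    then show ?thesis using fin[OF E(1)] finite_measure_mono[OF _ Dm] order_trans by blast
  qed
  have Vmono: "V r \<subseteq> V (Suc r)" for r
    unfolding V_def by (intro span_mono image_mono) auto
  have "decseq D"
    unfolding decseq_Suc_iff D_def using Vmono by blast
  then have lim: "(\<lambda>r. measure P (D r)) \<longlonglongrightarrow> measure P (\<Inter>r. D r)"
    using Dm by (intro finite_Lim_measure_decseq) auto
  have "(\<Inter>r. D r) \<subseteq> polar k \<kappa>"
  proof
    fix F :: "'n tempered" assume F: "F \<in> (\<Inter>r. D r)"
    have sp: "\<bar>bracket F y\<bar> \<le> \<kappa> * S.nrm k y" if y: "y \<in> span (range total_family)" for y :: "'n schwartz"
    proof -
      obtain t c where t: "finite t" "t \<subseteq> range total_family" "y = (\<Sum>a\<in>t. c a *\<^sub>R a)"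
        using y unfolding span_explicit by blast
      obtain I where I: "finite I" "t = total_family ` I"
        using finite_subset_image[OF t(1,2)] by blast
      obtain r where "I \<subseteq> {..<r}" using I(1) finite_nat_iff_bounded by blast
      then have "t \<subseteq> total_family ` {..<r}" using I(2) by blast
      then have "y \<in> V r"
        unfolding V_def t(3) by (intro span_sum span_scale span_base) blast
      moreover have "F \<in> D r" using F by blast
      ultimately show ?thesis unfolding D_def by blast
    qed
    obtain m C where C: "0 < C" "\<And>f. \<bar>bracket F f\<bar> \<le> C * S.nrm m f" using bracket_nrm_bound by blast
    have "\<bar>bracket F f\<bar> \<le> \<kappa> * S.nrm k f" for f
    proof (rule field_le_epsilon)
      fix e :: real assume e: "0 < e"
      \<comment> \<open>Approximation takes place in a norm that dominates both the k-th one and the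
        one bounding \<open>F\<close>. The latter depends on \<open>F\<close>, but its constant
        \<open>C\<close> disappears as \<open>e\<close> tends to 0.\<close>
      define M where "M = max k m"
      obtain y where y: "y \<in> span (range total_family)" "S.nrm M (f - y) < e / (\<kappa> + C)"
        using total_family[of "e / (\<kappa> + C)" M f] e C(1) \<kappa> by auto
      have le: "S.nrm k (f - y) \<le> S.nrm M (f - y)" "S.nrm m (f - y) \<le> S.nrm M (f - y)"
        by (auto simp: M_def intro: S.nrm_mono)
      have "S.nrm k y \<le> S.nrm k f + S.nrm k (f - y)"
        using S.nrm_triangle_diff[of k y 0 f] S.nrm_minus_commute[of k y f] by simp
      then have "\<bar>bracket F y\<bar> \<le> \<kappa> * (S.nrm k f + S.nrm M (f - y))"
        using sp[OF y(1)] \<kappa> le(1) by (intro order_trans[OF sp[OF y(1)]] mult_left_mono) auto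
      moreover have "\<bar>bracket F (f - y)\<bar> \<le> C * S.nrm M (f - y)"
        using C le(2) by (intro order_trans[OF C(2)] mult_left_mono) auto
      moreover have "(\<kappa> + C) * S.nrm M (f - y) \<le> e" using y(2) C(1) \<kappa> by (simp add: field_simps)
      ultimately show "\<bar>bracket F f\<bar> \<le> \<kappa> * S.nrm k f + e"
        by (simp add: bracket_diff algebra_simps)
    qed
    then show "F \<in> polar k \<kappa>" by (simp add: polar_def)
  qed
  then have "measure P (\<Inter>r. D r) \<le> measure P (polar k \<kappa>)"
    by (intro finite_measure_mono) (simp_all add: sets_P closed_polar)
  moreover have "c \<le> measure P (\<Inter>r. D r)"
    using lower by (intro tendsto_lowerbound[OF lim]) auto
  ultimately show ?thesis by simp
qed

text \<open>Equicontinuity bounds the expectation of \<open>1 - cos (bracket F f)\<close> by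
  \<open>\<epsilon> / 8\<close> plus a multiple of a squared norm of \<open>f\<close>, uniformly in
  n. The Gaussian average, with test functions scaled by \<open>\<eta>\<close>, turns this into a
  bound, uniform in \<open>E\<close>, on the mass where the sum of squares of \<open>F\<close> over
  \<open>E\<close> is large.\<close>

lemma tempered_tight:
  fixes P :: "nat \<Rightarrow> 'n::finite tempered measure" and l :: "'n schwartz \<Rightarrow> real"
  assumes P: "\<And>n. prob_space (P n)" and sets_P [measurable_cong]: "\<And>n. sets (P n) = sets borel"
    and lim: "\<And>f. (\<lambda>n. \<integral>F. cos (bracket F f) \<partial>P n) \<longlonglongrightarrow> l f"
    and cont: "(l \<longlongrightarrow> l 0) (at 0)" and \<epsilon>: "0 < \<epsilon>"
  shows "\<exists>k \<kappa>. \<forall>n. 1 - \<epsilon> \<le> measure (P n) (polar k \<kappa>)"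
proof -
  define \<psi> where "\<psi> n f = 1 - (\<integral>F. cos (bracket F f) \<partial>P n)" for n f
  have int: "integrable (P n) (\<lambda>F. cos (c * bracket F f))" for n c f
  proof -
    interpret prob_space "P n" by (rule P)
    show ?thesis by (rule integrable_const_bound[of _ 1]) auto
  qed
  have int1: "integrable (P n) (\<lambda>F. cos (bracket F f))" for n f using int[of n 1 f] by simp
  have one: "(\<integral>F. (c :: real) \<partial>P n) = c" "integrable (P n) (\<lambda>F. c :: real)" for n c
  proof -
    interpret prob_space "P n" by (rule P)
    show "(\<integral>F. (c :: real) \<partial>P n) = c" "integrable (P n) (\<lambda>F. c :: real)" using prob_space by auto
  qed
  note [simp] = prob_space.prob_space[OF P]
  have \<psi>_alt: "\<psi> n f = (\<integral>F. 1 - cos (bracket F f) \<partial>P n)" for n f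
    unfolding \<psi>_def by (simp add: one int1)
  have l0: "l 0 = 1"
  proof -
    have "(\<lambda>n. \<integral>F. cos (bracket F 0) \<partial>P n) = (\<lambda>n. 1)" by (simp add: bracket_zero one)
    then show ?thesis using lim[of 0] LIMSEQ_unique[OF tendsto_const] by metis
  qed
  have "\<exists>m. \<exists>\<delta>>0. \<forall>n x. S.nrm m x < \<delta> \<longrightarrow> \<psi> n x \<le> \<epsilon> / 8"
  proof (rule S.equicontinuity)
    show "\<psi> n (x - y) \<le> 2 * \<psi> n x + 2 * \<psi> n y" for n x y
    proof -
      have "\<psi> n (x - y) \<le> (\<integral>F. 2 * (1 - cos (bracket F x)) + 2 * (1 - cos (bracket F y)) \<partial>P n)"
        unfolding \<psi>_alt bracket_diff
        by (intro integral_mono one_minus_cos_diff_le)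
           (auto intro!: Bochner_Integration.integrable_diff Bochner_Integration.integrable_add
             integrable_mult_right one int1 simp flip: bracket_diff)
      also have "\<dots> = 2 * \<psi> n x + 2 * \<psi> n y"
        unfolding \<psi>_alt by (simp add: one int1)
      finally show ?thesis .
    qed
    show "\<psi> n 0 = 0" for n by (simp add: \<psi>_def bracket_zero one)
    show "\<exists>m. \<exists>\<delta>>0. \<forall>y. S.nrm m (y - x) < \<delta> \<longrightarrow> \<bar>\<psi> n y - \<psi> n x\<bar> < e" if "0 < e" for n x e
      using expectation_cos_nrm_continuous[OF P[of n] sets_P[of n] that, of x] unfolding \<psi>_def
      by (simp add: abs_minus_commute)
    show "(\<lambda>n. \<psi> n x) \<longlonglongrightarrow> 1 - l x" for x
      unfolding \<psi>_def by (intro tendsto_intros lim)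
    show "\<exists>m. \<exists>\<delta>>0. \<forall>y. S.nrm m y < \<delta> \<longrightarrow> 1 - l y < e" if e: "0 < e" for e
    proof -
      have "eventually (\<lambda>x. dist (l x) (l 0) < e) (at 0)" using cont e by (rule tendstoD)
      then obtain U where U: "open U" "0 \<in> U" "\<And>x. x \<in> U \<Longrightarrow> x \<noteq> 0 \<Longrightarrow> dist (l x) (l 0) < e"
        unfolding eventually_at_topological by blast
      obtain m \<delta> where \<delta>: "0 < \<delta>" "\<forall>y. S.nrm m (y - 0) < \<delta> \<longrightarrow> y \<in> U"
        using open_schwartz_imp_nrm_ball[OF U(1,2)] by blast
      have "1 - l y < e" if "S.nrm m y < \<delta>" for y
      \<comment> \<open>The filter \<open>at 0\<close> says nothing about the point itself.\<close>
      proof (cases "y = 0")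
        case False
        then have "dist (l y) (l 0) < e" using U(3) \<delta>(2) that by simp
        then show ?thesis by (simp add: l0 dist_real_def)
      qed (use e l0 in simp)
      then show ?thesis using \<delta>(1) by blast
    qed
  qed (use \<epsilon> in simp)
  then obtain m \<delta> where \<delta>: "0 < \<delta>" and m: "\<And>n x. S.nrm m x < \<delta> \<Longrightarrow> \<psi> n x \<le> \<epsilon> / 8" by blast
  \<comment> \<open>Inside the ball this is equicontinuity; outside it the quadratic term is at
    least 2, the trivial bound for \<open>1 - cos\<close>.\<close>
  have bound: "\<psi> n f \<le> \<epsilon> / 8 + 2 / \<delta>\<^sup>2 * schwartz_ip m f f" for n f
  proof (cases "S.nrm m f < \<delta>")
    case True
    then show ?thesis using m[OF True, of n] \<delta> by (simp add: add_increasing2)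
  next
    case False
    then have "\<delta>\<^sup>2 \<le> (S.nrm m f)\<^sup>2" using \<delta> by (intro power_mono) auto
    then have "2 \<le> 2 / \<delta>\<^sup>2 * schwartz_ip m f f" using \<delta> by (simp add: S.nrm_square field_simps)
    moreover have "\<psi> n f \<le> 2"
    proof -
      have "(\<integral>F. 1 - cos (bracket F f) \<partial>P n) \<le> (\<integral>F. 2 \<partial>P n)"
      proof (intro integral_mono Bochner_Integration.integrable_diff one int1)
        show "1 - cos (bracket F f) \<le> 2" for F
          using cos_ge_minus_one[of "bracket F f"] by linarith
      qed
      then show ?thesis by (simp only: \<psi>_alt one)
    qed
    ultimately show ?thesis using \<epsilon> by linarith
  qed
  obtain k C where HS: "\<And>E. S.orthonormal k E \<Longrightarrow> (\<Sum>e\<in>E. schwartz_ip m e (e :: 'n schwartz)) \<le> C"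
    using S.hilbert_schmidt[of m] unfolding S.orthonormal_def by blast
  define D where "D = \<bar>C\<bar> + 1"
  have D: "0 < D" "C \<le> D" by (auto simp: D_def)
  \<comment> \<open>Chosen so that
    \<open>2 / \<delta>\<^sup>2 * \<eta>\<^sup>2 * D = \<epsilon> / 8\<close>; together with the
    additive \<open>\<epsilon> / 8\<close> the Gaussian average is at most
    \<open>\<epsilon> / 4\<close>.\<close>
  define \<eta> where "\<eta> = sqrt (\<epsilon> * \<delta>\<^sup>2 / (16 * D))"
  have \<eta>: "0 < \<eta>" "\<eta>\<^sup>2 = \<epsilon> * \<delta>\<^sup>2 / (16 * D)" using \<epsilon> \<delta> D by (auto simp: \<eta>_def)
  \<comment> \<open>Now \<open>\<eta>\<^sup>2 * \<kappa>\<^sup>2 = 4\<close>, so the Gaussian factor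
    is at most \<open>exp (-2) \<le> 1 / 2\<close> where the sum of squares exceeds
    \<open>\<kappa>\<^sup>2\<close>. Markov's inequality then costs a factor 2 and leaves mass
    \<open>\<epsilon> / 2\<close>.\<close>
  define \<kappa> where "\<kappa> = 2 / \<eta>"
  have \<kappa>: "0 < \<kappa>" using \<eta>(1) by (simp add: \<kappa>_def)
  have fin: "1 - \<epsilon> \<le> measure (P n) {F. (\<Sum>e\<in>E. (bracket F e)\<^sup>2) \<le> \<kappa>\<^sup>2}" if E: "S.orthonormal k E" for n E
  proof -
    interpret prob_space "P n" by (rule P)
    let ?h = "\<lambda>F. exp (- (\<Sum>e\<in>E. (\<eta> * bracket F e)\<^sup>2) / 2)"
    let ?A = "{F. (\<Sum>e\<in>E. (bracket F e)\<^sup>2) \<le> \<kappa>\<^sup>2}"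
    have spc: "space (P n) = UNIV" using sets_eq_imp_space_eq[OF sets_P[of n]] by simp
    have A: "?A \<in> events"
    proof -
      have "{F \<in> space (P n). (\<Sum>e\<in>E. (bracket F e)\<^sup>2) \<le> \<kappa>\<^sup>2} \<in> events" by measurable
      then show ?thesis by (simp add: spc)
    qed
    \<comment> \<open>Evaluated at the test function \<open>0\<close>, where the cosine is 1 and the
      Gaussian factor alone remains.\<close>
    have "(\<integral>F. 1 - cos (\<eta> * bracket F 0) * ?h F \<partial>P n)
        \<le> \<epsilon> / 8 + (2 / \<delta>\<^sup>2 * \<eta>\<^sup>2) * (schwartz_ip m (0 :: 'n schwartz) 0 + (\<Sum>e\<in>E. schwartz_ip m e e))"
    proof (rule S.gaussian_average[where X = "\<lambda>f F. \<eta> * bracket F f"])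
      show "prob_space (P n)" by (rule P)
      show "(\<lambda>F. \<eta> * bracket F f) \<in> borel_measurable (P n)" for f by measurable
      show "\<eta> * bracket F (f + t *\<^sub>R g) = \<eta> * bracket F f + t * (\<eta> * bracket F g)" for f g t F
        by (simp add: bracket_add bracket_scale algebra_simps)
      show "(\<integral>F. 1 - cos (\<eta> * bracket F f) \<partial>P n) \<le> \<epsilon> / 8 + 2 / \<delta>\<^sup>2 * \<eta>\<^sup>2 * schwartz_ip m f f" for f
      proof -
        have "schwartz_ip m (\<eta> *\<^sub>R f) (\<eta> *\<^sub>R f) = \<eta>\<^sup>2 * schwartz_ip m f f"
          by (simp add: S.ip_simps power2_eq_square)
        then show ?thesis using bound[of n "\<eta> *\<^sub>R f"] by (simp add: \<psi>_alt bracket_scale mult.assoc)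
      qed
      show "finite E" using E by (simp add: S.orthonormal_def)
    qed
    also have "\<dots> \<le> \<epsilon> / 8 + (2 / \<delta>\<^sup>2 * \<eta>\<^sup>2) * D"
      using HS[OF E] D(2) by (intro add_left_mono mult_left_mono) auto
    also have "\<dots> = \<epsilon> / 4" using \<delta> D(1) by (simp add: \<eta>(2))
    finally have upper: "(\<integral>F. 1 - ?h F \<partial>P n) \<le> \<epsilon> / 4" by (simp add: bracket_zero)
    have h: "0 \<le> ?h F" "?h F \<le> 1" for F by (auto simp: sum_nonneg)
    have "(\<integral>F. 1 / 2 * indicator (- ?A) F \<partial>P n) \<le> (\<integral>F. 1 - ?h F \<partial>P n)"
    proof (rule integral_mono)
      show "integrable (P n) (\<lambda>F. 1 / 2 * indicator (- ?A) F :: real)"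
        using A spc sets.compl_sets[OF A]
        by (intro integrable_mult_right integrable_real_indicator) (auto simp: less_top[symmetric] Compl_eq_Diff_UNIV)
      show "integrable (P n) (\<lambda>F. 1 - ?h F)"
        using h by (intro Bochner_Integration.integrable_diff one integrable_const_bound[of _ 1]) auto
      fix F
      show "1 / 2 * indicator (- ?A) F \<le> 1 - ?h F"
      proof (cases "F \<in> ?A")
        case False
        then have "\<kappa>\<^sup>2 \<le> (\<Sum>e\<in>E. (bracket F e)\<^sup>2)" by simp
        then have "\<eta>\<^sup>2 * \<kappa>\<^sup>2 \<le> (\<Sum>e\<in>E. (\<eta> * bracket F e)\<^sup>2)"
          by (simp add: power_mult_distrib sum_distrib_left[symmetric] mult_left_mono)
        moreover have "\<eta>\<^sup>2 * \<kappa>\<^sup>2 = 4" using \<eta>(1) by (simp add: \<kappa>_def power_divide)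
        ultimately have "?h F \<le> exp (-2)" by simp
        also have "exp (-2) \<le> (1 / 2 :: real)"
          using exp_ge_add_one_self[of "2 :: real"] by (simp add: exp_minus field_simps)
        finally show ?thesis using False by simp
      qed (use h in auto)
    qed
    also have "(\<integral>F. 1 / 2 * indicator (- ?A) F \<partial>P n) = 1 / 2 * measure (P n) (- ?A)"
      using spc by simp
    finally have "measure (P n) (- ?A) \<le> \<epsilon> / 2" using upper by simp
    then show ?thesis using prob_compl[OF A] \<epsilon> by (simp add: spc Compl_eq_Diff_UNIV)
  qed
  have "1 - \<epsilon> \<le> measure (P n) (polar k \<kappa>)" for n
    using \<kappa> by (intro polar_measure_ge P sets_P fin) auto
  then show ?thesis by blast
qed

section \<open>Trigonometric polynomials and convergence\<close>

text \<open>Defined as a linear span without a rule for products, so that convergence of integrals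
  follows from the generators by linearity. That it is an algebra comes from the product-to-sum
  formulas.\<close>

inductive trig :: "('n::finite tempered \<Rightarrow> real) \<Rightarrow> bool" where
  trig_cos: "trig (\<lambda>F. cos (bracket F f))"
| trig_sin: "trig (\<lambda>F. sin (bracket F f))"
| trig_add: "trig g \<Longrightarrow> trig h \<Longrightarrow> trig (\<lambda>F. g F + h F)"
| trig_scale: "trig g \<Longrightarrow> trig (\<lambda>F. c * g F)"

lemma trig_const: "trig (\<lambda>_. c)"
  using trig_scale[OF trig_cos[of 0], of c] by (simp add: bracket_zero)

lemma trig_cos_sin_mult:
  assumes "trig h"
  shows "trig (\<lambda>F. cos (bracket F f) * h F)" "trig (\<lambda>F. sin (bracket F f) * h F)"
  using assms
proof (induction)
  case (trig_cos g)
  { case 1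
    have "(\<lambda>F. cos (bracket F f) * cos (bracket F g)) =
        (\<lambda>F. 1/2 * cos (bracket F (f - g)) + 1/2 * cos (bracket F (f + g)))"
      by (simp add: bracket_diff bracket_add cos_times_cos add_divide_distrib)
    then show ?case by (simp only: trig.intros)
  next
    case 2
    have "(\<lambda>F. sin (bracket F f) * cos (bracket F g)) =
        (\<lambda>F. 1/2 * sin (bracket F (f + g)) + 1/2 * sin (bracket F (f - g)))"
      by (simp add: bracket_diff bracket_add sin_times_cos add_divide_distrib)
    then show ?case by (simp only: trig.intros)
  }
next
  case (trig_sin g)
  { case 1
    have "(\<lambda>F. cos (bracket F f) * sin (bracket F g)) =
        (\<lambda>F. 1/2 * sin (bracket F (f + g)) + (-1/2) * sin (bracket F (f - g)))"
      by (simp add: bracket_diff bracket_add cos_times_sin diff_divide_distrib)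
    then show ?case by (simp only: trig.intros)
  next
    case 2
    have "(\<lambda>F. sin (bracket F f) * sin (bracket F g)) =
        (\<lambda>F. 1/2 * cos (bracket F (f - g)) + (-1/2) * cos (bracket F (f + g)))"
      by (simp add: bracket_diff bracket_add sin_times_sin diff_divide_distrib)
    then show ?case by (simp only: trig.intros)
  }
next
  case (trig_add g h)
  { case 1 show ?case using trig.trig_add[OF trig_add.IH(1,3)] by (simp add: distrib_left)
  next
    case 2 show ?case using trig.trig_add[OF trig_add.IH(2,4)] by (simp add: distrib_left) }
next
  case (trig_scale g c)
  { case 1 show ?case using trig.trig_scale[OF trig_scale.IH(1), of c] by (simp add: mult.left_commute)
  next
    case 2 show ?case using trig.trig_scale[OF trig_scale.IH(2), of c] by (simp add: mult.left_commute) }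
qed

lemma trig_mult: "trig g \<Longrightarrow> trig h \<Longrightarrow> trig (\<lambda>F. g F * h F)"
proof (induction rule: trig.induct)
  case (trig_add g g')
  then show ?case using trig.trig_add[OF trig_add.IH(1,2)] by (simp add: distrib_right)
next
  case (trig_scale g c)
  then show ?case using trig.trig_scale[OF trig_scale.IH, of c] by (simp add: mult.assoc)
qed (auto intro: trig_cos_sin_mult)

lemma trig_continuous: "trig h \<Longrightarrow> continuous_on UNIV h"
proof (induction rule: trig.induct)
  case (trig_cos f)
  show ?case
    by (rule continuous_on_compose2[OF continuous_on_cos[OF continuous_on_id] continuous_on_bracket subset_UNIV])
next
  case (trig_sin f)
  show ?case
    by (rule continuous_on_compose2[OF continuous_on_sin[OF continuous_on_id] continuous_on_bracket subset_UNIV])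
qed (auto intro: continuous_on_add continuous_on_mult_left)

lemma trig_bounded: "trig h \<Longrightarrow> \<exists>B. \<forall>F. \<bar>h F\<bar> \<le> B"
proof (induction rule: trig.induct)
  case (trig_add g h)
  then obtain A B where "\<And>F. \<bar>g F\<bar> \<le> A" "\<And>F. \<bar>h F\<bar> \<le> B" by blast
  then have "\<bar>g F + h F\<bar> \<le> A + B" for F by (meson abs_triangle_ineq add_mono order_trans)
  then show ?case by blast
next
  case (trig_scale g c)
  then obtain A where "\<And>F. \<bar>g F\<bar> \<le> A" by blast
  then have "\<bar>c * g F\<bar> \<le> \<bar>c\<bar> * A" for F unfolding abs_mult by (intro mult_left_mono) auto
  then show ?case by blast
qed (auto intro: exI[of _ "1 :: real"])

text \<open>Serves to compose a trigonometric polynomial with a polynomial close to a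
  truncation.\<close>

lemma trig_polynomial:
  assumes p: "real_polynomial_function p" and h: "trig h"
  shows "trig (\<lambda>F. p (h F :: real))"
  using p
proof (induction rule: real_polynomial_function.induct)
  case (linear p)
  then have "p t = p 1 * t" for t
    using linear_scale[OF bounded_linear.linear[OF linear], of t 1] by simp
  then have "(\<lambda>F. p (h F)) = (\<lambda>F. p 1 * h F)" by blast
  then show ?case using trig_scale[OF h, of "p 1"] by simp
qed (auto intro: trig_const trig_add trig_mult)

lemma trig_integral_convergence:
  fixes P :: "nat \<Rightarrow> 'n::finite tempered measure"
  assumes h: "trig h"
    and P: "\<And>n. prob_space (P n)" "\<And>n. sets (P n) = sets borel"
    and N: "prob_space N" "sets N = sets borel"
    and cos: "\<And>f. (\<lambda>n. \<integral>F. cos (bracket F f) \<partial>P n) \<longlonglongrightarrow> (\<integral>F. cos (bracket F f) \<partial>N)"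
    and sin: "\<And>f. (\<lambda>n. \<integral>F. sin (bracket F f) \<partial>P n) \<longlonglongrightarrow> (\<integral>F. sin (bracket F f) \<partial>N)"
  shows "(\<lambda>n. \<integral>F. h F \<partial>P n) \<longlonglongrightarrow> (\<integral>F. h F \<partial>N)"
proof -
  have int: "integrable Q g" if g: "trig g" "prob_space Q" "sets Q = sets borel" for g and Q :: "'n tempered measure"
  proof -
    interpret prob_space Q by fact
    obtain B where "\<And>F. \<bar>g F\<bar> \<le> B" using trig_bounded[OF g(1)] by blast
    moreover have "g \<in> borel_measurable Q"
      using borel_measurable_continuous_onI[OF trig_continuous[OF g(1)]]
      by (simp add: measurable_cong_sets[OF g(3) refl])
    ultimately show ?thesis by (intro integrable_const_bound[of _ B]) auto
  qed
  show ?thesis using h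
  proof (induction rule: trig.induct)
    case (trig_add g h)
    then show ?case using tendsto_add[OF trig_add.IH] int P N by simp
  next
    case (trig_scale g c)
    then show ?case using tendsto_mult_left[OF trig_scale.IH, of c] by simp
  qed (fact cos, fact sin)
qed

text \<open>Stone-Weierstrass on the compact coordinate image, followed by truncation. The function
  \<open>h\<close> depends on the polar, but its global bound does not; so the polar can be chosen
  from the bound before \<open>h\<close> is known.\<close>

lemma trig_dense_on_polar:
  fixes \<phi> :: "'n::finite tempered \<Rightarrow> real"
  assumes \<phi>: "continuous_on UNIV \<phi>" and B: "\<And>F. \<bar>\<phi> F\<bar> \<le> B" and e: "0 < e"
  shows "\<exists>h. trig h \<and> (\<forall>F\<in>polar m \<kappa>. \<bar>\<phi> F - h F\<bar> \<le> e) \<and> (\<forall>F. \<bar>h F\<bar> \<le> B + e)"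
proof -
  let ?C = "coords ` (polar m \<kappa> :: 'n tempered set)"
  let ?S = "inv coords :: (nat \<Rightarrow> real) \<Rightarrow> 'n tempered"
  define R where "R = {\<lambda>x. h (?S x) | h. trig h}"
  have cont: "continuous_on ?C (\<lambda>x. g (?S x))" if "continuous_on UNIV g" for g :: "'n tempered \<Rightarrow> real"
    by (rule continuous_on_compose2[OF that continuous_on_inv_coords]) simp
  interpret R: function_ring_on R ?C
  proof
    show "compact ?C" by (rule compact_coords_polar)
    show "continuous_on ?C f" if "f \<in> R" for f
      using that cont[OF trig_continuous] by (auto simp: R_def)
    show "(\<lambda>x. f x + g x) \<in> R" if "f \<in> R" "g \<in> R" for f g
    proof -
      obtain f' g' where "f = (\<lambda>x. f' (?S x))" "trig f'" "g = (\<lambda>x. g' (?S x))" "trig g'"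
        using \<open>f \<in> R\<close> \<open>g \<in> R\<close> by (auto simp: R_def)
      then show ?thesis unfolding R_def by (intro CollectI exI[of _ "\<lambda>F. f' F + g' F"]) (auto intro: trig_add)
    qed
    show "(\<lambda>x. f x * g x) \<in> R" if "f \<in> R" "g \<in> R" for f g
    proof -
      obtain f' g' where "f = (\<lambda>x. f' (?S x))" "trig f'" "g = (\<lambda>x. g' (?S x))" "trig g'"
        using \<open>f \<in> R\<close> \<open>g \<in> R\<close> by (auto simp: R_def)
      then show ?thesis unfolding R_def by (intro CollectI exI[of _ "\<lambda>F. f' F * g' F"]) (auto intro: trig_mult)
    qed
    show "(\<lambda>_. c) \<in> R" for c
      unfolding R_def by (intro CollectI exI[of _ "\<lambda>_. c"]) (auto intro: trig_const)
    fix x y assume xy: "x \<in> ?C" "y \<in> ?C" "x \<noteq> y"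
    obtain F G :: "'n tempered" where FG: "x = coords F" "y = coords G" using xy by blast
    obtain i where i: "coords F i \<noteq> coords G i" using xy(3) FG by (auto simp: fun_eq_iff)
    \<comment> \<open>Brings both values into \<open>[-1, 1]\<close>, inside
      \<open>[- pi / 2, pi / 2]\<close>, where the sine is injective and hence separates the two
      points.\<close>
    define t where "t = 1 / (\<bar>coords F i\<bar> + \<bar>coords G i\<bar> + 1)"
    have t: "0 < t" by (simp add: t_def add_nonneg_pos)
    have "\<bar>t * coords F i\<bar> \<le> 1" "\<bar>t * coords G i\<bar> \<le> 1"
      by (simp_all add: t_def abs_mult)
    then have "- (pi / 2) \<le> t * coords F i" "t * coords F i \<le> pi / 2"
        "- (pi / 2) \<le> t * coords G i" "t * coords G i \<le> pi / 2"
      using pi_ge_two by (auto simp: abs_le_iff)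
    then have "sin (t * coords F i) \<noteq> sin (t * coords G i)"
      using sin_inj_pi[of "t * coords F i" "t * coords G i"] i t by auto
    then have "sin (bracket F (t *\<^sub>R total_family i)) \<noteq> sin (bracket G (t *\<^sub>R total_family i))"
      by (simp add: bracket_scale coords_def)
    then show "\<exists>f\<in>R. f x \<noteq> f y"
      unfolding R_def FG
      by (intro bexI[of _ "\<lambda>x. sin (bracket (?S x) (t *\<^sub>R total_family i))"])
         (auto simp: inv_coords intro: trig_sin)
  qed
  obtain g where g: "g \<in> R" "\<And>x. x \<in> ?C \<Longrightarrow> \<bar>\<phi> (?S x) - g x\<bar> < e / 2"
    using R.Stone_Weierstrass_basic[OF cont[OF \<phi>], of "e / 2"] e by auto
  obtain h where h: "trig h" "g = (\<lambda>x. h (?S x))" using g(1) by (auto simp: R_def)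
  have close: "\<bar>\<phi> F - h F\<bar> < e / 2" if "F \<in> polar m \<kappa>" for F
    using g(2)[of "coords F"] that by (simp add: h(2) inv_coords)
  obtain H where H: "\<And>F. \<bar>h F\<bar> \<le> H" using trig_bounded[OF h(1)] by blast
  \<comment> \<open>Truncation to an interval that contains all values of \<open>\<phi>\<close>; it
    moves \<open>h F\<close> no farther away from \<open>\<phi> F\<close>.\<close>
  define clip where "clip t = max (- B) (min B t)" for t :: real
  have B0: "0 \<le> B" by (rule order_trans[OF abs_ge_zero B])
  \<comment> \<open>All values of \<open>h\<close>, off the polar too, lie in this compact interval,
    so a uniform polynomial approximation of \<open>clip\<close> on it controls
    \<open>p (h F)\<close> everywhere.\<close>
  have "continuous_on {-H..H} clip" unfolding clip_def by (intro continuous_intros)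
  then obtain p where p: "real_polynomial_function p" "\<And>t. t \<in> {-H..H} \<Longrightarrow> \<bar>clip t - p t\<bar> < e / 2"
    using Stone_Weierstrass_real_polynomial_function[of "{-H..H}" clip "e / 2"] e by auto
  have ph: "\<bar>clip (h F) - p (h F)\<bar> < e / 2" for F
    using p(2)[of "h F"] H[of F] by (auto simp: abs_le_iff)
  show ?thesis
  proof (intro exI[of _ "\<lambda>F. p (h F)"] conjI ballI allI)
    show "trig (\<lambda>F. p (h F))" by (rule trig_polynomial[OF p(1) h(1)])
    show "\<bar>p (h F)\<bar> \<le> B + e" for F
    proof -
      have "\<bar>clip (h F)\<bar> \<le> B" using B0 by (auto simp: clip_def)
      then show ?thesis using ph[of F] e by linarith
    qed
    fix F :: "'n tempered" assume "F \<in> polar m \<kappa>"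
    then have "\<bar>\<phi> F - h F\<bar> < e / 2" by (rule close)
    moreover have "\<bar>\<phi> F - clip (h F)\<bar> \<le> \<bar>\<phi> F - h F\<bar>"
      using B[of F] unfolding clip_def by linarith
    ultimately show "\<bar>\<phi> F - p (h F)\<bar> \<le> e" using ph[of F] by linarith
  qed
qed

lemma trig_convergence_imp_weak_convergence:
  fixes P :: "nat \<Rightarrow> 'n::finite tempered measure" and \<phi> :: "'n tempered \<Rightarrow> real"
  assumes P: "\<And>n. prob_space (P n)" and sets_P [measurable_cong]: "\<And>n. sets (P n) = sets borel"
    and N: "prob_space N" and sets_N [measurable_cong]: "sets N = sets borel"
    and cos: "\<And>f. (\<lambda>n. \<integral>F. cos (bracket F f) \<partial>P n) \<longlonglongrightarrow> (\<integral>F. cos (bracket F f) \<partial>N)"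
    and sin: "\<And>f. (\<lambda>n. \<integral>F. sin (bracket F f) \<partial>P n) \<longlonglongrightarrow> (\<integral>F. sin (bracket F f) \<partial>N)"
    and tight: "\<And>\<epsilon>. 0 < \<epsilon> \<Longrightarrow> \<exists>k \<kappa>. (\<forall>n. 1 - \<epsilon> \<le> measure (P n) (polar k \<kappa>)) \<and> 1 - \<epsilon> \<le> measure N (polar k \<kappa>)"
    and \<phi>: "continuous_on UNIV \<phi>" and B: "\<And>F. \<bar>\<phi> F\<bar> \<le> B"
  shows "(\<lambda>n. \<integral>F. \<phi> F \<partial>P n) \<longlonglongrightarrow> (\<integral>F. \<phi> F \<partial>N)"
proof (rule LIMSEQ_I)
  fix r :: real assume r: "0 < r"
  have B0: "0 \<le> B" by (rule order_trans[OF abs_ge_zero B])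
  \<comment> \<open>\<open>e \<le> 1\<close> gives \<open>B + (B + e) \<le> 2 * B + 1\<close>, so
    replacing \<open>\<phi>\<close> by \<open>h\<close> costs at most \<open>r / 8 + r / 8\<close>,
    once under \<open>P n\<close> and once under \<open>N\<close>.\<close>
  define e where "e = min 1 (r / 8)"
  define \<epsilon> where "\<epsilon> = r / (8 * (2 * B + 1))"
  have e: "0 < e" "e \<le> 1" "e \<le> r / 8" using r by (auto simp: e_def)
  have \<epsilon>: "0 < \<epsilon>" using r B0 by (simp add: \<epsilon>_def add_nonneg_pos)
  obtain k \<kappa> where k: "\<And>n. 1 - \<epsilon> \<le> measure (P n) (polar k \<kappa>)" "1 - \<epsilon> \<le> measure N (polar k \<kappa>)"
    using tight[OF \<epsilon>] by blast
  obtain h where h: "trig h" "\<And>F. F \<in> polar k \<kappa> \<Longrightarrow> \<bar>\<phi> F - h F\<bar> \<le> e" "\<And>F. \<bar>h F\<bar> \<le> B + e"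
    using trig_dense_on_polar[OF \<phi> B e(1), of k \<kappa>] by blast
  have [measurable]: "\<phi> \<in> borel_measurable borel" "h \<in> borel_measurable borel"
    using \<phi> trig_continuous[OF h(1)] by (auto intro: borel_measurable_continuous_onI)
  have [measurable]: "(polar k \<kappa> :: 'n tempered set) \<in> sets borel"
    by (rule borel_closed[OF closed_polar])
  have small: "e + (B + (B + e)) * \<epsilon> \<le> r / 4"
  proof -
    have "(B + (B + e)) * \<epsilon> \<le> (2 * B + 1) * \<epsilon>" using e \<epsilon> by (intro mult_right_mono) auto
    also have "\<dots> = r / 8" using B0 by (simp add: \<epsilon>_def field_simps)
    finally show ?thesis using e by simp
  qed
  have 1: "\<bar>(\<integral>F. \<phi> F \<partial>P n) - (\<integral>F. h F \<partial>P n)\<bar> \<le> r / 4" for n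
    by (rule order_trans[OF integral_diff_le_outside[OF P _ _ B h(3) _ h(2) k(1)] small])
       (use e in \<open>auto simp: sets_P\<close>)
  have 2: "\<bar>(\<integral>F. \<phi> F \<partial>N) - (\<integral>F. h F \<partial>N)\<bar> \<le> r / 4"
    by (rule order_trans[OF integral_diff_le_outside[OF N _ _ B h(3) _ h(2) k(2)] small])
       (use e in \<open>auto simp: sets_N\<close>)
  have "(\<lambda>n. \<integral>F. h F \<partial>P n) \<longlonglongrightarrow> (\<integral>F. h F \<partial>N)"
    by (rule trig_integral_convergence[OF h(1) P sets_P N sets_N cos sin])
  from LIMSEQ_D[OF this, of "r / 4"] r obtain n0 where
    n0: "\<And>n. n0 \<le> n \<Longrightarrow> norm ((\<integral>F. h F \<partial>P n) - (\<integral>F. h F \<partial>N)) < r / 4" by auto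
  have "norm ((\<integral>F. \<phi> F \<partial>P n) - (\<integral>F. \<phi> F \<partial>N)) < r" if "n0 \<le> n" for n
    using 1[of n] 2 n0[OF that] r unfolding real_norm_def by linarith
  then show "\<exists>n0. \<forall>n\<ge>n0. norm ((\<integral>F. \<phi> F \<partial>P n) - (\<integral>F. \<phi> F \<partial>N)) < r" by blast
qed

text \<open>\<open>coords\<close> carries the laws to sequences, where the limit is extracted, and
  the Borel inverse \<open>J\<close> brings it back. Each \<open>P n\<close> is carried by the union
  of the polars, so the default value of \<open>J\<close> elsewhere does no harm.\<close>

lemma tempered_prokhorov:
  fixes P :: "nat \<Rightarrow> 'n::finite tempered measure"
  assumes P: "\<And>n. prob_space (P n)" and sets_P [measurable_cong]: "\<And>n. sets (P n) = sets borel"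
    and tight: "\<And>i n. 1 - \<epsilon> i \<le> measure (P n) (polar (k i) (\<kappa> i))" and \<epsilon>: "\<epsilon> \<longlonglongrightarrow> 0"
  shows "\<exists>s N. strict_mono s \<and> prob_space N \<and> sets N = sets borel \<and>
    (\<forall>i. 1 - \<epsilon> i \<le> measure N (polar (k i) (\<kappa> i))) \<and>
    (\<forall>(\<phi> :: 'n tempered \<Rightarrow> real) B. continuous_on UNIV \<phi> \<longrightarrow> (\<forall>F. \<bar>\<phi> F\<bar> \<le> B) \<longrightarrow>
      (\<lambda>n. \<integral>F. \<phi> F \<partial>P (s n)) \<longlonglongrightarrow> (\<integral>F. \<phi> F \<partial>N))"
proof -
  define K where "K i = (polar (k i) (\<kappa> i) :: 'n tempered set)" for i
  define C where "C i = coords ` K i" for i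
  have Cc: "compact (C i)" for i unfolding C_def K_def by (rule compact_coords_polar)
  have Km [measurable]: "K i \<in> sets borel" for i unfolding K_def by (rule borel_closed[OF closed_polar])
  have Cm [measurable]: "C i \<in> sets borel" for i using Cc by (simp add: compact_imp_closed)
  define J where "J x = (if x \<in> (\<Union>i. C i) then inv coords x else (0 :: 'n tempered))" for x
  have J [measurable]: "J \<in> borel_measurable borel"
    unfolding J_def[abs_def] using Cc
    by (intro borel_measurable_closed_union) (auto simp: C_def K_def compact_imp_closed continuous_on_inv_coords)
  have JC: "J (coords F) = F" if "F \<in> K i" for F i
    using that by (auto simp: J_def C_def inv_coords)
  define Q where "Q n = distr (P n) borel coords" for n
  have cm: "coords \<in> borel_measurable (P n)" for n by measurable
  have spc: "space (P n) = UNIV" for n using sets_eq_imp_space_eq[OF sets_P[of n]] by simp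
  have Q: "prob_space (Q n)" for n
    unfolding Q_def by (rule prob_space.prob_space_distr[OF P cm])
  have QC: "1 - \<epsilon> i \<le> measure (Q n) (C i)" for i n
  proof -
    interpret prob_space "P n" by (rule P)
    have "measure (P n) (K i) \<le> measure (P n) (coords -` C i \<inter> space (P n))"
      by (intro finite_measure_mono measurable_sets[OF cm Cm]) (auto simp: C_def spc)
    then show ?thesis using tight[of i n] by (simp add: Q_def measure_distr cm K_def)
  qed
  have setsQ: "sets (Q n) = sets borel" for n by (simp add: Q_def)
  obtain s Q' where s: "strict_mono s" and Q': "prob_space Q'" "sets Q' = sets borel"
    "\<And>i. 1 - \<epsilon> i \<le> measure Q' (C i)" and
    conv: "\<And>(\<phi> :: _ \<Rightarrow> real) B. \<phi> \<in> borel_measurable borel \<Longrightarrow> (\<And>i. continuous_on (C i) \<phi>) \<Longrightarrow>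
      (\<And>x. \<bar>\<phi> x\<bar> \<le> B) \<Longrightarrow> (\<lambda>n. \<integral>x. \<phi> x \<partial>Q (s n)) \<longlonglongrightarrow> (\<integral>x. \<phi> x \<partial>Q')"
    using prokhorov_sequences[of Q C \<epsilon>, OF Q setsQ Cc QC \<epsilon>] by metis
  interpret Q': prob_space Q' by (rule Q'(1))
  have Jm: "J \<in> borel_measurable Q'" using J by (simp add: measurable_cong_sets[OF Q'(2) refl])
  define N where "N = distr Q' borel J"
  have N: "prob_space N" unfolding N_def by (rule Q'.prob_space_distr[OF Jm])
  have NK: "1 - \<epsilon> i \<le> measure N (K i)" for i
  proof -
    have "measure Q' (C i) \<le> measure Q' (J -` K i \<inter> space Q')"
    proof (intro Q'.finite_measure_mono measurable_sets[OF Jm Km])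
      have "space Q' = UNIV" using sets_eq_imp_space_eq[OF Q'(2)] by simp
      then show "C i \<subseteq> J -` K i \<inter> space Q'" using JC by (auto simp: C_def)
    qed
    then show ?thesis using Q'(3)[of i] by (simp add: N_def measure_distr Jm)
  qed
  have "(\<lambda>n. \<integral>F. \<phi> F \<partial>P (s n)) \<longlonglongrightarrow> (\<integral>F. \<phi> F \<partial>N)"
    if \<phi>: "continuous_on UNIV \<phi>" and B: "\<And>F. \<bar>\<phi> F\<bar> \<le> B" for \<phi> :: "'n tempered \<Rightarrow> real" and B
  proof -
    have [measurable]: "\<phi> \<in> borel_measurable borel" by (rule borel_measurable_continuous_onI[OF \<phi>])
    have "(\<lambda>n. \<integral>x. \<phi> (J x) \<partial>Q (s n)) \<longlonglongrightarrow> (\<integral>x. \<phi> (J x) \<partial>Q')"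
    proof (rule conv)
      show "(\<lambda>x. \<phi> (J x)) \<in> borel_measurable borel" by measurable
      show "continuous_on (C i) (\<lambda>x. \<phi> (J x))" for i
      proof -
        have "continuous_on (C i) (inv coords :: _ \<Rightarrow> 'n tempered)"
          unfolding C_def K_def by (rule continuous_on_inv_coords)
        then have "continuous_on (C i) J"
          by (subst continuous_on_cong[OF refl, of _ _ "inv coords"]) (auto simp: J_def)
        then show ?thesis by (intro continuous_on_compose2[OF \<phi>]) auto
      qed
    qed (rule B)
    moreover have "(\<integral>x. \<phi> (J x) \<partial>Q n) = (\<integral>F. \<phi> F \<partial>P n)" for n
    proof -
      interpret prob_space "P n" by (rule P)
      have "AE F in P n. F \<in> (\<Union>i. K i)"
      proof (rule AE_prob_1[OF antisym])
        have "1 - \<epsilon> i \<le> measure (P n) (\<Union>i. K i)" for i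
        proof -
          have "measure (P n) (K i) \<le> measure (P n) (\<Union>i. K i)"
            by (intro finite_measure_mono sets.countable_UN) (auto simp: sets_P)
          then show ?thesis using tight[of i n] by (simp add: K_def)
        qed
        moreover have "(\<lambda>i. 1 - \<epsilon> i) \<longlonglongrightarrow> 1 - 0" by (intro tendsto_intros \<epsilon>)
        ultimately have "1 - 0 \<le> measure (P n) (\<Union>i. K i)"
          by (intro tendsto_upperbound[of _ _ sequentially]) auto
        then show "1 \<le> measure (P n) (\<Union>i. K i)" by simp
      qed (rule prob_le_1)
      then have "AE F in P n. \<phi> (J (coords F)) = \<phi> F"
        by (rule AE_mp) (auto simp: JC)
      then have "(\<integral>F. \<phi> (J (coords F)) \<partial>P n) = (\<integral>F. \<phi> F \<partial>P n)"
        by (intro integral_cong_AE) auto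
      then show ?thesis unfolding Q_def by (subst integral_distr[OF cm]) auto
    qed
    moreover have "(\<integral>x. \<phi> (J x) \<partial>Q') = (\<integral>F. \<phi> F \<partial>N)"
      unfolding N_def by (rule integral_distr[OF Jm, symmetric]) measurable
    ultimately show ?thesis by simp
  qed
  moreover have "sets N = sets borel" by (simp add: N_def)
  ultimately show ?thesis using s N NK unfolding K_def by blast
qed

lemma law_prob_space:
  assumes "generalized_random_field M X"
  shows "prob_space (law M X)" "sets (law M X) = sets borel"
  using assms by (auto simp: generalized_random_field_def law_def intro: prob_space.prob_space_distr)

text \<open>Splits into real integrals, since compactness and density are used for real
  functions.\<close>

lemma char_functional_law:
  fixes X :: "'w \<Rightarrow> 'n::finite tempered"
  assumes "generalized_random_field M X"
  shows "char_functional M X f =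
    Complex (\<integral>F. cos (bracket F f) \<partial>law M X) (\<integral>F. sin (bracket F f) \<partial>law M X)"
proof -
  interpret prob_space "law M X" by (rule law_prob_space[OF assms])
  have X: "X \<in> measurable M borel" using assms by (simp add: generalized_random_field_def)
  have m: "(\<lambda>F. exp (\<i> * complex_of_real (bracket F f))) \<in> borel_measurable borel" by measurable
  have m': "(\<lambda>F. exp (\<i> * complex_of_real (bracket F f))) \<in> borel_measurable (law M X)"
    using m by (simp add: law_def)
  have eq: "char_functional M X f = (\<integral>F. exp (\<i> * complex_of_real (bracket F f)) \<partial>law M X)"
    unfolding char_functional_def law_def by (rule integral_distr[OF X m, symmetric])
  have int: "integrable (law M X) (\<lambda>F. exp (\<i> * complex_of_real (bracket F f)))"
    by (rule integrable_const_bound[of _ 1, OF _ m']) simp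
  have "Re (char_functional M X f) = (\<integral>F. cos (bracket F f) \<partial>law M X)"
    unfolding eq integral_Re[OF int, symmetric] by (simp add: Re_exp)
  moreover have "Im (char_functional M X f) = (\<integral>F. sin (bracket F f) \<partial>law M X)"
    unfolding eq integral_Im[OF int, symmetric] by (simp add: Im_exp)
  ultimately show ?thesis by (simp add: complex_eq_iff)
qed

theorem theorem2p3:
  fixes M :: "nat \<Rightarrow> 'w measure"
    and X :: "nat \<Rightarrow> 'w \<Rightarrow> 'n::finite tempered"
    and L :: "'n schwartz \<Rightarrow> complex"
  assumes "\<And>n. n \<ge> 1 \<Longrightarrow> generalized_random_field (M n) (X n)"
    and "\<And>f. (\<lambda>n. char_functional (M n) (X n) f) \<longlonglongrightarrow> L f"
    and "(L \<longlongrightarrow> L 0) (at 0)"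
  shows "\<exists>(N :: 'n tempered measure) (Y :: 'n tempered \<Rightarrow> 'n tempered).
    generalized_random_field N Y \<and>
    char_functional N Y = L \<and>
    converges_in_distribution M X N Y"
proof -
  \<comment> \<open>The fields are given from \<open>n = 1\<close> on, so the sequence is shifted;
    \<open>LIMSEQ_imp_Suc\<close> undoes the shift at the end.\<close>
  define P where "P n = law (M (Suc n)) (X (Suc n))" for n
  have rf: "generalized_random_field (M (Suc n)) (X (Suc n))" for n using assms(1) by simp
  have P: "prob_space (P n)" "sets (P n) = sets borel" for n
    unfolding P_def by (rule law_prob_space[OF rf])+
  have "(\<lambda>n. char_functional (M (Suc n)) (X (Suc n)) f) \<longlonglongrightarrow> L f" for f
    by (rule LIMSEQ_Suc[OF assms(2)])
  from tendsto_Re[OF this] tendsto_Im[OF this]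
  have cos: "(\<lambda>n. \<integral>F. cos (bracket F f) \<partial>P n) \<longlonglongrightarrow> Re (L f)"
    and sin: "(\<lambda>n. \<integral>F. sin (bracket F f) \<partial>P n) \<longlonglongrightarrow> Im (L f)" for f
    by (simp_all add: char_functional_law[OF rf] P_def)
  have cont: "((\<lambda>f. Re (L f)) \<longlongrightarrow> Re (L 0)) (at 0)" by (rule tendsto_Re[OF assms(3)])
  define \<epsilon> where "\<epsilon> i = 1 / real (Suc i)" for i
  have \<epsilon>: "\<epsilon> \<longlonglongrightarrow> 0" unfolding \<epsilon>_def using LIMSEQ_inverse_real_of_nat by (simp add: inverse_eq_divide)
  have "\<forall>i. \<exists>k \<kappa>. \<forall>n. 1 - \<epsilon> i \<le> measure (P n) (polar k \<kappa>)"
    by (intro allI tempered_tight[OF P cos cont]) (simp add: \<epsilon>_def)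
  then obtain k \<kappa> where tight: "\<And>i n. 1 - \<epsilon> i \<le> measure (P n) (polar (k i) (\<kappa> i))" by metis
  obtain s N where s: "strict_mono s" and N: "prob_space N" "sets N = sets borel"
    and NK: "\<And>i. 1 - \<epsilon> i \<le> measure N (polar (k i) (\<kappa> i))"
    and conv: "\<And>(\<phi> :: 'n tempered \<Rightarrow> real) B. continuous_on UNIV \<phi> \<Longrightarrow> (\<And>F. \<bar>\<phi> F\<bar> \<le> B) \<Longrightarrow>
      (\<lambda>n. \<integral>F. \<phi> F \<partial>P (s n)) \<longlonglongrightarrow> (\<integral>F. \<phi> F \<partial>N)"
    using tempered_prokhorov[of P \<epsilon> k \<kappa>, OF P tight \<epsilon>] by metis
  have N_cos: "(\<integral>F. cos (bracket F f) \<partial>N) = Re (L f)" for f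
  proof (rule LIMSEQ_unique)
    show "(\<lambda>n. \<integral>F. cos (bracket F f) \<partial>P (s n)) \<longlonglongrightarrow> (\<integral>F. cos (bracket F f) \<partial>N)"
      by (rule conv[OF trig_continuous[OF trig_cos], of _ 1]) simp
    show "(\<lambda>n. \<integral>F. cos (bracket F f) \<partial>P (s n)) \<longlonglongrightarrow> Re (L f)"
      using LIMSEQ_subseq_LIMSEQ[OF cos s] by (simp add: comp_def)
  qed
  have N_sin: "(\<integral>F. sin (bracket F f) \<partial>N) = Im (L f)" for f
  proof (rule LIMSEQ_unique)
    show "(\<lambda>n. \<integral>F. sin (bracket F f) \<partial>P (s n)) \<longlonglongrightarrow> (\<integral>F. sin (bracket F f) \<partial>N)"
      by (rule conv[OF trig_continuous[OF trig_sin], of _ 1]) simp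
    show "(\<lambda>n. \<integral>F. sin (bracket F f) \<partial>P (s n)) \<longlonglongrightarrow> Im (L f)"
      using LIMSEQ_subseq_LIMSEQ[OF sin s] by (simp add: comp_def)
  qed
  \<comment> \<open>The trigonometric integrals under \<open>N\<close> are those prescribed by
    \<open>L\<close>, hence limits along the full sequence and not just along \<open>s\<close>. This
    is where the subsequence is left behind.\<close>
  have weak: "(\<lambda>n. \<integral>F. \<phi> F \<partial>P n) \<longlonglongrightarrow> (\<integral>F. \<phi> F \<partial>N)"
    if "continuous_on UNIV \<phi>" "\<And>F. \<bar>\<phi> F\<bar> \<le> B" for \<phi> :: "'n tempered \<Rightarrow> real" and B
  proof (rule trig_convergence_imp_weak_convergence[OF P N _ _ _ that])
    show "\<exists>k \<kappa>. (\<forall>n. 1 - e \<le> measure (P n) (polar k \<kappa>)) \<and> 1 - e \<le> measure N (polar k \<kappa>)" if e: "0 < e" for e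
    proof -
      obtain i where "\<epsilon> i < e"
        using order_tendstoD(2)[OF \<epsilon> e] by (auto simp: eventually_sequentially)
      then show ?thesis using tight[of i] NK[of i]
        by (intro exI[of _ "k i"] exI[of _ "\<kappa> i"] conjI allI) (meson diff_left_mono less_imp_le order_trans)+
    qed
  qed (use cos sin in \<open>simp_all add: N_cos N_sin\<close>)
  \<comment> \<open>The limit field is realized canonically, as the identity on the space of
    tempered distributions under the limit law.\<close>
  have Y: "generalized_random_field N (\<lambda>F. F)"
    using N by (simp add: generalized_random_field_def measurable_ident_sets)
  have law: "law N (\<lambda>F. F) = N" unfolding law_def by (rule distr_id2[OF N(2)[symmetric]])
  have "char_functional N (\<lambda>F. F) = L"
    by (rule ext) (simp add: char_functional_law[OF Y] law N_cos N_sin)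
  moreover have "converges_in_distribution M X N (\<lambda>F. F)"
    unfolding converges_in_distribution_def
  proof (intro allI impI, elim conjE)
    fix \<phi> :: "'n tempered \<Rightarrow> real" assume \<phi>: "continuous_on UNIV \<phi>" "bounded (range \<phi>)"
    then obtain B where "\<And>F. \<bar>\<phi> F\<bar> \<le> B" by (auto simp: bounded_iff)
    from weak[OF \<phi>(1) this]
    have "(\<lambda>n. LINT F|law (M (Suc n)) (X (Suc n)). \<phi> F) \<longlonglongrightarrow> (LINT F|law N (\<lambda>F. F). \<phi> F)"
      by (simp add: P_def law)
    then show "(\<lambda>n. LINT F|law (M n) (X n). \<phi> F) \<longlonglongrightarrow> (LINT F|law N (\<lambda>F. F). \<phi> F)"
      by (rule LIMSEQ_imp_Suc)
  qed
  ultimately show ?thesis using Y by blast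
qed

end
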